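(* Let $\Delta$ be the group of finite subsets of $\omega$ with the symmetric difference operation. Let $\Delta$ act freely and continuously on a Polish space $X$ and let $\mathcal{G}$ be a countable family of closed graphs on $X$, free over the action. If $A\subset X$ is an analytic set, exactly one of the following occurs: (1) $A\in I_{\mathcal{G}}$; (2) there is a continuous, injective near reduction of $\mathcal{H}$ to $\mathcal{G}$ with range included in $A$. Here $\mathcal{H}$ is the countable family of graphs on $2^\omega$ defined in the context.
   Context: A graph is a symmetric irreflexive binary relation; it is closed if it is closed as a subset of the complement of the diagonal. A $G$-anticlique is a set containing no two $G$-connected points; the Borel chromatic number of $G$ is the smallest cardinality of a collection of Borel $G$-anticliques covering the space. $I_{\mathcal{G}}$ is the $\sigma$-ideal on $X$ $\sigma$-generated by the Borel sets which are anticliques in at least one of the graphs in $\mathcal{G}$. Let a countable group $\Gamma$ act freely and continuously on a Polish space $X$ and let $\mathcal{G}$ be a countable family of graphs on $X$ such that each edge of each of them consists of orbit equivalent points. The family $\mathcal{G}$ is free over the action if the action naturally extends to a free action of $\Gamma$ on $\mathcal{G}$ (that is, $\gamma\cdot G=\{\langle\gamma\cdot x,\gamma\cdot y\rangle\colon\langle x,y\rangle\in G\}$ belongs to $\mathcal{G}$ for all $G\in\mathcal{G}$, $\gamma\in\Gamma$, and $\gamma\cdot G\neq G$ if $\gamma\neq 1$), and for any two distinct $G_0,G_1\in\mathcal{G}$ the Borel chromatic number of $G_0\cap G_1$ is countable. The family $\mathcal{H}$: let $\omega=\bigcup_na_n$ be a partition into infinite sets. For each $n\in\omega$, choose a dense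 set $b_n\subset 2^{<\omega}$ (every finite binary string has an extension in $b_n$) such that $|t|\in a_n$ for each $t\in b_n$, and $|s|\neq|t|$ for all $s\neq t\in b_n$. Let $H_n$ be the graph on $2^\omega$ connecting $x,y$ if there is exactly one $m$ such that $x(m)\neq y(m)$ and in addition $x\restriction m\in b_n$. $\Delta$ acts on $2^\omega$ by symmetric difference (identifying points of $2^\omega$ with subsets of $\omega$), and $\mathcal{H}$ is the closure of the set $\{H_n\colon n\in\omega\}$ under the action of $\Delta$. The sets $a_n,b_n$ are arbitrary but fixed. Let $H$ be a graph on a Polish space $Y$ and $G$ a graph on a Polish space $X$. A function $h$ with domain $D\subset Y$ is a reduction of $H$ to $G$ (on $D$) if for all $x,y\in D$, $\langle x,y\rangle\in H$ iff $\langle h(x),h(y)\rangle\in G$. A function $h\colon Y\to X$ is a near reduction of $H$ to $G$ if $Y$ can be decomposed into countably many Borel sets $B_n$, $n\in\omega$, such that $h\restriction B_n$ is a reduction of $H$ to $G$ for every $n$. A near reduction of a countable family $\mathcal{H}$ of graphs on $Y$ to a countable family $\mathcal{G}$ of graphs on $X$ is a continuous injection $h\colon Y\to X$ together with a bijection $\pi\colon\mathcal{H}\to\mathcal{G}$ such that for every $H\in\mathcal{H}$, $h$ is a near reduction of $H$ to $\pi(H)$.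
   Formalization: The family of graphs is assumed nonempty; for the empty family the ideal contains only the empty set and no bijection from the infinite family H exists, so for nonempty A neither alternative would hold. *)

theory Defs
  imports "HOL-Analysis.Analysis" "HOL-Algebra.Group_Action" "HOL-Library.Countable_Set_Type"
begin

unbundle cardinal_syntax

section \<open>Graphs, anticliques, Borel chromatic numbers\<close>

definition is_graph :: "('a \<times> 'a) set \<Rightarrow> bool" where
  "is_graph G \<longleftrightarrow> sym G \<and> irrefl G"

definition closed_graph :: "('a::topological_space \<times> 'a) set \<Rightarrow> bool" where
  "closed_graph G \<longleftrightarrow> is_graph G \<and> closedin (top_of_set (- Id)) G"

definition anticlique :: "('a \<times> 'a) set \<Rightarrow> 'a set \<Rightarrow> bool" where
  "anticlique G S \<longleftrightarrow> (\<forall>x\<in>S. \<forall>y\<in>S. (x, y) \<notin> G)"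

definition borel_anticlique_cover ::
    "('a::topological_space \<times> 'a) set \<Rightarrow> 'a set set \<Rightarrow> bool" where
  "borel_anticlique_cover G C \<longleftrightarrow>
     (\<forall>S\<in>C. S \<in> sets borel \<and> anticlique G S) \<and> \<Union>C = UNIV"

text \<open>Cardinals are represented by the cardinal orders of the library.  On a T1 space a cover
  exists (the singletons), so the choice below is well defined up to equality of cardinals.\<close>

definition borel_chromatic_number ::
    "('a::topological_space \<times> 'a) set \<Rightarrow> 'a set rel" where
  "borel_chromatic_number G =
     |SOME C. borel_anticlique_cover G C \<and> (\<forall>D. borel_anticlique_cover G D \<longrightarrow> |C| \<le>o |D| )|"

section \<open>The sigma-ideal of a family of graphs\<close>

definition sigma_ideal :: "'a set set \<Rightarrow> bool" where
  "sigma_ideal I \<longleftrightarrow>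
     {} \<in> I \<and>
     (\<forall>A B. A \<subseteq> B \<and> B \<in> I \<longrightarrow> A \<in> I) \<and>
     (\<forall>C. countable C \<and> C \<subseteq> I \<longrightarrow> \<Union>C \<in> I)"

definition graph_ideal :: "('a::topological_space \<times> 'a) set set \<Rightarrow> 'a set set" where
  "graph_ideal \<G> = sigma_ideal hull {B \<in> sets borel. \<exists>G\<in>\<G>. anticlique G B}"

section \<open>Actions and families of graphs free over an action\<close>

definition free_action :: "('g, 'm) monoid_scheme \<Rightarrow> 'a set \<Rightarrow> ('g \<Rightarrow> 'a \<Rightarrow> 'a) \<Rightarrow> bool" where
  "free_action \<Gamma> E \<phi> \<longleftrightarrow>
     group_action \<Gamma> E \<phi> \<and> (\<forall>x\<in>E. stabilizer \<Gamma> \<phi> x = {\<one>\<^bsub>\<Gamma>\<^esub>})"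

text \<open>The acting group is discrete, so continuity only concerns the individual group elements.\<close>

definition continuous_action ::
    "('g, 'm) monoid_scheme \<Rightarrow> ('g \<Rightarrow> 'a \<Rightarrow> 'a::topological_space) \<Rightarrow> bool" where
  "continuous_action \<Gamma> \<phi> \<longleftrightarrow>
     group_action \<Gamma> UNIV \<phi> \<and> (\<forall>\<gamma>\<in>carrier \<Gamma>. continuous_on UNIV (\<phi> \<gamma>))"

definition graph_act :: "('g \<Rightarrow> 'a \<Rightarrow> 'a) \<Rightarrow> 'g \<Rightarrow> ('a \<times> 'a) set \<Rightarrow> ('a \<times> 'a) set" where
  "graph_act \<phi> \<gamma> G = {(\<phi> \<gamma> x, \<phi> \<gamma> y) | x y. (x, y) \<in> G}"

definition edges_in_orbits ::
    "('g, 'm) monoid_scheme \<Rightarrow> ('g \<Rightarrow> 'a \<Rightarrow> 'a) \<Rightarrow> ('a \<times> 'a) set \<Rightarrow> bool" where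
  "edges_in_orbits \<Gamma> \<phi> G \<longleftrightarrow> (\<forall>(x, y)\<in>G. y \<in> orbit \<Gamma> \<phi> x)"

definition free_over_action ::
    "('g, 'm) monoid_scheme \<Rightarrow> ('g \<Rightarrow> 'a \<Rightarrow> 'a::topological_space) \<Rightarrow> ('a \<times> 'a) set set \<Rightarrow> bool" where
  "free_over_action \<Gamma> \<phi> \<G> \<longleftrightarrow>
     (\<forall>\<gamma>\<in>carrier \<Gamma>. \<forall>G\<in>\<G>. graph_act \<phi> \<gamma> G \<in> \<G>) \<and>
     (\<forall>\<gamma>\<in>carrier \<Gamma>. \<forall>G\<in>\<G>. \<gamma> \<noteq> \<one>\<^bsub>\<Gamma>\<^esub> \<longrightarrow> graph_act \<phi> \<gamma> G \<noteq> G) \<and>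
     (\<forall>G\<^sub>0\<in>\<G>. \<forall>G\<^sub>1\<in>\<G>. G\<^sub>0 \<noteq> G\<^sub>1 \<longrightarrow> borel_chromatic_number (G\<^sub>0 \<inter> G\<^sub>1) \<le>o natLeq)"

section \<open>Analytic sets\<close>

definition analytic :: "'a::topological_space set \<Rightarrow> bool" where
  "analytic A \<longleftrightarrow> A = {} \<or> (\<exists>f :: (nat \<Rightarrow> nat) \<Rightarrow> 'a. continuous_on UNIV f \<and> range f = A)"

section \<open>The family of graphs on the Cantor space\<close>

text \<open>The Cantor space is the type \<open>nat \<Rightarrow> bool\<close> with the product topology, finite binary
  strings are boolean lists.\<close>

definition Delta :: "nat set monoid" where
  "Delta = \<lparr>carrier = {\<gamma>. finite \<gamma>}, mult = sym_diff, one = {}\<rparr>"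

definition cantor_act :: "nat set \<Rightarrow> (nat \<Rightarrow> bool) \<Rightarrow> (nat \<Rightarrow> bool)" where
  "cantor_act \<gamma> x = (\<lambda>k. k \<in> sym_diff \<gamma> {i. x i})"

definition restr :: "(nat \<Rightarrow> bool) \<Rightarrow> nat \<Rightarrow> bool list" where
  "restr x m = map x [0..<m]"

definition graph_parameters :: "(nat \<Rightarrow> nat set) \<Rightarrow> (nat \<Rightarrow> bool list set) \<Rightarrow> bool" where
  "graph_parameters a b \<longleftrightarrow>
     disjoint_family a \<and> (\<Union>n. a n) = UNIV \<and> (\<forall>n. infinite (a n)) \<and>
     (\<forall>n. (\<forall>s. \<exists>u. s @ u \<in> b n) \<and>
          (\<forall>t\<in>b n. length t \<in> a n) \<and>
          (\<forall>s\<in>b n. \<forall>t\<in>b n. s \<noteq> t \<longrightarrow> length s \<noteq> length t))"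

definition cantor_graph :: "bool list set \<Rightarrow> ((nat \<Rightarrow> bool) \<times> (nat \<Rightarrow> bool)) set" where
  "cantor_graph T =
     {(x, y). \<exists>m. x m \<noteq> y m \<and> (\<forall>k. k \<noteq> m \<longrightarrow> x k = y k) \<and> restr x m \<in> T}"

definition cantor_family ::
    "(nat \<Rightarrow> bool list set) \<Rightarrow> ((nat \<Rightarrow> bool) \<times> (nat \<Rightarrow> bool)) set set" where
  "cantor_family b = {graph_act cantor_act \<gamma> (cantor_graph (b n)) | \<gamma> n. \<gamma> \<in> carrier Delta}"

section \<open>Near reductions\<close>

definition reduction_on ::
    "'b set \<Rightarrow> ('b \<Rightarrow> 'a) \<Rightarrow> ('b \<times> 'b) set \<Rightarrow> ('a \<times> 'a) set \<Rightarrow> bool" where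
  "reduction_on D h H G \<longleftrightarrow> (\<forall>x\<in>D. \<forall>y\<in>D. (x, y) \<in> H \<longleftrightarrow> (h x, h y) \<in> G)"

definition near_reduction ::
    "('b::topological_space \<Rightarrow> 'a) \<Rightarrow> ('b \<times> 'b) set \<Rightarrow> ('a \<times> 'a) set \<Rightarrow> bool" where
  "near_reduction h H G \<longleftrightarrow>
     (\<exists>B :: nat \<Rightarrow> 'b set. (\<forall>n. B n \<in> sets borel) \<and> disjoint_family B \<and> (\<Union>n. B n) = UNIV \<and>
        (\<forall>n. reduction_on (B n) h H G))"

definition family_near_reduction ::
    "('b::topological_space \<Rightarrow> 'a::topological_space) \<Rightarrow> (('b \<times> 'b) set \<Rightarrow> ('a \<times> 'a) set) \<Rightarrow>
     ('b \<times> 'b) set set \<Rightarrow> ('a \<times> 'a) set set \<Rightarrow> bool" where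
  "family_near_reduction h \<pi> \<H> \<G> \<longleftrightarrow>
     continuous_on UNIV h \<and> inj h \<and> bij_betw \<pi> \<H> \<G> \<and>
     (\<forall>H\<in>\<H>. near_reduction h H (\<pi> H))"

section \<open>Basic facts\<close>

lemma countable_borel_chromatic_number_iff:
  fixes G :: "('a::t1_space \<times> 'a) set"
  assumes "irrefl G"
  shows "borel_chromatic_number G \<le>o natLeq \<longleftrightarrow> (\<exists>C. countable C \<and> borel_anticlique_cover G C)"
proof -
  let ?P = "\<lambda>C. borel_anticlique_cover G C \<and> (\<forall>D. borel_anticlique_cover G D \<longrightarrow> |C| \<le>o |D| )"
  let ?R = "card_of ` Collect (borel_anticlique_cover G)"
  have "borel_anticlique_cover G (range (\<lambda>x. {x}))"
    using assms by (auto simp: borel_anticlique_cover_def anticlique_def irrefl_def)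
  then have "?R \<noteq> {}" by auto
  moreover have "\<forall>r\<in>?R. Card_order r" by (auto simp: card_of_Card_order)
  ultimately have "\<exists>r\<in>?R. \<forall>r'\<in>?R. r \<le>o r'"
    by (rule exists_minim_Card_order)
  then have "\<exists>C. ?P C" by simp
  then have P: "?P (SOME C. ?P C)" by (rule someI_ex)
  define C0 where "C0 = (SOME C. ?P C)"
  have C0: "?P C0" and chi: "borel_chromatic_number G = |C0|"
    using P unfolding C0_def borel_chromatic_number_def by simp_all
  show ?thesis
  proof
    assume "borel_chromatic_number G \<le>o natLeq"
    then have "countable C0" unfolding chi countable_card_le_natLeq .
    with C0 show "\<exists>C. countable C \<and> borel_anticlique_cover G C" by auto
  next
    assume "\<exists>C. countable C \<and> borel_anticlique_cover G C"
    then obtain C where "countable C" "borel_anticlique_cover G C" by auto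
    then have "|C0| \<le>o |C|" "|C| \<le>o natLeq"
      using C0 by (auto simp: countable_card_le_natLeq)
    then show "borel_chromatic_number G \<le>o natLeq"
      unfolding chi by (rule ordLeq_transitive)
  qed
qed

lemma group_Delta: "group Delta"
proof (rule groupI)
  fix x assume "x \<in> carrier Delta"
  then show "\<exists>y\<in>carrier Delta. y \<otimes>\<^bsub>Delta\<^esub> x = \<one>\<^bsub>Delta\<^esub>"
    by (auto simp: Delta_def)
qed (auto simp: Delta_def)

lemma free_action_cantor_act: "free_action Delta UNIV cantor_act"
proof -
  have inv: "cantor_act \<gamma> (cantor_act \<gamma> x) = x" for \<gamma> x
    by (auto simp: cantor_act_def fun_eq_iff)
  have bij: "cantor_act \<gamma> \<in> Bij UNIV" for \<gamma>
    unfolding Bij_def using o_bij[of "cantor_act \<gamma>" "cantor_act \<gamma>"] inv by (simp add: fun_eq_iff)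
  have "group_hom Delta (BijGroup UNIV) cantor_act"
    unfolding group_hom_def group_hom_axioms_def
  proof (intro conjI group_Delta group_BijGroup homI)
    fix x y
    have "cantor_act (sym_diff x y) = compose UNIV (cantor_act x) (cantor_act y)"
      unfolding cantor_act_def compose_def fun_eq_iff by simp blast
    then show "cantor_act (x \<otimes>\<^bsub>Delta\<^esub> y) =
        cantor_act x \<otimes>\<^bsub>BijGroup UNIV\<^esub> cantor_act y"
      by (simp add: BijGroup_def Delta_def bij)
  qed (simp add: BijGroup_def bij)
  moreover have "stabilizer Delta cantor_act x = {\<one>\<^bsub>Delta\<^esub>}" for x
    unfolding stabilizer_def Delta_def cantor_act_def fun_eq_iff by simp blast
  ultimately show ?thesis
    by (simp add: free_action_def group_action_def)
qed

end

theory Submission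
  imports Defs
begin

text \<open>The alternatives exclude each other by a Baire category argument: a Borel set which is comeager
  in an open subset of the Cantor space contains edges of every graph of the family.

  If \<open>A\<close> is not in the ideal, a fusion of analytic sets outside the ideal yields elements
  \<open>\<gamma> 0, \<gamma> 1, \<dots>\<close> of \<open>Delta\<close> and a continuous injection \<open>h\<close> into \<open>A\<close> such that flipping the
  \<open>m\<close>-th coordinate acts as \<open>\<gamma> m\<close>.  Hence \<open>h\<close> is equivariant for the homomorphism \<open>\<phi>\<close>
  sending \<open>{m}\<close> to \<open>\<gamma> m\<close>.  Along the way one picks representatives \<open>F 0, F 1, \<dots>\<close> of all
  orbits of the family under the image of \<open>\<phi>\<close>, and the translate by \<open>\<delta>\<close> of the graph
  given by \<open>b n\<close> is mapped to the translate of \<open>F n\<close> by \<open>\<phi> \<delta>\<close>.  If \<open>b n\<close> contains a string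
  of length \<open>m\<close>, then \<open>\<gamma> m\<close> is chosen so as to realize the corresponding edges of \<open>F n\<close>.

  The difficulty is to avoid further edges: if \<open>(x, \<gamma> k x)\<close> is an edge of \<open>G\<close>, it might happen that
  \<open>(x, \<gamma> k y)\<close> is an edge for all later edges \<open>(x, y)\<close>.  Then one replaces \<open>\<gamma> k\<close> by its product
  with a later element and repeats this; if it never stopped, the limit would be an edge of the
  closed graph \<open>G\<close> between points of different orbits.  Common edges of different graphs of the
  family are removed using the countable chromatic number of their intersection.\<close>

text \<open>Two obstacles shape the construction. The limit points have to stay in an analytic set,
  and so do their translates at all earlier stages; shrinking the sets in the space itself does not
  give this. The fusion therefore runs on closed sets of codes in the Baire space, a code containing
  codes of the point and of its translate at the previous stage. As the Baire space is not compact,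
  every stage also fixes a finite part of all codes, enough to determine the limit. Secondly, a
  stage can handle only finitely many graphs, and the graph realized later is not known when
  \<gamma> k is chosen. So the demands on \<gamma> k are density statements about positive sets, for
  all graphs of the family at once; they are cashed in when the later graph is known. A given graph
  is under control only from some stage on. This is why the result is a near reduction: its pieces
  fix the coordinates before that stage.\<close>

section \<open>Cylinders in spaces of sequences\<close>

definition cylinder :: "(nat \<Rightarrow> 'b) \<Rightarrow> nat \<Rightarrow> (nat \<Rightarrow> 'b) set" where
  "cylinder c n = {d. \<forall>i<n. d i = c i}"

lemma open_coordinate_eq:
  fixes v :: "'b::discrete_topology"
  shows "open {d :: 'i \<Rightarrow> 'b. d i = v}"
proof -
  have "open ((\<lambda>d :: 'i \<Rightarrow> 'b. d i) -` {v})"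
    by (rule open_vimage[OF open_discrete continuous_on_product_coordinates])
  then show ?thesis by (simp add: vimage_def)
qed

lemma closed_coordinate_eq:
  fixes v :: "'b::discrete_topology"
  shows "closed {d :: 'i \<Rightarrow> 'b. d i = v}"
proof -
  have "closed ((\<lambda>d :: 'i \<Rightarrow> 'b. d i) -` {v})"
    by (rule closed_vimage[OF closed_singleton continuous_on_product_coordinates])
  then show ?thesis by (simp add: vimage_def)
qed

lemma cylinder_Int: "cylinder c n = (\<Inter>i\<in>{..<n}. {d. d i = c i})"
  by (auto simp: cylinder_def)

lemma open_cylinder: "open (cylinder (c :: nat \<Rightarrow> 'b::discrete_topology) n)"
  unfolding cylinder_Int by (intro open_INT) (auto simp: open_coordinate_eq)

lemma closed_cylinder: "closed (cylinder (c :: nat \<Rightarrow> 'b::discrete_topology) n)"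
  unfolding cylinder_Int by (intro closed_INT ballI) (auto simp: closed_coordinate_eq)

lemma mem_cylinder_self: "c \<in> cylinder c n"
  by (simp add: cylinder_def)

lemma open_contains_cylinder:
  fixes U :: "(nat \<Rightarrow> 'b::topological_space) set"
  assumes "open U" "c \<in> U"
  obtains n where "cylinder c n \<subseteq> U"
proof -
  have "openin (product_topology (\<lambda>_. euclidean) (UNIV :: nat set)) U"
    using assms(1) by (simp add: open_fun_def)
  then obtain W where W: "finite {i. W i \<noteq> (UNIV :: 'b set)}" "c \<in> Pi\<^sub>E UNIV W" "Pi\<^sub>E UNIV W \<subseteq> U"
    using assms(2) unfolding openin_product_topology_alt by auto
  obtain n where n: "\<forall>i\<in>{i. W i \<noteq> UNIV}. i < n"
    using W(1) finite_nat_set_iff_bounded by blast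
  have "d i \<in> W i" if "d \<in> cylinder c n" for d i
  proof (cases "W i = UNIV")
    case False
    then have "d i = c i" using n that by (auto simp: cylinder_def)
    then show "d i \<in> W i" using W(2) by (auto simp: PiE_iff)
  qed (auto)
  then have "cylinder c n \<subseteq> Pi\<^sub>E UNIV W"
    by (auto simp: PiE_iff)
  then have "cylinder c n \<subseteq> U" using W(3) by (rule subset_trans)
  then show thesis by (rule that)
qed

lemma continuous_on_reindex:
  "continuous_on UNIV (\<lambda>c :: nat \<Rightarrow> 'b::topological_space. (\<lambda>n. c (f n)))"
  by (intro continuous_on_coordinatewise_then_product continuous_on_product_coordinates)

text \<open>Indexing by finite lists instead of points makes the cylinders of the Baire space a
  countable basis, as needed for countable unions and for the pigeonhole argument in
  \<open>code_step\<close>.\<close>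

definition string_cylinder :: "'b list \<Rightarrow> (nat \<Rightarrow> 'b) set" where
  "string_cylinder u = cylinder (\<lambda>i. u ! i) (length u)"

lemma open_eq_Union_cylinders:
  fixes U :: "(nat \<Rightarrow> nat) set"
  assumes "open U"
  shows "U = \<Union> (string_cylinder ` {u. string_cylinder u \<subseteq> U})"
proof (rule equalityI)
  show "U \<subseteq> \<Union> (string_cylinder ` {u. string_cylinder u \<subseteq> U})"
  proof
    fix c assume "c \<in> U"
    then obtain n where n: "cylinder c n \<subseteq> U" using open_contains_cylinder assms by blast
    have "string_cylinder (map c [0..<n]) = cylinder c n"
      unfolding string_cylinder_def cylinder_def by simp
    then show "c \<in> \<Union> (string_cylinder ` {u. string_cylinder u \<subseteq> U})"
      using n mem_cylinder_self by blast
  qed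
qed blast

section \<open>Analytic and Borel sets\<close>

text \<open>Images of closed subsets of the Baire space rather than of the whole space:
  intersections and restrictions then amount to closed conditions on codes, and the empty set needs
  no separate treatment.\<close>

definition souslin :: "'a::topological_space set \<Rightarrow> bool" where
  "souslin S \<longleftrightarrow> (\<exists>F (g :: (nat \<Rightarrow> nat) \<Rightarrow> 'a). closed F \<and> continuous_on UNIV g \<and> S = g ` F)"

definition closed_projection :: "(nat \<Rightarrow> nat) set \<Rightarrow> bool" where
  "closed_projection B \<longleftrightarrow> (\<exists>F :: ((nat \<Rightarrow> nat) \<times> (nat \<Rightarrow> nat)) set. closed F \<and> B = fst ` F)"

lemma closed_projection_closed: "closed B \<Longrightarrow> closed_projection B"
  unfolding closed_projection_def
  by (rule exI[of _ "B \<times> UNIV"]) (auto intro: closed_Times)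

text \<open>The first entry of the witness names the member of the union, the rest is a witness for
  that member. Written as an intersection of implications over all \<open>n\<close>, the condition
  is visibly closed.\<close>

lemma closed_projection_UN:
  assumes "\<And>n :: nat. closed_projection (B n)"
  shows "closed_projection (\<Union>n. B n)"
proof -
  have "\<forall>n. \<exists>F :: ((nat \<Rightarrow> nat) \<times> (nat \<Rightarrow> nat)) set. closed F \<and> B n = fst ` F"
    using assms unfolding closed_projection_def by blast
  from choice[OF this] obtain F :: "nat \<Rightarrow> ((nat \<Rightarrow> nat) \<times> (nat \<Rightarrow> nat)) set"
    where F: "\<And>n. closed (F n)" "\<And>n. B n = fst ` F n" by blast
  define E where "E = (\<Inter>n. {(x, y). y 0 \<noteq> n} \<union> (\<lambda>(x, y). (x, \<lambda>i. y (Suc i))) -` F n)"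
  have "closed {(x :: nat \<Rightarrow> nat, y :: nat \<Rightarrow> nat). y 0 \<noteq> n}" for n
  proof -
    have "open (UNIV \<times> {y :: nat \<Rightarrow> nat. y 0 = n} :: ((nat \<Rightarrow> nat) \<times> _) set)"
      by (intro open_Times open_UNIV open_coordinate_eq)
    moreover have "{(x :: nat \<Rightarrow> nat, y :: nat \<Rightarrow> nat). y 0 \<noteq> n} = - (UNIV \<times> {y. y 0 = n})" by auto
    ultimately show ?thesis by (simp add: closed_def)
  qed
  moreover have "continuous_on UNIV (\<lambda>(x :: nat \<Rightarrow> nat, y :: nat \<Rightarrow> nat). (x, \<lambda>i. y (Suc i)))"
    unfolding split_beta
    by (intro continuous_intros continuous_on_coordinatewise_then_product
        continuous_on_compose2[OF continuous_on_product_coordinates]) auto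
  ultimately have "closed E"
    unfolding E_def by (intro closed_INT ballI closed_Un closed_vimage F)
  moreover have "(\<Union>n. B n) = fst ` E"
  proof (intro equalityI subsetI)
    fix x assume "x \<in> (\<Union>n. B n)"
    then obtain n y where "(x, y) \<in> F n" using F(2) by auto
    then have "(x, case_nat n y) \<in> E" by (auto simp: E_def)
    then show "x \<in> fst ` E" by force
  next
    fix x assume "x \<in> fst ` E"
    then obtain y where "(x, y) \<in> E" by auto
    then have "(x, \<lambda>i. y (Suc i)) \<in> F (y 0)" by (auto simp: E_def)
    then show "x \<in> (\<Union>n. B n)" using F(2) by force
  qed
  ultimately show ?thesis unfolding closed_projection_def by blast
qed

text \<open>One sequence carries witnesses for all members at once, spread out by
  \<open>prod_encode\<close>.\<close>

lemma closed_projection_INT: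
  assumes "\<And>n :: nat. closed_projection (B n)"
  shows "closed_projection (\<Inter>n. B n)"
proof -
  have "\<forall>n. \<exists>F :: ((nat \<Rightarrow> nat) \<times> (nat \<Rightarrow> nat)) set. closed F \<and> B n = fst ` F"
    using assms unfolding closed_projection_def by blast
  from choice[OF this] obtain F :: "nat \<Rightarrow> ((nat \<Rightarrow> nat) \<times> (nat \<Rightarrow> nat)) set"
    where F: "\<And>n. closed (F n)" "\<And>n. B n = fst ` F n" by blast
  define E where "E = (\<Inter>n. (\<lambda>(x, y). (x, \<lambda>i. y (prod_encode (n, i)))) -` F n)"
  have "continuous_on UNIV (\<lambda>(x :: nat \<Rightarrow> nat, y :: nat \<Rightarrow> nat). (x, \<lambda>i. y (prod_encode (n, i))))"
    for n
    unfolding split_beta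
    by (intro continuous_intros continuous_on_coordinatewise_then_product
        continuous_on_compose2[OF continuous_on_product_coordinates]) auto
  then have "closed E"
    unfolding E_def by (intro closed_INT ballI closed_vimage F)
  moreover have "(\<Inter>n. B n) = fst ` E"
  proof (intro equalityI subsetI)
    fix x assume "x \<in> (\<Inter>n. B n)"
    then have "\<forall>n. x \<in> fst ` F n" by (simp add: F(2))
    then have "\<forall>n. \<exists>y. (x, y) \<in> F n" by force
    from choice[OF this] obtain y where "\<And>n. (x, y n) \<in> F n" by blast
    then have "(x, \<lambda>k. case prod_decode k of (n, i) \<Rightarrow> y n i) \<in> E" by (auto simp: E_def)
    then show "x \<in> fst ` E" by force
  next
    fix x assume "x \<in> fst ` E"
    then obtain y where "(x, y) \<in> E" by auto
    then have "(x, \<lambda>i. y (prod_encode (n, i))) \<in> F n" for n by (auto simp: E_def)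
    then show "x \<in> (\<Inter>n. B n)" using F(2) by force
  qed
  ultimately show ?thesis unfolding closed_projection_def by blast
qed

lemma closed_projection_open:
  assumes "open U"
  shows "closed_projection U"
proof -
  define V :: "nat \<Rightarrow> (nat \<Rightarrow> nat) set" where "V n = (if string_cylinder (from_nat n) \<subseteq> U then string_cylinder (from_nat n) else {})"
    for n
  have "U \<subseteq> (\<Union>n. V n)"
  proof
    fix c assume "c \<in> U"
    then obtain u where "c \<in> string_cylinder u" "string_cylinder u \<subseteq> U"
      using open_eq_Union_cylinders[OF assms] by blast
    then have "c \<in> V (to_nat u)" unfolding V_def by simp
    then show "c \<in> (\<Union>n. V n)" by blast
  qed
  moreover have "V n \<subseteq> U" for n unfolding V_def by simp
  moreover have "closed (V n)" for n
    unfolding V_def string_cylinder_def by (simp add: closed_cylinder)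
  ultimately have "U = (\<Union>n. V n)" "\<And>n. closed_projection (V n)"
    using closed_projection_closed by blast+
  then show ?thesis
    using closed_projection_UN[of V] by simp
qed

text \<open>The induction carries the complement along, because projections of closed sets are not
  stable under complements. This is why open sets are needed as a base case besides the closed
  ones.\<close>

lemma closed_projection_borel:
  assumes "B \<in> sets borel"
  shows "closed_projection B"
proof -
  have "B \<in> sigma_sets UNIV (Collect closed)"
    using assms by (simp add: borel_eq_closed)
  then have "closed_projection B \<and> closed_projection (- B)"
  proof (induction B rule: sigma_sets.induct)
    case (Basic a)
    then show ?case by (auto intro: closed_projection_closed closed_projection_open)
  next
    case Empty
    then show ?case by (auto intro: closed_projection_closed)
  next
    case (Compl a)
    then show ?case by (simp add: Compl_eq_Diff_UNIV[symmetric])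
  next
    case (Union a)
    then show ?case by (simp add: closed_projection_UN closed_projection_INT)
  qed
  then show ?thesis by blast
qed

lemma souslin_image:
  fixes f :: "'a::topological_space \<Rightarrow> 'b::topological_space"
  assumes "continuous_on UNIV f" "souslin S"
  shows "souslin (f ` S)"
proof -
  obtain F g where F: "closed F" "continuous_on UNIV (g :: (nat \<Rightarrow> nat) \<Rightarrow> 'a)" "S = g ` F"
    using assms unfolding souslin_def by blast
  have "continuous_on UNIV (f \<circ> g)"
    using F(2) assms(1) continuous_on_compose continuous_on_subset by blast
  then show ?thesis unfolding souslin_def using F by (metis image_comp)
qed

lemma analytic_imp_souslin: "analytic A \<Longrightarrow> souslin A"
proof -
  assume "analytic A"
  then consider "A = {}" | f :: "(nat \<Rightarrow> nat) \<Rightarrow> 'a" where "continuous_on UNIV f" "range f = A"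
    unfolding analytic_def by blast
  then show ?thesis
  proof cases
    case 1
    then show ?thesis unfolding souslin_def
      by (intro exI[of _ "{}"] exI[of _ "\<lambda>_. undefined"]) auto
  next
    case 2
    then show ?thesis unfolding souslin_def by blast
  qed
qed

text \<open>Even and odd entries of a code hold codes of the same point for both sets. That the two
  points coincide is a closed condition in a Hausdorff space.\<close>

lemma souslin_Int:
  fixes S T :: "'a::t2_space set"
  assumes "souslin S" "souslin T"
  shows "souslin (S \<inter> T)"
proof -
  obtain F g where F: "closed F" "continuous_on UNIV (g :: (nat \<Rightarrow> nat) \<Rightarrow> 'a)" "S = g ` F"
    using assms unfolding souslin_def by blast
  obtain E h where E: "closed E" "continuous_on UNIV (h :: (nat \<Rightarrow> nat) \<Rightarrow> 'a)" "T = h ` E"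
    using assms unfolding souslin_def by blast
  define p q :: "(nat \<Rightarrow> nat) \<Rightarrow> nat \<Rightarrow> nat" where "p = (\<lambda>c n. c (2 * n))" and "q = (\<lambda>c n. c (2 * n + 1))"
  have pq: "continuous_on UNIV p" "continuous_on UNIV q"
    unfolding p_def q_def by (rule continuous_on_reindex)+
  have gh: "continuous_on UNIV (\<lambda>c. g (p c))" "continuous_on UNIV (\<lambda>c. h (q c))"
    by (rule continuous_on_compose2[OF F(2) pq(1)] continuous_on_compose2[OF E(2) pq(2)]; simp)+
  define K where "K = p -` F \<inter> q -` E \<inter> {c. g (p c) = h (q c)}"
  have "closed K"
    unfolding K_def using F(1) E(1) pq gh
    by (intro closed_Int closed_vimage closed_Collect_eq)
  moreover have "S \<inter> T = (\<lambda>c. g (p c)) ` K"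
  proof (intro equalityI subsetI)
    fix x assume "x \<in> S \<inter> T"
    then obtain c d where cd: "c \<in> F" "x = g c" "d \<in> E" "x = h d" using F(3) E(3) by auto
    define e where "e = (\<lambda>n. if even n then c (n div 2) else d (n div 2))"
    have "p e = c" "q e = d" by (auto simp: e_def p_def q_def)
    then have "e \<in> K" "x = g (p e)" using cd by (auto simp: K_def)
    then show "x \<in> (\<lambda>c. g (p c)) ` K" by blast
  next
    fix x assume "x \<in> (\<lambda>c. g (p c)) ` K"
    then obtain c where "p c \<in> F" "q c \<in> E" "x = g (p c)" "x = h (q c)" by (auto simp: K_def)
    then show "x \<in> S \<inter> T" using F(3) E(3) by blast
  qed
  ultimately show ?thesis unfolding souslin_def using gh(1) by blast
qed

text \<open>\<open>B\<close> is pulled back to a Borel subset of the Baire space, where it is a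
  projection of a closed set; the odd entries then hold the witness for that projection.\<close>

lemma souslin_Int_borel:
  fixes S B :: "'a::topological_space set"
  assumes "souslin S" "B \<in> sets borel"
  shows "souslin (S \<inter> B)"
proof -
  obtain F g where F: "closed F" "continuous_on UNIV (g :: (nat \<Rightarrow> nat) \<Rightarrow> 'a)" "S = g ` F"
    using assms unfolding souslin_def by blast
  have "g \<in> borel_measurable borel" using F(2) by (rule borel_measurable_continuous_onI)
  then have "g -` B \<in> sets borel"
    using assms(2) by (metis measurable_sets_borel)
  then obtain K where K: "closed K" "g -` B = fst ` (K :: ((nat \<Rightarrow> nat) \<times> (nat \<Rightarrow> nat)) set)"
    using closed_projection_borel unfolding closed_projection_def by blast
  define p q :: "(nat \<Rightarrow> nat) \<Rightarrow> nat \<Rightarrow> nat" where "p = (\<lambda>c n. c (2 * n))" and "q = (\<lambda>c n. c (2 * n + 1))"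
  have pq: "continuous_on UNIV p" "continuous_on UNIV q"
    unfolding p_def q_def by (rule continuous_on_reindex)+
  define E where "E = p -` F \<inter> (\<lambda>c. (p c, q c)) -` K"
  have "closed E" unfolding E_def
    by (intro closed_Int closed_vimage continuous_on_Pair pq F K)
  moreover have "continuous_on UNIV (\<lambda>c. g (p c))"
    by (rule continuous_on_compose2[OF F(2) pq(1)]) simp
  moreover have "S \<inter> B = (\<lambda>c. g (p c)) ` E"
  proof (intro equalityI subsetI)
    fix x assume x: "x \<in> S \<inter> B"
    then obtain c where c: "c \<in> F" "x = g c" using F(3) by auto
    then have "c \<in> g -` B" using x by simp
    then obtain d where d: "(c, d) \<in> K" using K(2) by auto
    define e where "e = (\<lambda>n. if even n then c (n div 2) else d (n div 2))"
    have "p e = c" "q e = d" by (auto simp: e_def p_def q_def)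
    then have "e \<in> E" "x = g (p e)" using c d by (auto simp: E_def)
    then show "x \<in> (\<lambda>c. g (p c)) ` E" by blast
  next
    fix x assume "x \<in> (\<lambda>c. g (p c)) ` E"
    then obtain c where c: "p c \<in> F" "(p c, q c) \<in> K" "x = g (p c)" by (auto simp: E_def)
    then have "p c \<in> g -` B" using K(2) by force
    then show "x \<in> S \<inter> B" using c F(3) by auto
  qed
  ultimately show ?thesis unfolding souslin_def by blast
qed

section \<open>Lusin separation\<close>

definition borel_separated :: "'a::topological_space set \<Rightarrow> 'a set \<Rightarrow> bool" where
  "borel_separated P Q \<longleftrightarrow> (\<exists>B\<in>sets borel. P \<subseteq> B \<and> B \<inter> Q = {})"

text \<open>For fixed \<open>i\<close>, intersect the separating sets over \<open>j\<close>; then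
  take the union over \<open>i\<close>.\<close>

lemma borel_separated_UN:
  assumes "\<And>(i :: nat) (j :: nat). borel_separated (P i) (Q j)"
  shows "borel_separated (\<Union>i. P i) (\<Union>j. Q j)"
proof -
  have "\<forall>ij. \<exists>B. B \<in> sets borel \<and> P (fst ij) \<subseteq> B \<and> B \<inter> Q (snd ij) = {}"
  proof
    fix ij
    show "\<exists>B. B \<in> sets borel \<and> P (fst ij) \<subseteq> B \<and> B \<inter> Q (snd ij) = {}"
      using assms[of "fst ij" "snd ij"] unfolding borel_separated_def by blast
  qed
  from choice[OF this] obtain C
    where C: "\<And>ij. C ij \<in> sets borel \<and> P (fst ij) \<subseteq> C ij \<and> C ij \<inter> Q (snd ij) = {}" by blast
  define B where "B i j = C (i, j)" for i j
  have B: "B i j \<in> sets borel" "P i \<subseteq> B i j" "B i j \<inter> Q j = {}" for i j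
    using C[of "(i, j)"] by (auto simp: B_def)
  have "(\<Union>i. \<Inter>j. B i j) \<in> sets borel" using B(1) by (intro sets.countable_UN'' sets.countable_INT'') auto
  moreover have "(\<Union>i. P i) \<subseteq> (\<Union>i. \<Inter>j. B i j)" using B(2) by blast
  moreover have "(\<Union>i. \<Inter>j. B i j) \<inter> (\<Union>j. Q j) = {}" using B(3) by blast
  ultimately show ?thesis unfolding borel_separated_def by blast
qed

lemma UN_cylinder_upd: "(\<Union>k. cylinder (c(n := k)) (Suc n)) = cylinder c n"
proof (intro equalityI subsetI)
  fix d assume "d \<in> cylinder c n"
  then have "d \<in> cylinder (c(n := d n)) (Suc n)" by (auto simp: cylinder_def less_Suc_eq)
  then show "d \<in> (\<Union>k. cylinder (c(n := k)) (Suc n))" by blast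
next
  fix d assume "d \<in> (\<Union>k. cylinder (c(n := k)) (Suc n))"
  then obtain k where "\<forall>i<Suc n. d i = (c(n := k)) i" unfolding cylinder_def by blast
  then show "d \<in> cylinder c n" unfolding cylinder_def by (simp add: less_Suc_eq)
qed

text \<open>If two sets cannot be separated, then by \<open>borel_separated_UN\<close> neither can
  some pair of pieces given by longer cylinders. The limit branches have different images, whose
  disjoint neighbourhoods separate all sufficiently small pieces, a contradiction.\<close>

lemma lusin_separation:
  fixes S T :: "'a::t2_space set"
  assumes "souslin S" "souslin T" "S \<inter> T = {}"
  shows "borel_separated S T"
proof (rule ccontr)
  obtain F g where F: "closed F" "continuous_on UNIV (g :: (nat \<Rightarrow> nat) \<Rightarrow> 'a)" "S = g ` F"
    using assms unfolding souslin_def by blast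
  obtain E h where E: "closed E" "continuous_on UNIV (h :: (nat \<Rightarrow> nat) \<Rightarrow> 'a)" "T = h ` E"
    using assms unfolding souslin_def by blast
  \<comment> \<open>Only the first \<open>n\<close> entries of the two sequences in \<open>s\<close>
    count; the remaining ones are arbitrary.\<close>
  define P where "P n s = (\<not> borel_separated (g ` (F \<inter> cylinder (fst s) n)) (h ` (E \<inter> cylinder (snd s) n)))" for n s
  define Q where "Q n s t = (\<exists>k l. fst t = (fst s)(n := k) \<and> snd t = (snd s)(n := l))"
    for n and s t :: "(nat \<Rightarrow> nat) \<times> (nat \<Rightarrow> nat)"
  assume "\<not> borel_separated S T"
  then have "P 0 (undefined, undefined)"
    by (simp add: P_def cylinder_def F E)
  then have "\<exists>s. P 0 s" by blast
  moreover have "\<exists>t. P (Suc n) t \<and> Q n s t" if "P n s" for n s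
  proof (rule ccontr)
    assume "\<not> ?thesis"
    then have "borel_separated (g ` (F \<inter> cylinder ((fst s)(n := k)) (Suc n)))
       (h ` (E \<inter> cylinder ((snd s)(n := l)) (Suc n)))" for k l
      unfolding P_def Q_def by (metis fst_conv snd_conv)
    then have "borel_separated (\<Union>k. g ` (F \<inter> cylinder ((fst s)(n := k)) (Suc n)))
       (\<Union>l. h ` (E \<inter> cylinder ((snd s)(n := l)) (Suc n)))"
      by (rule borel_separated_UN)
    then have "borel_separated (g ` (F \<inter> (\<Union>k. cylinder ((fst s)(n := k)) (Suc n))))
       (h ` (E \<inter> (\<Union>l. cylinder ((snd s)(n := l)) (Suc n))))"
      by (simp only: image_UN[symmetric] Int_UN_distrib)
    then show False using that unfolding P_def UN_cylinder_upd by blast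
  qed
  ultimately obtain w where w: "\<And>n. P n (w n)" "\<And>n. Q n (w n) (w (Suc n))"
    using dependent_nat_choice[of P Q] by blast
  define c d where "c = (\<lambda>i. fst (w (Suc i)) i)" and "d = (\<lambda>i. snd (w (Suc i)) i)"
  have stable: "fst (w (Suc i + k)) i = c i \<and> snd (w (Suc i + k)) i = d i" for i k
  proof (induction k)
    case (Suc k)
    then show ?case using w(2)[of "Suc i + k"] by (auto simp: Q_def)
  qed (simp add: c_def d_def)
  have "fst (w n) i = c i \<and> snd (w n) i = d i" if "i < n" for n i
    using stable[of i "n - Suc i"] that by simp
  then have cyl: "cylinder (fst (w n)) n = cylinder c n" "cylinder (snd (w n)) n = cylinder d n" for n
    by (auto simp: cylinder_def)
  have nsep: "\<not> borel_separated (g ` (F \<inter> cylinder c n)) (h ` (E \<inter> cylinder d n))" for n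
    using w(1)[of n] unfolding P_def cyl .
  have empty: "borel_separated {} Y" "borel_separated Y {}" for Y :: "'a set"
    unfolding borel_separated_def by (auto intro: bexI[of _ "{}"] bexI[of _ UNIV])
  \<comment> \<open>The branch cannot leave the closed set: otherwise a piece would be empty, hence
    separated.\<close>
  have "c \<in> F"
  proof (rule ccontr)
    assume "c \<notin> F"
    then obtain n where "cylinder c n \<subseteq> - F" 
      using open_contains_cylinder[of "- F" c] F(1) by (auto simp: open_Compl)
    then have "F \<inter> cylinder c n = {}" by blast
    then show False using nsep[of n] empty by simp
  qed
  moreover have "d \<in> E"
  proof (rule ccontr)
    assume "d \<notin> E"
    then obtain n where "cylinder d n \<subseteq> - E" 
      using open_contains_cylinder[of "- E" d] E(1) by (auto simp: open_Compl)
    then have "E \<inter> cylinder d n = {}" by blast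
    then show False using nsep[of n] empty by simp
  qed
  ultimately have "g c \<noteq> h d" using assms(3) F(3) E(3) by blast
  then obtain U V where UV: "open U" "open V" "g c \<in> U" "h d \<in> V" "U \<inter> V = {}"
    using hausdorff[of "g c" "h d"] by blast
  obtain n where n: "cylinder c n \<subseteq> g -` U"
    using open_contains_cylinder[of "g -` U" c] UV F(2) open_vimage by blast
  obtain m where m: "cylinder d m \<subseteq> h -` V"
    using open_contains_cylinder[of "h -` V" d] UV E(2) open_vimage by blast
  have "cylinder c (max n m) \<subseteq> cylinder c n" "cylinder d (max n m) \<subseteq> cylinder d m"
    by (auto simp: cylinder_def)
  then have "g ` (F \<inter> cylinder c (max n m)) \<subseteq> U" "U \<inter> h ` (E \<inter> cylinder d (max n m)) = {}"
    using n m UV(5) by blast+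
  then have "borel_separated (g ` (F \<inter> cylinder c (max n m))) (h ` (E \<inter> cylinder d (max n m)))"
    unfolding borel_separated_def using UV(1) by (intro bexI[of _ U]) auto
  then show False using nsep by blast
qed

section \<open>Baire category in the Cantor space\<close>

text \<open>Makes \<open>nat \<Rightarrow> bool\<close> second countable, so that the category
  lemmas below apply to the Cantor space.\<close>

instance bool :: second_countable_topology
proof
  show "\<exists>B :: bool set set. countable B \<and> open = generate_topology B"
    by (intro exI[of _ "range lessThan \<union> range greaterThan"]) (auto simp: open_bool_def)
qed

definition nowhere_dense :: "'a::topological_space set \<Rightarrow> bool" where
  "nowhere_dense N \<longleftrightarrow> (\<forall>U. open U \<and> U \<noteq> {} \<longrightarrow> (\<exists>V. open V \<and> V \<noteq> {} \<and> V \<subseteq> U \<and> V \<inter> N = {}))"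

definition meagre :: "'a::topological_space set \<Rightarrow> bool" where
  "meagre M \<longleftrightarrow> (\<exists>N :: nat \<Rightarrow> 'a set. (\<forall>n. nowhere_dense (N n)) \<and> M \<subseteq> (\<Union>n. N n))"

lemma meagre_subset: "meagre M \<Longrightarrow> L \<subseteq> M \<Longrightarrow> meagre L"
  unfolding meagre_def by blast

lemma nowhere_dense_imp_meagre: "nowhere_dense N \<Longrightarrow> meagre N"
  unfolding meagre_def by (rule exI[of _ "\<lambda>_. N"]) simp

lemma nowhere_dense_empty: "nowhere_dense {}"
  unfolding nowhere_dense_def by blast

lemma meagre_UN:
  assumes "\<And>n :: nat. meagre (M n)"
  shows "meagre (\<Union>n. M n)"
proof -
  have "\<forall>n. \<exists>N :: nat \<Rightarrow> 'a set. (\<forall>i. nowhere_dense (N i)) \<and> M n \<subseteq> (\<Union>i. N i)"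
    using assms unfolding meagre_def by simp
  from choice[OF this] obtain N :: "nat \<Rightarrow> nat \<Rightarrow> 'a set"
    where N: "\<And>n i. nowhere_dense (N n i)" "\<And>n. M n \<subseteq> (\<Union>i. N n i)" by blast
  define L where "L k = (case prod_decode k of (n, i) \<Rightarrow> N n i)" for k
  have "nowhere_dense (L k)" for k
    unfolding L_def using N(1) by (simp split: prod.split)
  moreover have "(\<Union>n. M n) \<subseteq> (\<Union>k. L k)"
  proof
    fix x assume "x \<in> (\<Union>n. M n)"
    then obtain n i where "x \<in> N n i" using N(2) by blast
    then have "x \<in> L (prod_encode (n, i))" by (simp add: L_def)
    then show "x \<in> (\<Union>k. L k)" by blast
  qed
  ultimately show ?thesis unfolding meagre_def by blast
qed

lemma meagre_Union:
  assumes "countable C" "\<And>M. M \<in> C \<Longrightarrow> meagre M"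
  shows "meagre (\<Union>C)"
proof (cases "C = {}")
  case True
  then show ?thesis using nowhere_dense_imp_meagre[OF nowhere_dense_empty] by simp
next
  case False
  have "from_nat_into C n \<in> C" for n using False by (rule from_nat_into)
  then have "meagre (\<Union>n. from_nat_into C n)"
    by (intro meagre_UN assms(2))
  then show ?thesis using range_from_nat_into[OF False assms(1)] by simp
qed

lemma meagre_Un: "meagre M \<Longrightarrow> meagre L \<Longrightarrow> meagre (M \<union> L)"
  using meagre_Union[of "{M, L}"] by auto

lemma meagre_vimage_involution:
  assumes "continuous_on UNIV f" and inv: "\<And>x. f (f x) = x" and "meagre M"
  shows "meagre (f -` M)"
proof -
  have ne: "f -` U \<noteq> {}" if ne: "U \<noteq> {}" for U
  proof -
    obtain x where "x \<in> U" using ne by blast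
    then have "f x \<in> f -` U" by (simp add: inv)
    then show ?thesis by blast
  qed
  have "nowhere_dense (f -` N)" if nd: "nowhere_dense N" for N
    unfolding nowhere_dense_def
  proof (intro allI impI)
    fix U :: "'a set" assume "open U \<and> U \<noteq> {}"
    then have U: "open (f -` U)" "f -` U \<noteq> {}"
      using open_vimage[OF _ assms(1)] ne by blast+
    obtain V where V: "open V" "V \<noteq> {}" "V \<subseteq> f -` U" "V \<inter> N = {}"
      using nd[unfolded nowhere_dense_def, rule_format, of "f -` U"] U by blast
    have "f -` V \<subseteq> U"
    proof
      fix x assume "x \<in> f -` V"
      then have "f (f x) \<in> U" using V(3) by blast
      then show "x \<in> U" by (simp add: inv)
    qed
    moreover have "f -` V \<inter> f -` N = {}" using V(4) by blast
    moreover have "open (f -` V)" "f -` V \<noteq> {}" using open_vimage[OF V(1) assms(1)] ne V(2) by auto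
    ultimately show "\<exists>V. open V \<and> V \<noteq> {} \<and> V \<subseteq> U \<and> V \<inter> f -` N = {}" by blast
  qed
  note nd = this
  obtain N :: "nat \<Rightarrow> 'a set" where N: "\<And>n. nowhere_dense (N n)" "M \<subseteq> (\<Union>n. N n)"
    using assms(3) unfolding meagre_def by blast
  have "(\<forall>n. nowhere_dense (f -` N n)) \<and> f -` M \<subseteq> (\<Union>n. f -` N n)"
  proof (intro conjI allI nd N(1))
    show "f -` M \<subseteq> (\<Union>n. f -` N n)" using N(2) by blast
  qed
  then show ?thesis unfolding meagre_def by (intro exI[of _ "\<lambda>n. f -` N n"])
qed

text \<open>A form of the Baire property that avoids choosing an open set approximating \<open>B\<close>.\<close>

definition category_decided :: "'a::topological_space set \<Rightarrow> bool" where
  "category_decided B \<longleftrightarrow>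
     (\<forall>U. open U \<and> U \<noteq> {} \<longrightarrow>
        (\<exists>V. open V \<and> V \<noteq> {} \<and> V \<subseteq> U \<and> (meagre (V \<inter> B) \<or> meagre (V - B))))"

text \<open>The basic open sets on which \<open>B\<close> is meagre are countably many, and their
  union is dense in \<open>U\<close> because the other alternative of
  \<open>category_decided\<close> is excluded.\<close>

lemma category_decided_meagre:
  fixes B :: "'a::second_countable_topology set"
  assumes "category_decided B" "open U"
    and "\<And>V. open V \<Longrightarrow> V \<noteq> {} \<Longrightarrow> V \<subseteq> U \<Longrightarrow> \<not> meagre (V - B)"
  shows "meagre (U \<inter> B)"
proof -
  obtain \<B> :: "'a set set" where \<B>: "countable \<B>" "topological_basis \<B>"
    using ex_countable_basis by blast
  define \<V> where "\<V> = {V \<in> \<B>. V \<subseteq> U \<and> meagre (V \<inter> B)}"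
  have "nowhere_dense (U - \<Union>\<V>)"
    unfolding nowhere_dense_def
  proof (intro allI impI)
    fix W :: "'a set" assume W: "open W \<and> W \<noteq> {}"
    show "\<exists>V. open V \<and> V \<noteq> {} \<and> V \<subseteq> W \<and> V \<inter> (U - \<Union>\<V>) = {}"
    proof (cases "W \<inter> U = {}")
      case True
      then show ?thesis using W by blast
    next
      case False
      then obtain V where V: "open V" "V \<noteq> {}" "V \<subseteq> W \<inter> U" "meagre (V \<inter> B) \<or> meagre (V - B)"
        using assms(1,2) W unfolding category_decided_def by (metis open_Int)
      then have m: "meagre (V \<inter> B)" using assms(3)[of V] by blast
      obtain x where x: "x \<in> V" using V(2) by blast
      obtain V' where V': "V' \<in> \<B>" "x \<in> V'" "V' \<subseteq> V"
        using topological_basisE[OF \<B>(2) V(1) x] by blast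
      have "meagre (V' \<inter> B)" using m V'(3) by (blast intro: meagre_subset)
      then have "V' \<in> \<V>" using V' V(3) by (auto simp: \<V>_def)
      moreover have "open V'" using topological_basis_open[OF \<B>(2) V'(1)] .
      ultimately show ?thesis using V' V(3) by blast
    qed
  qed
  moreover have "meagre (\<Union>((\<lambda>V. V \<inter> B) ` \<V>))"
    using \<B>(1) by (intro meagre_Union) (auto simp: \<V>_def)
  ultimately have "meagre (\<Union>((\<lambda>V. V \<inter> B) ` \<V>) \<union> (U - \<Union>\<V>))"
    using meagre_Un nowhere_dense_imp_meagre by blast
  then show ?thesis by (rule meagre_subset) blast
qed

text \<open>The notion is symmetric under complements. For a union, either some member is comeager
  in an open part of \<open>U\<close>, and then so is the union, or all members are meagre in
  \<open>U\<close>.\<close>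

lemma category_decided_borel:
  fixes B :: "'a::second_countable_topology set"
  assumes "B \<in> sets borel"
  shows "category_decided B"
proof -
  have m0: "meagre ({} :: 'a set)" using nowhere_dense_imp_meagre[OF nowhere_dense_empty] .
  have "B \<in> sigma_sets UNIV {S. open S}"
    using assms by (simp add: borel_def)
  then show ?thesis
  proof (induction B rule: sigma_sets.induct)
    case (Basic a)
    show ?case unfolding category_decided_def
    proof (intro allI impI)
      fix U :: "'a set" assume U: "open U \<and> U \<noteq> {}"
      show "\<exists>V. open V \<and> V \<noteq> {} \<and> V \<subseteq> U \<and> (meagre (V \<inter> a) \<or> meagre (V - a))"
      proof (cases "U \<inter> a = {}")
        case True
        then show ?thesis using U m0 by (intro exI[of _ U]) simp
      next
        case False
        have e: "U \<inter> a - a = {}" by blast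
        show ?thesis using U False Basic m0
          by (intro exI[of _ "U \<inter> a"]) (simp add: open_Int e)
      qed
    qed
  next
    case Empty
    then show ?case unfolding category_decided_def using m0 by (metis Int_empty_right order_refl)
  next
    case (Compl a)
    have "V \<inter> (UNIV - a) = V - a" "V - (UNIV - a) = V \<inter> a" for V :: "'a set" by blast+
    then show ?case using Compl.IH unfolding category_decided_def by metis
  next
    case (Union a)
    show ?case unfolding category_decided_def
    proof (intro allI impI)
      fix U :: "'a set" assume U: "open U \<and> U \<noteq> {}"
      show "\<exists>V. open V \<and> V \<noteq> {} \<and> V \<subseteq> U \<and> (meagre (V \<inter> \<Union> (range a)) \<or> meagre (V - \<Union> (range a)))"
      proof (cases "\<exists>i V. open V \<and> V \<noteq> {} \<and> V \<subseteq> U \<and> meagre (V - a i)")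
        case True
        then obtain i V where V: "open V" "V \<noteq> {}" "V \<subseteq> U" "meagre (V - a i)" by blast
        have "meagre (V - \<Union> (range a))" by (rule meagre_subset[OF V(4)]) blast
        then show ?thesis using V by blast
      next
        case False
        then have "meagre (U \<inter> a i)" for i
          using category_decided_meagre[OF Union.IH[of i], of U] U by blast
        then have "meagre (\<Union>i. U \<inter> a i)" by (rule meagre_UN)
        moreover have "(\<Union>i. U \<inter> a i) = U \<inter> \<Union> (range a)" by blast
        ultimately have "meagre (U \<inter> \<Union> (range a))" by simp
        then show ?thesis using U by blast
      qed
    qed
  qed
qed

lemma cantor_space_baire:
  assumes "open U" "U \<noteq> {}"
  shows "\<not> meagre (U :: (nat \<Rightarrow> bool) set)"
proof
  assume "meagre U"
  then obtain N :: "nat \<Rightarrow> (nat \<Rightarrow> bool) set"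
    where N: "\<And>n. nowhere_dense (N n)" "U \<subseteq> (\<Union>n. N n)"
    unfolding meagre_def by blast
  let ?X = "euclidean :: (nat \<Rightarrow> bool) topology"
  have "compact_space (euclidean :: bool topology)"
    by (simp add: compact_space_def finite_imp_compact)
  then have cs: "compact_space ?X"
    unfolding euclidean_product_topology[symmetric] by (simp add: compact_space_product_topology)
  have "Hausdorff_space (euclidean :: bool topology)" unfolding Hausdorff_space_def
    using hausdorff[where 'a = bool] by (simp add: disjnt_def)
  then have hs: "Hausdorff_space ?X"
    unfolding euclidean_product_topology[symmetric] by (simp add: Hausdorff_space_product_topology)
  have "interior (closure (N n)) = {}" for n
  proof (rule ccontr)
    assume "interior (closure (N n)) \<noteq> {}"
    then obtain V where V: "open V" "V \<noteq> {}" "V \<subseteq> interior (closure (N n))" "V \<inter> N n = {}"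
      using N(1)[of n, unfolded nowhere_dense_def, rule_format, of "interior (closure (N n))"]
      by auto
    then have "V \<inter> closure (N n) = {}" using open_Int_closure_eq_empty[of V "N n"] by simp
    then show False
      using V(2,3) interior_subset[of "closure (N n)"] by blast
  qed
  then have "?X interior_of \<Union> (range (\<lambda>n. closure (N n))) = {}"
    by (intro Baire_category_alt)
      (use cs hs in \<open>auto simp: compact_imp_locally_compact_space compact_Hausdorff_imp_regular_space\<close>)
  then have "interior (\<Union>n. closure (N n)) = {}" by simp
  moreover have "U \<subseteq> (\<Union>n. closure (N n))" 
    by (rule subset_trans[OF N(2)]) (intro UN_mono closure_subset order_refl)
  then have "U \<subseteq> interior (\<Union>n. closure (N n))" using assms(1) by (rule interior_maximal)
  ultimately show False using assms(2) by blast
qed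

section \<open>Coordinate flips and category in the Cantor space\<close>

lemma cantor_act_apply: "cantor_act \<gamma> x k \<longleftrightarrow> (k \<in> \<gamma>) \<noteq> x k"
  by (auto simp: cantor_act_def)

lemma cantor_act_twice: "cantor_act \<gamma> (cantor_act \<gamma> x) = x"
  by (auto simp: cantor_act_apply fun_eq_iff)

lemma continuous_cantor_act: "continuous_on UNIV (cantor_act \<gamma>)"
proof (rule continuous_on_coordinatewise_then_product)
  fix k
  have "cantor_act \<gamma> x k = (if k \<in> \<gamma> then \<not> x k else x k)" for x
    by (simp add: cantor_act_apply)
  moreover have "continuous_on UNIV (\<lambda>x :: nat \<Rightarrow> bool. g (x k))" for g :: "bool \<Rightarrow> bool"
    by (rule continuous_on_compose2[of UNIV g]) (auto intro: continuous_on_product_coordinates)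
  from this[of "\<lambda>v. if k \<in> \<gamma> then \<not> v else v"]
  show "continuous_on UNIV (\<lambda>x. cantor_act \<gamma> x k)" unfolding calculation .
qed

lemma graph_act_cantor_iff:
  "(x, y) \<in> graph_act cantor_act \<gamma> H \<longleftrightarrow> (cantor_act \<gamma> x, cantor_act \<gamma> y) \<in> H"
  unfolding graph_act_def mem_Collect_eq prod.inject by (metis cantor_act_twice)

text \<open>Some \<open>K\<close> is nonmeagre, hence comeager in an open set. Flipping one
  coordinate \<open>m\<close> maps a small cylinder homeomorphically to itself, so some point and
  its flip both lie in \<open>K\<close>; by density of \<open>b n\<close>, the cylinder and
  \<open>m\<close> can be chosen such that they form an edge.\<close>

lemma no_cantor_anticlique_cover:
  assumes par: "graph_parameters a b"
    and \<K>: "countable \<K>" "\<Union>\<K> = UNIV"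
    and K: "\<And>K. K \<in> \<K> \<Longrightarrow> K \<in> sets borel \<and> (\<exists>H\<in>cantor_family b. anticlique H K)"
  shows False
proof -
  have "\<not> meagre (UNIV :: (nat \<Rightarrow> bool) set)" by (rule cantor_space_baire) auto
  then obtain K where K': "K \<in> \<K>" "\<not> meagre K" using meagre_Union[OF \<K>(1)] \<K>(2) by metis
  then have "category_decided K" using K category_decided_borel by blast
  then obtain U where U: "open U" "U \<noteq> {}" "meagre (U - K)"
    using category_decided_meagre[of K UNIV] K'(2) by auto
  obtain \<delta> n where d: "finite \<delta>" and ac: "anticlique (graph_act cantor_act \<delta> (cantor_graph (b n))) K"
    using K[OF K'(1)] by (auto simp: cantor_family_def Delta_def)
  obtain x0 where "x0 \<in> U" using U(2) by blast
  then obtain k where k: "cylinder x0 k \<subseteq> U" using open_contains_cylinder U(1) by blast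
  obtain N0 where N0: "\<forall>d\<in>\<delta>. d < N0" using d finite_nat_set_iff_bounded by blast
  define N where "N = max k N0"
  obtain u where u: "restr (cantor_act \<delta> x0) N @ u \<in> b n"
    using par unfolding graph_parameters_def by blast
  \<comment> \<open>The string extends the translate of \<open>x0\<close>, not \<open>x0\<close>
    itself: an edge of the translated graph is tested against \<open>b n\<close> after acting by
    \<delta>.\<close>
  define t where "t = restr (cantor_act \<delta> x0) N @ u"
  define m where "m = length t"
  have mN: "N \<le> m" by (simp add: m_def t_def restr_def)
  define w where "w = cantor_act \<delta> (\<lambda>i. i < m \<and> t ! i)"
  have w0: "w i = x0 i" if "i < k" for i
    using that mN by (auto simp: w_def cantor_act_apply t_def restr_def nth_append N_def)
  have tw: "restr (cantor_act \<delta> x) m = t" if "x \<in> cylinder w m" for x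
  proof -
    have "cantor_act \<delta> x i = t ! i" if "i < m" for i
      using \<open>x \<in> cylinder w m\<close> that by (auto simp: cylinder_def w_def cantor_act_apply)
    then show ?thesis by (intro nth_equalityI) (simp_all add: restr_def m_def)
  qed
  have "cylinder w m \<subseteq> cylinder x0 k"
    using w0 mN by (auto simp: cylinder_def N_def)
  then have wU: "cylinder w m \<subseteq> U" using k by blast
  let ?f = "cantor_act {m}"
  have fw: "?f x \<in> cylinder w m" if "x \<in> cylinder w m" for x
    using that by (auto simp: cylinder_def cantor_act_apply)
  have "\<not> meagre (cylinder w m)"
    by (rule cantor_space_baire) (use open_cylinder mem_cylinder_self in blast)+
  moreover have "meagre ((U - K) \<union> ?f -` (U - K))"
    by (intro meagre_Un U(3) meagre_vimage_involution continuous_cantor_act cantor_act_twice)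
  ultimately obtain x where x: "x \<in> cylinder w m" "x \<notin> U - K" "?f x \<notin> U - K"
    using meagre_subset by blast
  then have "x \<in> K" "?f x \<in> K" using wU fw by blast+
  moreover have "(x, ?f x) \<in> graph_act cantor_act \<delta> (cantor_graph (b n))"
    unfolding graph_act_cantor_iff cantor_graph_def
    using tw[OF x(1)] u unfolding t_def[symmetric]
    by (auto intro!: exI[of _ m] simp: cantor_act_apply)
  ultimately show False using ac unfolding anticlique_def by blast
qed

section \<open>Positive analytic sets\<close>

definition borel_anticliques :: "('a::topological_space \<times> 'a) set set \<Rightarrow> 'a set set" where
  "borel_anticliques \<G> = {B \<in> sets borel. \<exists>G\<in>\<G>. anticlique G B}"

definition countably_covered :: "'a set set \<Rightarrow> 'a set \<Rightarrow> bool" where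
  "countably_covered X S \<longleftrightarrow> (\<exists>C. countable C \<and> C \<subseteq> X \<and> S \<subseteq> \<Union>C)"

lemma countably_covered_subset: "countably_covered X S \<Longrightarrow> R \<subseteq> S \<Longrightarrow> countably_covered X R"
  unfolding countably_covered_def by (meson subset_trans)

lemma countably_covered_Union:
  assumes "countable D" "\<And>S. S \<in> D \<Longrightarrow> countably_covered X S"
  shows "countably_covered X (\<Union>D)"
proof -
  have "\<forall>S\<in>D. \<exists>C. countable C \<and> C \<subseteq> X \<and> S \<subseteq> \<Union>C"
    using assms(2) unfolding countably_covered_def by simp
  from bchoice[OF this] obtain f
    where "\<forall>S\<in>D. countable (f S) \<and> f S \<subseteq> X \<and> S \<subseteq> \<Union>(f S)" by (elim exE)
  then have f: "countable (f S) \<and> f S \<subseteq> X \<and> S \<subseteq> \<Union>(f S)" if "S \<in> D" for S using that by (rule bspec)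
  have "countable (\<Union>S\<in>D. f S)" using assms(1) f by (intro countable_UN) auto
  moreover have "(\<Union>S\<in>D. f S) \<subseteq> X" using f by (intro UN_least) simp
  moreover have "\<Union>D \<subseteq> \<Union>(\<Union>S\<in>D. f S)"
  proof (rule Union_least)
    fix S assume S: "S \<in> D"
    then have "f S \<subseteq> (\<Union>S\<in>D. f S)" by blast
    then have "\<Union>(f S) \<subseteq> \<Union>(\<Union>S\<in>D. f S)" by (rule Union_mono)
    then show "S \<subseteq> \<Union>(\<Union>S\<in>D. f S)" using f[OF S] by (meson subset_trans)
  qed
  ultimately show ?thesis unfolding countably_covered_def by (intro exI[of _ "\<Union>S\<in>D. f S"]) simp
qed

lemma countably_covered_base: "B \<in> X \<Longrightarrow> countably_covered X B"
  unfolding countably_covered_def by (intro exI[of _ "{B}"]) simp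

text \<open>The concrete description of the hull yields a Borel superset in the ideal for every
  member, see \<open>graph_ideal_borel_cover\<close>; removing such a superset keeps a set
  analytic.\<close>

lemma graph_ideal_iff: "S \<in> graph_ideal \<G> \<longleftrightarrow> countably_covered (borel_anticliques \<G>) S"
proof
  define X where "X = borel_anticliques \<G>"
  have hull: "graph_ideal \<G> = \<Inter>{T. sigma_ideal T \<and> X \<subseteq> T}"
    by (simp add: graph_ideal_def hull_def X_def borel_anticliques_def)
  have "sigma_ideal {S. countably_covered X S}"
    unfolding sigma_ideal_def
  proof (intro conjI allI impI)
    show "{} \<in> {S. countably_covered X S}"
      unfolding countably_covered_def by (intro CollectI exI[of _ "{}"]) simp
  next
    fix A B assume "A \<subseteq> B \<and> B \<in> {S. countably_covered X S}"
    then show "A \<in> {S. countably_covered X S}" using countably_covered_subset[of X B A] by simp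
  next
    fix D assume "countable D \<and> D \<subseteq> {S. countably_covered X S}"
    then show "\<Union>D \<in> {S. countably_covered X S}" using countably_covered_Union[of D X] by (simp add: subset_eq)
  qed
  moreover have "X \<subseteq> {S. countably_covered X S}"
    using countably_covered_base by auto
  ultimately show "S \<in> graph_ideal \<G> \<Longrightarrow> countably_covered X S" unfolding hull by blast
  assume "countably_covered X S"
  then obtain C where C: "countable C" "C \<subseteq> X" "S \<subseteq> \<Union>C" unfolding countably_covered_def by blast
  show "S \<in> graph_ideal \<G>" unfolding hull
  proof
    fix T assume "T \<in> {T. sigma_ideal T \<and> X \<subseteq> T}"
    then have T: "sigma_ideal T" "C \<subseteq> T" using C(2) by blast+
    then have "\<Union>C \<in> T" using C(1) unfolding sigma_ideal_def by simp
    moreover have "\<And>A B. A \<subseteq> B \<Longrightarrow> B \<in> T \<Longrightarrow> A \<in> T" using T(1) unfolding sigma_ideal_def by meson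
    ultimately show "S \<in> T" using C(3) by simp
  qed
qed

lemma graph_ideal_subset: "S \<in> graph_ideal \<G> \<Longrightarrow> R \<subseteq> S \<Longrightarrow> R \<in> graph_ideal \<G>"
  unfolding graph_ideal_iff by (rule countably_covered_subset)

lemma graph_ideal_Union:
  assumes "countable D" "\<And>S. S \<in> D \<Longrightarrow> S \<in> graph_ideal \<G>"
  shows "\<Union>D \<in> graph_ideal \<G>"
  using assms unfolding graph_ideal_iff by (rule countably_covered_Union)

lemma graph_ideal_base: "B \<in> borel_anticliques \<G> \<Longrightarrow> B \<in> graph_ideal \<G>"
  unfolding graph_ideal_iff by (rule countably_covered_base)

lemma graph_ideal_borel_cover:
  assumes "S \<in> graph_ideal \<G>"
  obtains B where "B \<in> sets borel" "B \<in> graph_ideal \<G>" "S \<subseteq> B"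
proof -
  obtain C where C: "countable C" "C \<subseteq> borel_anticliques \<G>" "S \<subseteq> \<Union>C"
    using assms unfolding graph_ideal_iff countably_covered_def by blast
  have "\<Union>C \<in> sets borel" using C by (intro sets.countable_Union) (auto simp: borel_anticliques_def)
  moreover have "\<Union>C \<in> graph_ideal \<G>"
    using C(1,2) graph_ideal_base by (intro graph_ideal_Union) auto
  ultimately show thesis using that C(3) by blast
qed

lemma empty_in_graph_ideal: "{} \<in> graph_ideal \<G>"
  unfolding graph_ideal_iff countably_covered_def by (intro exI[of _ "{}"]) simp

text \<open>The positive sets act as forcing conditions. Analyticity is part of the notion since
  only for analytic sets does lying outside the ideal produce edges.\<close>

definition pos :: "('a::topological_space \<times> 'a) set set \<Rightarrow> 'a set \<Rightarrow> bool" where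
  "pos \<G> S \<longleftrightarrow> souslin S \<and> S \<notin> graph_ideal \<G>"

lemma pos_nonempty: "pos \<G> S \<Longrightarrow> S \<noteq> {}"
  unfolding pos_def using empty_in_graph_ideal by blast

lemma pos_borel_cover:
  assumes "pos \<G> S" "countable C" "\<And>B. B \<in> C \<Longrightarrow> B \<in> sets borel" "S \<subseteq> \<Union>C"
  obtains B where "B \<in> C" "pos \<G> (S \<inter> B)"
proof -
  have "\<exists>B\<in>C. S \<inter> B \<notin> graph_ideal \<G>"
  proof (rule ccontr)
    assume "\<not> ?thesis"
    then have "\<Union>((\<inter>) S ` C) \<in> graph_ideal \<G>"
      using assms(2) by (intro graph_ideal_Union) auto
    moreover have "S \<subseteq> \<Union>((\<inter>) S ` C)" using assms(4) by blast
    ultimately have "S \<in> graph_ideal \<G>" by (rule graph_ideal_subset)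
    then show False using assms(1) by (simp add: pos_def)
  qed
  then obtain B where B: "B \<in> C" "S \<inter> B \<notin> graph_ideal \<G>" by blast
  moreover have "souslin (S \<inter> B)"
    using assms(1,3) B(1) by (intro souslin_Int_borel) (auto simp: pos_def)
  ultimately show thesis using that by (simp add: pos_def)
qed

text \<open>By Lindelof, countably many of the neighbourhoods cover \<open>S\<close>, and one of
  them leaves a positive set.\<close>

lemma pos_local:
  fixes S :: "'a::second_countable_topology set"
  assumes "pos \<G> S" "\<And>x. x \<in> S \<Longrightarrow> \<exists>U. open U \<and> x \<in> U \<and> Q (S \<inter> U)"
  obtains T where "pos \<G> T" "T \<subseteq> S" "Q T"
proof -
  define \<U> where "\<U> = {U. open U \<and> Q (S \<inter> U)}"
  obtain \<V> where V: "\<V> \<subseteq> \<U>" "countable \<V>" "\<Union>\<V> = \<Union>\<U>"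
    using Lindelof[of \<U>] by (auto simp: \<U>_def)
  have "S \<subseteq> \<Union>\<V>" unfolding V(3) \<U>_def using assms(2) by blast
  moreover have "U \<in> sets borel" if "U \<in> \<V>" for U using that V(1) by (auto simp: \<U>_def)
  ultimately obtain U where "U \<in> \<V>" "pos \<G> (S \<inter> U)"
    using pos_borel_cover[OF assms(1) V(2)] by blast
  then show thesis using that[of "S \<inter> U"] V(1) by (auto simp: \<U>_def)
qed

text \<open>Finitely many requirements which are dense below \<open>S\<close> and inherited by
  subsets are met one after the other.\<close>

lemma pos_dense_finite:
  assumes "finite K" "pos \<G> S"
    and "\<And>k T. k \<in> K \<Longrightarrow> pos \<G> T \<Longrightarrow> T \<subseteq> S \<Longrightarrow> \<exists>T'. pos \<G> T' \<and> T' \<subseteq> T \<and> Q k T'"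
    and mono: "\<And>k T T'. k \<in> K \<Longrightarrow> Q k T \<Longrightarrow> T' \<subseteq> T \<Longrightarrow> Q k T'"
  shows "\<exists>T. pos \<G> T \<and> T \<subseteq> S \<and> (\<forall>k\<in>K. Q k T)"
  using assms(1,3,4)
proof (induction K rule: finite_induct)
  case empty
  then show ?case using assms(2) by blast
next
  case (insert k K)
  have "\<exists>T. pos \<G> T \<and> T \<subseteq> S \<and> (\<forall>k\<in>K. Q k T)"
    by (rule insert.IH) (use insert.prems in \<open>blast+\<close>)
  then obtain T where T: "pos \<G> T" "T \<subseteq> S" "\<forall>k\<in>K. Q k T" by blast
  obtain T' where T': "pos \<G> T'" "T' \<subseteq> T" "Q k T'" using insert.prems(1)[of k T] T by blast
  have "Q j T'" if "j \<in> K" for j using insert.prems(2)[of j T T'] T(3) T'(2) that by blast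
  then show ?case using T T' by blast
qed

text \<open>There are only countably many \<gamma>. If all \<open>E \<gamma>\<close> were in the
  ideal, Borel supersets of them in the ideal could be removed from \<open>S\<close>, leaving a
  positive set which meets none of them. This is the device by which a group element depending on
  the point is made constant.\<close>

lemma pos_meets:
  assumes S: "pos \<G> S"
    and E: "\<And>\<gamma>. finite \<gamma> \<Longrightarrow> souslin (E \<gamma>)"
    and meets: "\<And>R. pos \<G> R \<Longrightarrow> R \<subseteq> S \<Longrightarrow> \<exists>\<gamma> :: nat set. finite \<gamma> \<and> R \<inter> E \<gamma> \<noteq> {}"
  obtains \<gamma> where "finite \<gamma>" "pos \<G> (E \<gamma>)"
proof -
  have "\<exists>\<gamma>. finite \<gamma> \<and> E \<gamma> \<notin> graph_ideal \<G>"
  proof (rule ccontr)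
    assume "\<not> ?thesis"
    then have "\<forall>\<gamma>\<in>Collect finite. \<exists>B. B \<in> sets borel \<and> B \<in> graph_ideal \<G> \<and> E \<gamma> \<subseteq> B"
      by (metis graph_ideal_borel_cover mem_Collect_eq)
    from bchoice[OF this] obtain B
      where B: "\<And>\<gamma>. finite \<gamma> \<Longrightarrow> B \<gamma> \<in> sets borel \<and> B \<gamma> \<in> graph_ideal \<G> \<and> E \<gamma> \<subseteq> B \<gamma>" by blast
    define W where "W = (\<Union>\<gamma>\<in>Collect finite. B \<gamma>)"
    have c: "countable (Collect finite :: nat set set)" by (rule countable_Collect_finite)
    have W: "W \<in> sets borel" unfolding W_def
      using B c by (intro sets.countable_UN'') auto
    have Wi: "W \<in> graph_ideal \<G>" unfolding W_def
      using B c by (intro graph_ideal_Union) auto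
    have "souslin (S - W)"
      using souslin_Int_borel[of S "- W"] S W by (simp add: pos_def Diff_eq)
    moreover have "S - W \<notin> graph_ideal \<G>"
    proof
      assume "S - W \<in> graph_ideal \<G>"
      then have "\<Union>{S - W, W} \<in> graph_ideal \<G>" using Wi by (intro graph_ideal_Union) auto
      then have "S \<in> graph_ideal \<G>" by (rule graph_ideal_subset) blast
      then show False using S by (simp add: pos_def)
    qed
    ultimately obtain \<gamma> where \<gamma>: "finite \<gamma>" "(S - W) \<inter> E \<gamma> \<noteq> {}"
      using meets[of "S - W"] by (auto simp: pos_def)
    have "E \<gamma> \<subseteq> W" using B[OF \<gamma>(1)] \<gamma>(1) by (auto simp: W_def)
    then show False using \<gamma>(2) by blast
  qed
  then show thesis using that E by (auto simp: pos_def)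
qed

section \<open>Families of graphs over a free action\<close>

locale free_graph_family =
  fixes act :: "nat set \<Rightarrow> 'a \<Rightarrow> 'a::polish_space" and \<G> :: "('a \<times> 'a) set set"
  assumes act_empty: "act {} x = x"
    and act_act: "finite \<gamma> \<Longrightarrow> finite \<delta> \<Longrightarrow> act \<gamma> (act \<delta> x) = act (sym_diff \<gamma> \<delta>) x"
    and act_free: "finite \<gamma> \<Longrightarrow> act \<gamma> x = x \<Longrightarrow> \<gamma> = {}"
    and continuous_act: "finite \<gamma> \<Longrightarrow> continuous_on UNIV (act \<gamma>)"
    and countable_family: "countable \<G>"
    and graph_sym: "G \<in> \<G> \<Longrightarrow> (x, y) \<in> G \<Longrightarrow> (y, x) \<in> G"
    and graph_irrefl: "G \<in> \<G> \<Longrightarrow> (x, x) \<notin> G"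
    and graph_orbit: "G \<in> \<G> \<Longrightarrow> (x, y) \<in> G \<Longrightarrow> \<exists>\<gamma>. finite \<gamma> \<and> y = act \<gamma> x"
    and graph_closed: "G \<in> \<G> \<Longrightarrow> closedin (top_of_set (- Id)) G"
    and graph_act_in: "finite \<gamma> \<Longrightarrow> G \<in> \<G> \<Longrightarrow> graph_act act \<gamma> G \<in> \<G>"
    and graph_act_free: "finite \<gamma> \<Longrightarrow> G \<in> \<G> \<Longrightarrow> graph_act act \<gamma> G = G \<Longrightarrow> \<gamma> = {}"
    and graph_chromatic: "G \<in> \<G> \<Longrightarrow> G' \<in> \<G> \<Longrightarrow> G \<noteq> G' \<Longrightarrow>
      \<exists>C. countable C \<and> borel_anticlique_cover (G \<inter> G') C"
begin

lemma act_invol: "finite \<gamma> \<Longrightarrow> act \<gamma> (act \<gamma> x) = x"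
  by (simp add: act_act act_empty)

lemma act_commute: "finite \<gamma> \<Longrightarrow> finite \<delta> \<Longrightarrow> act \<gamma> (act \<delta> x) = act \<delta> (act \<gamma> x)"
  by (simp add: act_act Un_commute)

lemma act_inj:
  assumes "finite \<gamma>" "finite \<delta>" "act \<gamma> x = act \<delta> x"
  shows "\<gamma> = \<delta>"
proof -
  have "act \<delta> (act \<gamma> x) = x" using assms by (simp add: act_invol)
  then have "act (sym_diff \<delta> \<gamma>) x = x" using assms(1,2) by (simp add: act_act)
  then have "sym_diff \<delta> \<gamma> = {}" using assms(1,2) by (intro act_free[of "sym_diff \<delta> \<gamma>" x]) auto
  then show ?thesis by blast
qed

lemma graph_act_iff: "finite \<gamma> \<Longrightarrow> (x, y) \<in> graph_act act \<gamma> G \<longleftrightarrow> (act \<gamma> x, act \<gamma> y) \<in> G"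
  unfolding graph_act_def mem_Collect_eq prod.inject
  by (rule iffI, elim exE conjE, simp add: act_invol, rule exI[of _ "act \<gamma> x"], rule exI[of _ "act \<gamma> y"])
    (simp add: act_invol)

lemma graph_act_graph_act:
  assumes "finite \<gamma>" "finite \<delta>"
  shows "graph_act act \<gamma> (graph_act act \<delta> G) = graph_act act (sym_diff \<gamma> \<delta>) G"
proof -
  have "(x, y) \<in> graph_act act \<gamma> (graph_act act \<delta> G) \<longleftrightarrow> (x, y) \<in> graph_act act (sym_diff \<gamma> \<delta>) G"
    for x y using assms by (simp add: graph_act_iff act_act Un_commute)
  then show ?thesis by auto
qed

lemma graph_act_empty: "graph_act act {} G = G"
  by (simp add: graph_act_def act_empty)

lemma graph_act_inj:
  assumes "finite \<gamma>" "finite \<delta>" "G \<in> \<G>" "graph_act act \<gamma> G = graph_act act \<delta> G"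
  shows "\<gamma> = \<delta>"
proof -
  have "graph_act act (sym_diff \<gamma> \<delta>) G = graph_act act \<gamma> (graph_act act \<gamma> G)"
    using assms by (simp add: graph_act_graph_act)
  also have "\<dots> = G" using assms(1) by (simp add: graph_act_graph_act graph_act_empty)
  finally have "sym_diff \<gamma> \<delta> = {}" using assms by (intro graph_act_free) auto
  then show ?thesis by blast
qed

lemma graph_closure:
  assumes "G \<in> \<G>"
  obtains T where "closed T" "G = T - Id"
  using graph_closed[OF assms] unfolding closedin_closed by blast

lemma graph_nbhd:
  assumes "G \<in> \<G>" "x \<noteq> y" "(x, y) \<notin> G"
  obtains U V where "open U" "open V" "x \<in> U" "y \<in> V" "U \<times> V \<inter> G = {}"
proof -
  obtain T where T: "closed T" "G = T - Id" using graph_closure[OF assms(1)] .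
  then have "open (- T)" "(x, y) \<in> - T" using assms by auto
  then obtain U V where "open U" "open V" "x \<in> U" "y \<in> V" "U \<times> V \<subseteq> - T"
    by (auto elim: open_prod_elim)
  then show thesis using that T(2) by blast
qed

lemma graph_limit:
  assumes "G \<in> \<G>" "X \<longlonglongrightarrow> x" "Y \<longlonglongrightarrow> y" "\<And>n. (X n, Y n) \<in> G" "x \<noteq> y"
  shows "(x, y) \<in> G"
proof -
  obtain T where T: "closed T" "G = T - Id" using graph_closure[OF assms(1)] .
  have "(\<lambda>n. (X n, Y n)) \<longlonglongrightarrow> (x, y)" using assms(2,3) by (rule tendsto_Pair)
  then have "(x, y) \<in> T"
    using closed_sequentially[OF T(1), of "\<lambda>n. (X n, Y n)"] assms(4) T(2) by blast
  then show ?thesis using T(2) assms(5) by simp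
qed

text \<open>The graphs are closed only off the diagonal. Since the action is free, the pairs
  \<open>(x, act \<gamma> x)\<close> avoid the diagonal for nonempty \<gamma>, so the closure of the
  graph adds nothing.\<close>

lemma closed_graph_section:
  assumes "G \<in> \<G>" "finite \<gamma>"
  shows "closed {x. (x, act \<gamma> x) \<in> G}"
proof (cases "\<gamma> = {}")
  case True
  then show ?thesis using graph_irrefl[OF assms(1)] by (simp add: act_empty)
next
  case False
  obtain T where T: "closed T" "G = T - Id" using graph_closure[OF assms(1)] .
  have "act \<gamma> x \<noteq> x" for x using act_free[OF assms(2)] False by blast
  then have "(x, act \<gamma> x) \<notin> Id" for x by (metis pair_in_Id_conv)
  then have "{x. (x, act \<gamma> x) \<in> G} = (\<lambda>x. (x, act \<gamma> x)) -` T"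
    unfolding T(2) by blast
  then show ?thesis
    using T(1) continuous_act[OF assms(2)]
    by (simp add: closed_vimage continuous_on_Pair continuous_on_id)
qed

lemma act_image_eq_vimage:
  assumes "finite \<gamma>"
  shows "act \<gamma> ` B = act \<gamma> -` B"
proof (intro equalityI subsetI)
  fix x assume "x \<in> act \<gamma> -` B"
  then have "x = act \<gamma> (act \<gamma> x)" "act \<gamma> x \<in> B" using assms by (simp_all add: act_invol)
  then show "x \<in> act \<gamma> ` B" by (rule image_eqI)
qed (use assms in \<open>auto simp: act_invol\<close>)

lemma act_borel:
  assumes "finite \<gamma>" "B \<in> sets borel"
  shows "act \<gamma> ` B \<in> sets borel"
proof -
  have "act \<gamma> \<in> borel_measurable borel"
    using continuous_act[OF assms(1)] by (rule borel_measurable_continuous_onI)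
  then show ?thesis
    using assms by (metis act_image_eq_vimage measurable_sets_borel)
qed

lemma graph_ideal_act:
  assumes "finite \<gamma>" "S \<in> graph_ideal \<G>"
  shows "act \<gamma> ` S \<in> graph_ideal \<G>"
proof -
  obtain C where C: "countable C" "C \<subseteq> borel_anticliques \<G>" "S \<subseteq> \<Union>C"
    using assms unfolding graph_ideal_iff countably_covered_def by blast
  have "act \<gamma> ` B \<in> borel_anticliques \<G>" if B: "B \<in> C" for B
  proof -
    obtain G where G: "G \<in> \<G>" "anticlique G B" "B \<in> sets borel"
      using C(2) B unfolding borel_anticliques_def by blast
    have "anticlique (graph_act act \<gamma> G) (act \<gamma> ` B)"
      using G(2) assms(1) by (auto simp: anticlique_def graph_act_iff act_invol)
    then show ?thesis
      using graph_act_in[OF assms(1) G(1)] act_borel[OF assms(1) G(3)] unfolding borel_anticliques_def by blast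
  qed
  then have "\<Union>((`) (act \<gamma>) ` C) \<in> graph_ideal \<G>"
    using C(1) by (intro graph_ideal_Union) (auto intro: graph_ideal_base)
  then show ?thesis by (rule graph_ideal_subset) (use C(3) in blast)
qed

lemma pos_act:
  assumes "finite \<gamma>" "pos \<G> S"
  shows "pos \<G> (act \<gamma> ` S)"
proof -
  have "act \<gamma> ` S \<notin> graph_ideal \<G>"
  proof
    assume "act \<gamma> ` S \<in> graph_ideal \<G>"
    then have "act \<gamma> ` act \<gamma> ` S \<in> graph_ideal \<G>" by (rule graph_ideal_act[OF assms(1)])
    then show False using assms by (simp add: image_image act_invol pos_def)
  qed
  then show ?thesis
    using assms souslin_image[OF continuous_act[OF assms(1)]] by (simp add: pos_def)
qed

text \<open>The Lusin separation theorem enlarges an analytic anticlique to a Borel one: separate it from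
  its neighbourhood and remove from the separating set all points having a neighbour inside it.\<close>

lemma souslin_anticlique_in_graph_ideal:
  assumes "souslin S" "G \<in> \<G>" "anticlique G S"
  shows "S \<in> graph_ideal \<G>"
proof -
  define D where "D \<gamma> = {x. (x, act \<gamma> x) \<in> G}" for \<gamma>
  have D: "D \<gamma> \<in> sets borel" if "finite \<gamma>" for \<gamma>
    unfolding D_def using closed_graph_section[OF assms(2) that] by (rule borel_closed)
  have c: "countable (Collect finite :: nat set set)" by (rule countable_Collect_finite)
  have "\<forall>\<gamma>\<in>Collect finite. \<exists>B. B \<in> sets borel \<and> S \<subseteq> B \<and> B \<inter> act \<gamma> ` (S \<inter> D \<gamma>) = {}"
  proof
    fix \<gamma> :: "nat set" assume "\<gamma> \<in> Collect finite"
    then have g: "finite \<gamma>" by simp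
    have "souslin (act \<gamma> ` (S \<inter> D \<gamma>))"
      by (intro souslin_image continuous_act g souslin_Int_borel assms D)
    moreover have "S \<inter> act \<gamma> ` (S \<inter> D \<gamma>) = {}"
      using assms(3) by (auto simp: anticlique_def D_def)
    ultimately have "borel_separated S (act \<gamma> ` (S \<inter> D \<gamma>))"
      using lusin_separation[OF assms(1)] by blast
    then show "\<exists>B. B \<in> sets borel \<and> S \<subseteq> B \<and> B \<inter> act \<gamma> ` (S \<inter> D \<gamma>) = {}"
      unfolding borel_separated_def by blast
  qed
  from bchoice[OF this] obtain B where "\<forall>\<gamma>\<in>Collect finite.
      B \<gamma> \<in> sets borel \<and> S \<subseteq> B \<gamma> \<and> B \<gamma> \<inter> act \<gamma> ` (S \<inter> D \<gamma>) = {}" by (elim exE)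
  then have B: "B \<gamma> \<in> sets borel \<and> S \<subseteq> B \<gamma> \<and> B \<gamma> \<inter> act \<gamma> ` (S \<inter> D \<gamma>) = {}" if "finite \<gamma>" for \<gamma>
    using that by (auto dest: bspec)
  define B0 where "B0 = (\<Inter>\<gamma>\<in>Collect finite. B \<gamma>)"
  have B0: "B0 \<in> sets borel"
    unfolding B0_def using B c by (intro sets.countable_INT'') auto
  define R where "R = B0 - (\<Union>\<gamma>\<in>Collect finite. act \<gamma> ` (B0 \<inter> D \<gamma>))"
  have "R \<in> sets borel"
    unfolding R_def using B0 D c by (intro sets.Diff sets.countable_UN'' act_borel sets.Int) auto
  moreover have "anticlique G R"
    unfolding anticlique_def
  proof (intro ballI notI)
    fix x y assume xy: "x \<in> R" "y \<in> R" "(x, y) \<in> G"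
    then obtain \<gamma> where "finite \<gamma>" "y = act \<gamma> x" using graph_orbit[OF assms(2)] by blast
    then show False using xy by (auto simp: R_def D_def)
  qed
  ultimately have "R \<in> graph_ideal \<G>" using assms(2) by (intro graph_ideal_base) (auto simp: borel_anticliques_def)
  moreover have "S \<subseteq> R"
  proof
    fix x assume x: "x \<in> S"
    have "x \<notin> act \<gamma> ` (B0 \<inter> D \<gamma>)" if g: "finite \<gamma>" for \<gamma>
    proof
      assume "x \<in> act \<gamma> ` (B0 \<inter> D \<gamma>)"
      then obtain y where y: "y \<in> B0" "(y, act \<gamma> y) \<in> G" "x = act \<gamma> y" by (auto simp: D_def)
      then have yx: "y = act \<gamma> x" using g by (simp add: act_invol)
      then have "x \<in> S \<inter> D \<gamma>" using x y graph_sym[OF assms(2)] by (simp add: D_def)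
      then have "y \<in> act \<gamma> ` (S \<inter> D \<gamma>)" using yx by blast
      moreover have "y \<in> B \<gamma>" using y(1) g by (simp add: B0_def)
      ultimately show False using B[OF g] by blast
    qed
    moreover have "x \<in> B0" using x B by (auto simp: B0_def)
    ultimately show "x \<in> R" by (auto simp: R_def)
  qed
  ultimately show ?thesis by (rule graph_ideal_subset)
qed

lemma pos_edge:
  assumes "pos \<G> S" "G \<in> \<G>"
  obtains x \<gamma> where "finite \<gamma>" "x \<in> S" "act \<gamma> x \<in> S" "(x, act \<gamma> x) \<in> G"
proof -
  have "\<not> anticlique G S"
    using assms souslin_anticlique_in_graph_ideal by (auto simp: pos_def)
  then obtain x y where "x \<in> S" "y \<in> S" "(x, y) \<in> G" unfolding anticlique_def by blast
  then show thesis using that graph_orbit[OF assms(2)] by blast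
qed

lemma souslin_sections:
  assumes "souslin S" "finite \<gamma>" "closed D"
  shows "souslin {x \<in> S. act \<gamma> x \<in> S \<and> x \<in> D}"
proof -
  have "{x \<in> S. act \<gamma> x \<in> S \<and> x \<in> D} = (S \<inter> act \<gamma> ` S) \<inter> D"
    unfolding act_image_eq_vimage[OF assms(2)] by blast
  then show ?thesis
    using assms by (simp add: souslin_Int_borel souslin_Int souslin_image continuous_act borel_closed)
qed

text \<open>\<open>pos_meets\<close> turns the edges found in every positive subset into edges along
  one fixed group element.\<close>

lemma pos_edges:
  assumes "pos \<G> S" "G \<in> \<G>"
  obtains \<gamma> T where "finite \<gamma>" "pos \<G> T" "T \<subseteq> S" "\<And>x. x \<in> T \<Longrightarrow> act \<gamma> x \<in> S \<and> (x, act \<gamma> x) \<in> G"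
proof -
  define E where "E \<gamma> = {x \<in> S. act \<gamma> x \<in> S \<and> x \<in> {x. (x, act \<gamma> x) \<in> G}}" for \<gamma>
  have "souslin (E \<gamma>)" if "finite \<gamma>" for \<gamma>
    unfolding E_def using assms that closed_graph_section by (intro souslin_sections) (auto simp: pos_def)
  moreover have "\<exists>\<gamma>. finite \<gamma> \<and> R \<inter> E \<gamma> \<noteq> {}" if R: "pos \<G> R" "R \<subseteq> S" for R
  proof -
    obtain x \<gamma> where "finite \<gamma>" "x \<in> R" "act \<gamma> x \<in> R" "(x, act \<gamma> x) \<in> G"
      using pos_edge[OF R(1) assms(2)] by blast
    then have "x \<in> R \<inter> E \<gamma>" using R(2) by (auto simp: E_def)
    then show ?thesis using \<open>finite \<gamma>\<close> by blast
  qed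
  ultimately obtain \<gamma> where \<gamma>: "finite \<gamma>" "pos \<G> (E \<gamma>)" using pos_meets[OF assms(1), of E] by blast
  show thesis
  proof (rule that[OF \<gamma>])
    show "E \<gamma> \<subseteq> S" by (auto simp: E_def)
    fix x assume "x \<in> E \<gamma>"
    then show "act \<gamma> x \<in> S \<and> (x, act \<gamma> x) \<in> G" by (simp add: E_def)
  qed
qed

text \<open>An edge \<open>(x, act \<gamma> x)\<close> of \<open>G\<close> realized by the embedding must not force the further edges
  \<open>(x, act \<gamma> y)\<close> of \<open>G\<close>, where \<open>(x, y)\<close> is an edge realized later.\<close>

definition robust :: "nat set \<Rightarrow> ('a \<times> 'a) set \<Rightarrow> 'a set \<Rightarrow> bool" where
  "robust \<gamma> G S \<longleftrightarrow> (\<forall>G'\<in>\<G>. \<forall>T. pos \<G> T \<and> T \<subseteq> S \<longrightarrow>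
     (\<exists>T'. pos \<G> T' \<and> T' \<subseteq> T \<and> (\<forall>x\<in>T'. \<forall>y\<in>T'. (x, y) \<in> G' \<longrightarrow> (x, act \<gamma> y) \<notin> G)))"

section \<open>Narrow sets and robust edges\<close>

text \<open>A uniform distance instead of mere inequality, because it has to survive the passage to
  a limit in \<open>robust_edges\<close>.\<close>

definition bounded_away :: "nat set \<Rightarrow> nat set \<Rightarrow> 'a set \<Rightarrow> bool" where
  "bounded_away \<delta> \<gamma> T \<longleftrightarrow> (\<exists>\<epsilon>>0. \<forall>u\<in>T. \<forall>v\<in>T. dist (act \<delta> u) (act \<gamma> v) \<ge> \<epsilon>)"

lemma bounded_away_subset: "bounded_away \<delta> \<gamma> T \<Longrightarrow> T' \<subseteq> T \<Longrightarrow> bounded_away \<delta> \<gamma> T'"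
  unfolding bounded_away_def by (meson subsetD)

lemma act_nbhd_small:
  assumes "finite \<gamma>" "\<epsilon> > 0"
  obtains U where "open U" "x \<in> U" "\<And>u v. u \<in> U \<Longrightarrow> v \<in> U \<Longrightarrow> dist (act \<gamma> u) (act \<gamma> v) < \<epsilon>"
proof -
  let ?U = "act \<gamma> -` ball (act \<gamma> x) (\<epsilon> / 2)"
  have "open ?U" using continuous_act[OF assms(1)] by (intro open_vimage) auto
  moreover have "x \<in> ?U" using assms(2) by simp
  moreover have "dist (act \<gamma> u) (act \<gamma> v) < \<epsilon>" if "u \<in> ?U" "v \<in> ?U" for u v
    using that dist_triangle_half_r[of "act \<gamma> x" "act \<gamma> u" \<epsilon> "act \<gamma> v"] by simp
  ultimately show thesis using that by blast
qed

lemma bounded_away_local: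
  assumes "finite \<gamma>" "finite \<delta>" "\<gamma> \<noteq> \<delta>"
  obtains U where "open U" "x \<in> U" "bounded_away \<delta> \<gamma> U"
proof -
  define \<epsilon> where "\<epsilon> = dist (act \<delta> x) (act \<gamma> x) / 3"
  have "act \<delta> x \<noteq> act \<gamma> x" using act_inj assms by blast
  then have \<epsilon>: "\<epsilon> > 0" by (simp add: \<epsilon>_def)
  obtain U where U: "open U" "x \<in> U" "\<And>u v. u \<in> U \<Longrightarrow> v \<in> U \<Longrightarrow> dist (act \<gamma> u) (act \<gamma> v) < \<epsilon>"
    using act_nbhd_small[OF assms(1) \<epsilon>] by blast
  obtain V where V: "open V" "x \<in> V" "\<And>u v. u \<in> V \<Longrightarrow> v \<in> V \<Longrightarrow> dist (act \<delta> u) (act \<delta> v) < \<epsilon>"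
    using act_nbhd_small[OF assms(2) \<epsilon>] by blast
  have "dist (act \<delta> u) (act \<gamma> v) \<ge> \<epsilon>" if "u \<in> U \<inter> V" "v \<in> U \<inter> V" for u v
  proof -
    have "dist (act \<gamma> v) (act \<gamma> x) < \<epsilon>" "dist (act \<delta> x) (act \<delta> u) < \<epsilon>"
      using U(2,3) V(2,3) that by auto
    moreover have "dist (act \<delta> x) (act \<gamma> x) \<le> dist (act \<delta> x) (act \<delta> u) + dist (act \<delta> u) (act \<gamma> v) + dist (act \<gamma> v) (act \<gamma> x)"
      by (meson dist_triangle add_right_mono order_trans)
    ultimately show ?thesis unfolding \<epsilon>_def by linarith
  qed
  then have "bounded_away \<delta> \<gamma> (U \<inter> V)" unfolding bounded_away_def using \<epsilon> by blast
  then show thesis using that[of "U \<inter> V"] U(1,2) V(1,2) by (simp add: open_Int)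
qed

text \<open>The small diameters make both endpoints of the edges converge; staying away from the
  elements of \<open>D\<close> diagonalizes against orbit equivalence of the limits.\<close>

definition narrow :: "real \<Rightarrow> nat set set \<Rightarrow> nat set \<Rightarrow> 'a set \<Rightarrow> bool" where
  "narrow \<epsilon> D \<gamma> T \<longleftrightarrow>
     (\<forall>u\<in>T. \<forall>v\<in>T. dist u v < \<epsilon> \<and> dist (act \<gamma> u) (act \<gamma> v) < \<epsilon>) \<and>
     (\<forall>\<delta>\<in>D. \<delta> \<noteq> \<gamma> \<longrightarrow> bounded_away \<delta> \<gamma> T)"

lemma pos_bounded_away:
  assumes "pos \<G> T" "finite \<gamma>" "finite \<delta>" "\<gamma> \<noteq> \<delta>"
  obtains T' where "pos \<G> T'" "T' \<subseteq> T" "bounded_away \<delta> \<gamma> T'"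
proof -
  have "\<exists>U. open U \<and> x \<in> U \<and> bounded_away \<delta> \<gamma> (T \<inter> U)" for x
    using bounded_away_local[OF assms(2-4), of x] bounded_away_subset by (metis Int_lower2)
  then show thesis using pos_local[OF assms(1), of "bounded_away \<delta> \<gamma>"] that by blast
qed

lemma pos_narrow:
  assumes "pos \<G> S" "finite \<gamma>" "\<epsilon> > 0" "finite D" "D \<subseteq> Collect finite"
  obtains T where "pos \<G> T" "T \<subseteq> S" "narrow \<epsilon> D \<gamma> T"
proof -
  have "\<exists>T. pos \<G> T \<and> T \<subseteq> S \<and> (\<forall>\<delta>\<in>D - {\<gamma>}. bounded_away \<delta> \<gamma> T)"
  proof (rule pos_dense_finite)
    fix \<delta> T assume "\<delta> \<in> D - {\<gamma>}" "pos \<G> T"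
    then show "\<exists>T'. pos \<G> T' \<and> T' \<subseteq> T \<and> bounded_away \<delta> \<gamma> T'"
      using pos_bounded_away[of T \<gamma> \<delta>] assms(2,5) by blast
  qed (use assms bounded_away_subset in auto)
  then obtain T where T: "pos \<G> T" "T \<subseteq> S" "\<And>\<delta>. \<delta> \<in> D - {\<gamma>} \<Longrightarrow> bounded_away \<delta> \<gamma> T" by blast
  define Q where "Q T \<longleftrightarrow> (\<forall>u\<in>T. \<forall>v\<in>T. dist u v < \<epsilon> \<and> dist (act \<gamma> u) (act \<gamma> v) < \<epsilon>)" for T
  have "\<exists>U. open U \<and> x \<in> U \<and> Q (T \<inter> U)" for x
  proof -
    obtain U where U: "open U" "x \<in> U" "\<And>u v. u \<in> U \<Longrightarrow> v \<in> U \<Longrightarrow> dist (act \<gamma> u) (act \<gamma> v) < \<epsilon>"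
      using act_nbhd_small[OF assms(2,3)] by blast
    obtain V where V: "open V" "x \<in> V" "\<And>u v. u \<in> V \<Longrightarrow> v \<in> V \<Longrightarrow> dist (act {} u) (act {} v) < \<epsilon>"
      using act_nbhd_small[OF _ assms(3), of "{}"] by blast
    have "Q (T \<inter> (U \<inter> V))" unfolding Q_def using U(3) V(3) by (simp add: act_empty)
    then show ?thesis using U(1,2) V(1,2) by (intro exI[of _ "U \<inter> V"]) (simp add: open_Int)
  qed
  then obtain T' where T': "pos \<G> T'" "T' \<subseteq> T" "Q T'" using pos_local[OF T(1), of Q] by blast
  have "narrow \<epsilon> D \<gamma> T'"
    unfolding narrow_def
  proof (intro conjI)
    show "\<forall>\<delta>\<in>D. \<delta> \<noteq> \<gamma> \<longrightarrow> bounded_away \<delta> \<gamma> T'" using T(3) T'(2) bounded_away_subset by blast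
    show "\<forall>u\<in>T'. \<forall>v\<in>T'. dist u v < \<epsilon> \<and> dist (act \<gamma> u) (act \<gamma> v) < \<epsilon>" using T'(3) by (simp add: Q_def)
  qed
  then show thesis using that T(2) T'(1,2) by blast
qed

text \<open>Below some \<open>T1\<close> every positive set contains \<open>x\<close>,
  \<open>y\<close> with \<open>(x, y)\<close> in \<open>G'\<close> and
  \<open>(x, act \<gamma> y)\<close> in \<open>G\<close>. Freezing the \<beta> with
  \<open>y = act \<beta> x\<close>, the product of \<gamma> and \<beta> realizes edges of
  \<open>G\<close> again. It differs from \<gamma> as \<open>G'\<close> is irreflexive, and the new
  second endpoints lie among the old ones since \<open>y\<close> is in \<open>T\<close>.\<close>

lemma not_robust_step:
  assumes G: "G \<in> \<G>" and S: "\<gamma> \<in> Collect finite" "pos \<G> T" and "\<not> robust \<gamma> G T"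
  obtains \<gamma>' T' where "finite \<gamma>'" "pos \<G> T'" "T' \<subseteq> T" "\<gamma>' \<noteq> \<gamma>"
    "\<And>x. x \<in> T' \<Longrightarrow> act \<gamma>' x \<in> act \<gamma> ` T \<and> (x, act \<gamma>' x) \<in> G"
proof -
  have fin: "finite \<gamma>" using S(1) by simp
  obtain G' T1 where G': "G' \<in> \<G>" and T1: "pos \<G> T1" "T1 \<subseteq> T"
    and bad: "\<And>R. pos \<G> R \<Longrightarrow> R \<subseteq> T1 \<Longrightarrow> \<exists>x\<in>R. \<exists>y\<in>R. (x, y) \<in> G' \<and> (x, act \<gamma> y) \<in> G"
    using assms(4) unfolding robust_def by blast
  define D where "D \<beta> = {x. (x, act \<beta> x) \<in> G'} \<inter> {x. (x, act (sym_diff \<gamma> \<beta>) x) \<in> G}" for \<beta>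
  define E where "E \<beta> = {x \<in> T1. act \<beta> x \<in> T1 \<and> x \<in> D \<beta>}" for \<beta>
  have "souslin (E \<beta>)" if b: "finite \<beta>" for \<beta>
  proof -
    have "closed (D \<beta>)" unfolding D_def
      using fin b by (intro closed_Int closed_graph_section G G') auto
    then show ?thesis unfolding E_def using T1(1) b by (intro souslin_sections) (auto simp: pos_def)
  qed
  moreover have "\<exists>\<beta>. finite \<beta> \<and> R \<inter> E \<beta> \<noteq> {}" if R: "pos \<G> R" "R \<subseteq> T1" for R
  proof -
    obtain x y where xy: "x \<in> R" "y \<in> R" "(x, y) \<in> G'" "(x, act \<gamma> y) \<in> G" using bad[OF R] by blast
    then obtain \<beta> where b: "finite \<beta>" "y = act \<beta> x" using graph_orbit[OF G'] by blast
    then have "x \<in> R \<inter> E \<beta>" using xy R(2) fin by (auto simp: E_def D_def act_act)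
    then show ?thesis using b(1) by blast
  qed
  ultimately obtain \<beta> where b: "finite \<beta>" "pos \<G> (E \<beta>)" using pos_meets[OF T1(1), of E] by blast
  obtain x where "x \<in> E \<beta>" using pos_nonempty[OF b(2)] by blast
  then have "(x, act \<beta> x) \<in> G'" by (simp add: E_def D_def)
  then have "\<beta> \<noteq> {}" using graph_irrefl[OF G'] act_empty by metis
  show thesis
  proof (rule that[of "sym_diff \<gamma> \<beta>" "E \<beta>"])
    show "finite (sym_diff \<gamma> \<beta>)" using fin b(1) by simp
    show "E \<beta> \<subseteq> T" using T1(2) by (auto simp: E_def)
    show "sym_diff \<gamma> \<beta> \<noteq> \<gamma>" using \<open>\<beta> \<noteq> {}\<close> by blast
    fix x assume x: "x \<in> E \<beta>"
    then have "act (sym_diff \<gamma> \<beta>) x = act \<gamma> (act \<beta> x)" using act_act[OF fin b(1)] by simp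
    moreover have "act \<beta> x \<in> T" using x T1(2) by (auto simp: E_def)
    ultimately show "act (sym_diff \<gamma> \<beta>) x \<in> act \<gamma> ` T \<and> (x, act (sym_diff \<gamma> \<beta>) x) \<in> G"
      using x by (simp add: E_def D_def)
  qed (rule b(2))
qed

text \<open>If no edge is robust, then \<open>\<gamma>\<close> can be multiplied by new group elements forever while
  \<open>(x, act \<gamma> x)\<close> remains an edge.  The limit is an edge as \<open>G\<close> is closed, but its endpoints
  are not orbit equivalent.\<close>

lemma robust_edges:
  assumes S: "pos \<G> S" and G: "G \<in> \<G>"
  obtains \<gamma> T where "finite \<gamma>" "pos \<G> T" "T \<subseteq> S" "robust \<gamma> G T"
    "\<And>x. x \<in> T \<Longrightarrow> act \<gamma> x \<in> S \<and> (x, act \<gamma> x) \<in> G"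
proof (rule ccontr)
  assume "\<not> thesis"
  then have no: "\<not> robust \<gamma> G T" if "finite \<gamma>" "pos \<G> T" "T \<subseteq> S"
    "\<forall>x\<in>T. act \<gamma> x \<in> S \<and> (x, act \<gamma> x) \<in> G" for \<gamma> T
    using that \<open>\<And>T \<gamma>. \<lbrakk>finite \<gamma>; pos \<G> T; T \<subseteq> S; robust \<gamma> G T;
      \<And>x. x \<in> T \<Longrightarrow> act \<gamma> x \<in> S \<and> (x, act \<gamma> x) \<in> G\<rbrakk> \<Longrightarrow> thesis\<close> by blast
  have c: "countable (Collect finite :: nat set set)" by (rule countable_Collect_finite)
  define e where "e = from_nat_into (Collect finite :: nat set set)"
  have e: "range e = Collect finite" unfolding e_def using c by (intro range_from_nat_into) auto
  define P where "P n s \<longleftrightarrow> finite (fst s) \<and> pos \<G> (snd s) \<and> snd s \<subseteq> S \<and>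
      (\<forall>x\<in>snd s. act (fst s) x \<in> S \<and> (x, act (fst s) x) \<in> G) \<and>
      narrow ((1/2)^n) (e ` {..<n}) (fst s) (snd s)" for n :: nat and s
  define Q where "Q (n :: nat) s t \<longleftrightarrow> snd t \<subseteq> snd s \<and> fst t \<noteq> fst s \<and>
      act (fst t) ` snd t \<subseteq> act (fst s) ` snd s" for n s t
  have D: "finite (e ` {..<n})" "e ` {..<n} \<subseteq> Collect finite" for n using e by auto
  have "\<exists>s. P 0 s"
  proof -
    obtain \<gamma> T where T: "finite \<gamma>" "pos \<G> T" "T \<subseteq> S" "\<And>x. x \<in> T \<Longrightarrow> act \<gamma> x \<in> S \<and> (x, act \<gamma> x) \<in> G"
      using pos_edges[OF S G] by blast
    obtain T' where T': "pos \<G> T'" "T' \<subseteq> T" "narrow ((1/2)^0) (e ` {..<0}) \<gamma> T'"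
      using pos_narrow[OF T(2,1) _ D(1) D(2), of "(1/2)^0" 0] by auto
    then have "P 0 (\<gamma>, T')" using T by (auto simp: P_def)
    then show ?thesis by blast
  qed
  moreover have "\<exists>t. P (Suc n) t \<and> Q n s t" if s: "P n s" for n s
  proof -
    obtain \<gamma> T where sT: "s = (\<gamma>, T)" by (cases s)
    then have T: "finite \<gamma>" "pos \<G> T" "T \<subseteq> S" "\<forall>x\<in>T. act \<gamma> x \<in> S \<and> (x, act \<gamma> x) \<in> G"
      using s by (simp_all add: P_def)
    obtain \<gamma>' T' where T': "finite \<gamma>'" "pos \<G> T'" "T' \<subseteq> T" "\<gamma>' \<noteq> \<gamma>"
      "\<And>x. x \<in> T' \<Longrightarrow> act \<gamma>' x \<in> act \<gamma> ` T \<and> (x, act \<gamma>' x) \<in> G"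
      using not_robust_step[OF G _ T(2) no[OF T]] T(1) by (metis mem_Collect_eq)
    obtain T'' where T'': "pos \<G> T''" "T'' \<subseteq> T'" "narrow ((1/2)^Suc n) (e ` {..<Suc n}) \<gamma>' T''"
      using pos_narrow[OF T'(2,1) _ D(1) D(2), of "(1/2)^Suc n" "Suc n"] by auto
    have "T'' \<subseteq> S" using T(3) T'(3) T''(2) by blast
    moreover have "act \<gamma>' x \<in> S \<and> (x, act \<gamma>' x) \<in> G" if x: "x \<in> T''" for x
    proof -
      have x': "x \<in> T'" using x T''(2) by blast
      then obtain u where u: "u \<in> T" "act \<gamma>' x = act \<gamma> u" using T'(5)[OF x'] by blast
      then have "act \<gamma>' x \<in> S" using T(4) by simp
      then show ?thesis using T'(5)[OF x'] by blast
    qed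
    ultimately have "P (Suc n) (\<gamma>', T'')" using T'(1) T''(1,3) by (simp add: P_def)
    moreover have "Q n s (\<gamma>', T'')"
      unfolding Q_def sT fst_conv snd_conv using T'(3,4,5) T''(2) by blast
    ultimately show ?thesis by blast
  qed
  ultimately obtain w where w: "\<And>n. P n (w n)" "\<And>n. Q n (w n) (w (Suc n))"
    using dependent_nat_choice[of P Q] by blast
  define \<gamma> T where "\<gamma> n = fst (w n)" and "T n = snd (w n)" for n
  have fin: "finite (\<gamma> n)" and posT: "pos \<G> (T n)" and nT: "narrow ((1/2)^n) (e ` {..<n}) (\<gamma> n) (T n)"
    and edge: "\<And>x. x \<in> T n \<Longrightarrow> (x, act (\<gamma> n) x) \<in> G" for n
    using w(1)[of n] by (auto simp: P_def \<gamma>_def T_def)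
  have stepT: "T (Suc n) \<subseteq> T n" and stepg: "\<gamma> (Suc n) \<noteq> \<gamma> n"
    and stepa: "act (\<gamma> (Suc n)) ` T (Suc n) \<subseteq> act (\<gamma> n) ` T n" for n
    using w(2)[of n] by (auto simp: Q_def \<gamma>_def T_def)
  have decT: "T m \<subseteq> T n" if "n \<le> m" for n m using stepT that by (rule lift_Suc_antimono_le)
  have deca: "act (\<gamma> m) ` T m \<subseteq> act (\<gamma> n) ` T n" if "n \<le> m" for n m
    using stepa that by (rule lift_Suc_antimono_le)
  have "\<forall>n. \<exists>x. x \<in> T n" using pos_nonempty[OF posT] by blast
  from choice[OF this] obtain X where X: "\<And>n. X n \<in> T n" by blast
  define Y where "Y n = act (\<gamma> n) (X n)" for n
  have XT: "X m \<in> T n" if "n \<le> m" for n m using X[of m] decT[OF that] by blast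
  have YT: "\<exists>v\<in>T n. Y m = act (\<gamma> n) v" if "n \<le> m" for n m
    using X[of m] deca[OF that] by (auto simp: Y_def)
  have dX: "dist (X m) (X k) < (1/2)^n" and dY: "dist (Y m) (Y k) < (1/2)^n" if nm: "n \<le> m" "n \<le> k" for n m k
  proof -
    show "dist (X m) (X k) < (1/2)^n" using nT[of n] XT[OF nm(1)] XT[OF nm(2)] by (simp add: narrow_def)
    obtain u v where "u \<in> T n" "v \<in> T n" "Y m = act (\<gamma> n) u" "Y k = act (\<gamma> n) v"
      using YT[OF nm(1)] YT[OF nm(2)] by blast
    then show "dist (Y m) (Y k) < (1/2)^n" using nT[of n] by (simp add: narrow_def)
  qed
  have Cauchy: "Cauchy Z" if Z: "\<And>n m k. n \<le> m \<Longrightarrow> n \<le> k \<Longrightarrow> dist (Z m) (Z k) < (1/2 :: real)^n"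
    for Z :: "nat \<Rightarrow> 'a"
    unfolding Cauchy_def
  proof (intro allI impI)
    fix r :: real assume "r > 0"
    then obtain n where "(1/2)^n < r" using real_arch_pow_inv[of r "1/2"] by auto
    then show "\<exists>M. \<forall>m\<ge>M. \<forall>k\<ge>M. dist (Z m) (Z k) < r" using Z by (meson less_trans)
  qed
  obtain x where x: "X \<longlonglongrightarrow> x" 
    using Cauchy_convergent[OF Cauchy[of X, OF dX]] unfolding convergent_def by blast
  obtain y where y: "Y \<longlonglongrightarrow> y" 
    using Cauchy_convergent[OF Cauchy[of Y, OF dY]] unfolding convergent_def by blast
  have not_orbit: "y \<noteq> act \<delta> x" if d: "finite \<delta>" for \<delta>
  proof -
    obtain i where i: "e i = \<delta>" using e d by (metis imageE mem_Collect_eq)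
    \<comment> \<open>Two consecutive elements are distinct, so one of the two following index
      \<open>i\<close> differs from \<delta>; by then \<delta> is among those from which the images
      are kept away.\<close>
    obtain j where j: "i < j" "\<gamma> j \<noteq> \<delta>" using stepg[of "Suc i"] by (metis lessI less_SucI)
    have "bounded_away \<delta> (\<gamma> j) (T j)" using nT[of j] i j by (auto simp: narrow_def)
    then obtain \<epsilon> where \<epsilon>: "\<epsilon> > 0" "\<And>u v. u \<in> T j \<Longrightarrow> v \<in> T j \<Longrightarrow> \<epsilon> \<le> dist (act \<delta> u) (act (\<gamma> j) v)"
      unfolding bounded_away_def by blast
    have "\<epsilon> \<le> dist (act \<delta> (X m)) (Y m)" if "j \<le> m" for m
      using YT[OF that] XT[OF that] \<epsilon>(2) by metis
    moreover have "(\<lambda>m. act \<delta> (X m)) \<longlonglongrightarrow> act \<delta> x"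
      using continuous_on_tendsto_compose[OF continuous_act[OF d] x] by simp
    then have "(\<lambda>m. dist (act \<delta> (X m)) (Y m)) \<longlonglongrightarrow> dist (act \<delta> x) y" using y by (rule tendsto_dist)
    ultimately have "\<epsilon> \<le> dist (act \<delta> x) y" by (intro LIMSEQ_le_const[of _ _ \<epsilon>]) auto
    then show ?thesis using \<epsilon>(1) by auto
  qed
  have "x \<noteq> y" using not_orbit[of "{}"] by (simp add: act_empty)
  then have "(x, y) \<in> G"
    using graph_limit[OF G x y] edge X by (simp add: Y_def)
  then show False using graph_orbit[OF G] not_orbit by blast
qed

end

section \<open>Finite combinations of group elements\<close>

text \<open>The product in \<open>Delta\<close> of the \<open>\<gamma> j\<close> for
  \<open>j\<close> in a finite set \<open>s\<close>. Parity of memberships expresses it without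
  ordering \<open>s\<close>.\<close>

definition comb :: "(nat \<Rightarrow> nat set) \<Rightarrow> nat set \<Rightarrow> nat set" where
  "comb \<gamma> s = {k. odd (card {j \<in> s. k \<in> \<gamma> j})}"

lemma comb_empty: "comb \<gamma> {} = {}"
  by (simp add: comb_def)

lemma comb_single: "comb \<gamma> {j} = \<gamma> j"
proof -
  have "{i \<in> {j}. k \<in> \<gamma> i} = (if k \<in> \<gamma> j then {j} else {})" for k by auto
  then show ?thesis by (simp add: comb_def)
qed

lemma comb_cong:
  assumes "\<And>j. j \<in> s \<Longrightarrow> \<gamma> j = \<gamma>' j"
  shows "comb \<gamma> s = comb \<gamma>' s"
proof -
  have "{j \<in> s. k \<in> \<gamma> j} = {j \<in> s. k \<in> \<gamma>' j}" for k using assms by auto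
  then show ?thesis by (simp add: comb_def)
qed

lemma finite_comb:
  assumes "finite s" "\<And>j. finite (\<gamma> j)"
  shows "finite (comb \<gamma> s)"
proof (rule finite_subset)
  show "comb \<gamma> s \<subseteq> (\<Union>j\<in>s. \<gamma> j)"
  proof
    fix k assume "k \<in> comb \<gamma> s"
    then have "card {j \<in> s. k \<in> \<gamma> j} \<noteq> 0" by (auto simp: comb_def intro: odd_pos)
    then have "{j \<in> s. k \<in> \<gamma> j} \<noteq> {}" by (metis card.empty)
    then show "k \<in> (\<Union>j\<in>s. \<gamma> j)" by blast
  qed
qed (use assms in auto)

lemma odd_card_sym_diff:
  assumes "finite A" "finite B"
  shows "odd (card (sym_diff A B)) \<longleftrightarrow> odd (card A) \<noteq> odd (card B)"
proof -
  have "card A = card (A - B) + card (A \<inter> B)" "card B = card (B - A) + card (A \<inter> B)"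
    using card_Diff_subset_Int[of A B] card_Diff_subset_Int[of B A] assms
    by (simp_all add: Int_commute card_mono)
  moreover have "card (sym_diff A B) = card (A - B) + card (B - A)"
    using assms by (intro card_Un_disjoint) auto
  ultimately show ?thesis by simp presburger
qed

lemma comb_sym_diff:
  assumes "finite s" "finite t"
  shows "comb \<gamma> (sym_diff s t) = sym_diff (comb \<gamma> s) (comb \<gamma> t)"
proof -
  have "odd (card {j \<in> sym_diff s t. k \<in> \<gamma> j}) \<longleftrightarrow>
      odd (card {j \<in> s. k \<in> \<gamma> j}) \<noteq> odd (card {j \<in> t. k \<in> \<gamma> j})" for k
  proof -
    have "{j \<in> sym_diff s t. k \<in> \<gamma> j} = sym_diff {j \<in> s. k \<in> \<gamma> j} {j \<in> t. k \<in> \<gamma> j}" by blast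
    then show ?thesis using odd_card_sym_diff[of "{j \<in> s. k \<in> \<gamma> j}" "{j \<in> t. k \<in> \<gamma> j}"] assms by simp
  qed
  then show ?thesis unfolding comb_def by blast
qed

section \<open>The invariant of the construction and its extension by one generator\<close>

context free_graph_family
begin

lemma act_comb_sym_diff:
  assumes "\<And>j. finite (\<gamma> j)" "finite s" "finite t"
  shows "act (comb \<gamma> (sym_diff s t)) x = act (comb \<gamma> s) (act (comb \<gamma> t) x)"
  using assms by (simp only: comb_sym_diff act_act finite_comb)

lemma act_comb_Un:
  assumes "\<And>j. finite (\<gamma> j)" "finite s" "finite t" "s \<inter> t = {}"
  shows "act (comb \<gamma> (s \<union> t)) x = act (comb \<gamma> s) (act (comb \<gamma> t) x)"
proof -
  have "s \<union> t = sym_diff s t" using assms(4) by blast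
  then show ?thesis using act_comb_sym_diff[OF assms(1-3)] by simp
qed

text \<open>The finitely many graphs under control from stage \<open>k\<close> on: translates by the
  first \<open>k\<close> generators of the first \<open>k\<close> representatives.\<close>

definition orbit_family :: "(nat \<Rightarrow> nat set) \<Rightarrow> (nat \<Rightarrow> ('a \<times> 'a) set) \<Rightarrow> nat \<Rightarrow> ('a \<times> 'a) set set" where
  "orbit_family \<gamma> F k = {graph_act act (comb \<gamma> s) (F i) | s i. s \<subseteq> {..<k} \<and> i < k}"

lemma finite_orbit_family: "finite (orbit_family \<gamma> F k)"
proof -
  have "orbit_family \<gamma> F k = (\<lambda>(s, i). graph_act act (comb \<gamma> s) (F i)) ` (Pow {..<k} \<times> {..<k})"
    unfolding orbit_family_def by auto
  then show ?thesis by simp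
qed

lemma orbit_family_mono:
  assumes "k \<le> m"
  shows "orbit_family \<gamma> F k \<subseteq> orbit_family \<gamma> F m"
proof
  fix G assume "G \<in> orbit_family \<gamma> F k"
  then obtain s i where si: "G = graph_act act (comb \<gamma> s) (F i)" "s \<subseteq> {..<k}" "i < k"
    unfolding orbit_family_def by blast
  then have "s \<subseteq> {..<m}" "i < m" using assms by auto
  then show "G \<in> orbit_family \<gamma> F m" unfolding orbit_family_def using si(1) by blast
qed

lemma orbit_family_in:
  assumes "\<And>j. finite (\<gamma> j)" "\<And>i. i < k \<Longrightarrow> F i \<in> \<G>" "G \<in> orbit_family \<gamma> F k"
  shows "G \<in> \<G>"
proof -
  obtain s i where si: "G = graph_act act (comb \<gamma> s) (F i)" "s \<subseteq> {..<k}" "i < k"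
    using assms(3) unfolding orbit_family_def by blast
  have "finite s" using si(2) finite_subset by blast
  then show ?thesis unfolding si(1) using assms(1,2) si(3) by (intro graph_act_in finite_comb)
qed

lemma orbit_family_act:
  assumes "\<And>j. finite (\<gamma> j)" "G \<in> orbit_family \<gamma> F m" "t \<subseteq> {..<m}"
  shows "graph_act act (comb \<gamma> t) G \<in> orbit_family \<gamma> F m"
proof -
  obtain s i where si: "G = graph_act act (comb \<gamma> s) (F i)" "s \<subseteq> {..<m}" "i < m"
    using assms(2) unfolding orbit_family_def by blast
  have fin: "finite s" "finite t" using si(2) assms(3) finite_subset by blast+
  have "graph_act act (comb \<gamma> t) G = graph_act act (comb \<gamma> (sym_diff t s)) (F i)"
    unfolding si(1) using fin assms(1) by (simp only: graph_act_graph_act finite_comb comb_sym_diff)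
  moreover have "sym_diff t s \<subseteq> {..<m}" using si(2) assms(3) by blast
  ultimately show ?thesis unfolding orbit_family_def using si(3) by blast
qed

lemma orbit_family_cong:
  assumes "\<And>j. j < k \<Longrightarrow> \<gamma> j = \<gamma>' j" "\<And>j. j < k \<Longrightarrow> F j = F' j"
  shows "orbit_family \<gamma> F k = orbit_family \<gamma>' F' k"
proof -
  have "comb \<gamma> s = comb \<gamma>' s" if "s \<subseteq> {..<k}" for s using that assms(1) by (intro comb_cong) auto
  then show ?thesis unfolding orbit_family_def using assms(2) by (intro Collect_cong) metis
qed

text \<open>The conclusion \<open>s = {}\<close> adds independence of the generators to the
  separation of the orbits, see \<open>good_comb_inj\<close>.\<close>

definition distinct_orbits :: "nat \<Rightarrow> (nat \<Rightarrow> nat set) \<Rightarrow> (nat \<Rightarrow> ('a \<times> 'a) set) \<Rightarrow> bool" where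
  "distinct_orbits m \<gamma> F \<longleftrightarrow> (\<forall>s i j. s \<subseteq> {..<m} \<longrightarrow> i < m \<longrightarrow> j < m \<longrightarrow>
     graph_act act (comb \<gamma> s) (F i) = F j \<longrightarrow> i = j \<and> s = {})"

text \<open>\<open>R j\<close> is the graph whose edges the step from \<open>j\<close> to \<open>Suc j\<close> realizes.  The only edges of
  graphs \<open>G\<close> in \<open>orbit_family \<gamma> F k\<close> which survive on the pieces of level \<open>k\<close> are the realized ones.\<close>

definition only_realized_edges ::
    "nat \<Rightarrow> (nat \<Rightarrow> nat set) \<Rightarrow> (nat \<Rightarrow> ('a \<times> 'a) set) \<Rightarrow> (nat \<Rightarrow> ('a \<times> 'a) set) \<Rightarrow> 'a set \<Rightarrow> bool" where
  "only_realized_edges m \<gamma> R F S \<longleftrightarrow> (\<forall>k G s t x.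
     k \<le> m \<longrightarrow> G \<in> orbit_family \<gamma> F k \<longrightarrow> s \<subseteq> {..<m} \<longrightarrow> t \<subseteq> {..<m} \<longrightarrow> s \<noteq> t \<longrightarrow>
     sym_diff s t \<subseteq> {k..} \<longrightarrow> x \<in> S \<longrightarrow> (act (comb \<gamma> s) x, act (comb \<gamma> t) x) \<in> G \<longrightarrow>
     (\<exists>j. sym_diff s t = {j} \<and> graph_act act (comb \<gamma> (s \<inter> {..<j})) G = R j))"

text \<open>A current point was moved by generators \<sigma> chosen after stage \<open>j\<close>
  before it entered the set of that stage, so robustness of \<open>\<gamma> j\<close> is required
  for the moved points. All graphs \<open>G\<close> are allowed since the one to be realized next is
  unknown, and so that the property can be translated by later generators.\<close>

definition robust_below :: "nat \<Rightarrow> (nat \<Rightarrow> nat set) \<Rightarrow> (nat \<Rightarrow> ('a \<times> 'a) set) \<Rightarrow> 'a set \<Rightarrow> bool" where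
  "robust_below m \<gamma> R S \<longleftrightarrow> (\<forall>j \<sigma> G T. j < m \<longrightarrow> \<sigma> \<subseteq> {j<..<m} \<longrightarrow> G \<in> \<G> \<longrightarrow> pos \<G> T \<longrightarrow> T \<subseteq> S \<longrightarrow>
     (\<exists>T'. pos \<G> T' \<and> T' \<subseteq> T \<and> (\<forall>x\<in>T'. \<forall>y\<in>T'. (x, y) \<in> G \<longrightarrow>
        (act (comb \<gamma> \<sigma>) x, act (\<gamma> j) (act (comb \<gamma> \<sigma>) y)) \<notin> R j)))"

lemmas distinct_orbitsD = distinct_orbits_def[THEN iffD1, rule_format]
lemmas only_realized_edgesD = only_realized_edges_def[THEN iffD1, rule_format]
lemmas robust_belowD = robust_below_def[THEN iffD1, rule_format]

definition good :: "nat \<Rightarrow> (nat \<Rightarrow> nat set) \<Rightarrow> (nat \<Rightarrow> ('a \<times> 'a) set) \<Rightarrow> (nat \<Rightarrow> ('a \<times> 'a) set) \<Rightarrow> 'a set \<Rightarrow> bool" where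
  "good m \<gamma> R F S \<longleftrightarrow> (\<forall>j. finite (\<gamma> j)) \<and> (\<forall>j<m. R j \<in> \<G> \<and> F j \<in> \<G>) \<and> pos \<G> S \<and>
     distinct_orbits m \<gamma> F \<and> only_realized_edges m \<gamma> R F S \<and> robust_below m \<gamma> R S"

lemma good_subset:
  assumes "good m \<gamma> R F S" "pos \<G> T" "T \<subseteq> S"
  shows "good m \<gamma> R F T"
proof -
  have "only_realized_edges m \<gamma> R F T"
    using assms(1,3) unfolding good_def only_realized_edges_def by (meson subsetD)
  moreover have "robust_below m \<gamma> R T"
    using assms(1,3) unfolding good_def robust_below_def by (meson subset_trans)
  ultimately show ?thesis using assms(1,2) by (simp add: good_def)
qed

text \<open>Each stage updates total functions at a single place; apart from finiteness of the
  generators the invariant reads only values below \<open>m\<close>.\<close>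

lemma good_cong:
  assumes g: "good m \<gamma> R F S" and \<gamma>': "\<And>j. finite (\<gamma>' j)"
    and eq: "\<And>j. j < m \<Longrightarrow> \<gamma> j = \<gamma>' j" "\<And>j. j < m \<Longrightarrow> R j = R' j" "\<And>j. j < m \<Longrightarrow> F j = F' j"
  shows "good m \<gamma>' R' F' S"
proof -
  have comb: "comb \<gamma>' s = comb \<gamma> s" if "s \<subseteq> {..<m}" for s
    using that eq(1) by (intro comb_cong) auto
  have fam: "orbit_family \<gamma>' F' k = orbit_family \<gamma> F k" if "k \<le> m" for k
    using that eq(1,3) by (intro orbit_family_cong) auto
  have "distinct_orbits m \<gamma>' F'"
    unfolding distinct_orbits_def
  proof (intro allI impI)
    fix s i j assume a: "s \<subseteq> {..<m}" "i < m" "j < m" "graph_act act (comb \<gamma>' s) (F' i) = F' j"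
    then have "graph_act act (comb \<gamma> s) (F i) = F j" using comb eq(3) by simp
    then show "i = j \<and> s = {}" using g a(1-3) unfolding good_def distinct_orbits_def by blast
  qed
  moreover have "only_realized_edges m \<gamma>' R' F' S"
    unfolding only_realized_edges_def
  proof (intro allI impI)
    fix k G s t x
    assume a: "k \<le> m" "G \<in> orbit_family \<gamma>' F' k" "s \<subseteq> {..<m}" "t \<subseteq> {..<m}" "s \<noteq> t"
      "sym_diff s t \<subseteq> {k..}" "x \<in> S" "(act (comb \<gamma>' s) x, act (comb \<gamma>' t) x) \<in> G"
    then obtain j where j: "sym_diff s t = {j}" "graph_act act (comb \<gamma> (s \<inter> {..<j})) G = R j"
      using g unfolding good_def only_realized_edges_def
      by (metis fam comb)
    have "j < m" using j(1) a(3,4) by blast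
    moreover have "comb \<gamma>' (s \<inter> {..<j}) = comb \<gamma> (s \<inter> {..<j})" using a(3) by (intro comb) blast
    ultimately show "\<exists>j. sym_diff s t = {j} \<and> graph_act act (comb \<gamma>' (s \<inter> {..<j})) G = R' j"
      using j eq(2) by (intro exI[of _ j]) simp
  qed
  moreover have "robust_below m \<gamma>' R' S"
    unfolding robust_below_def
  proof (intro allI impI)
    fix j \<sigma> G T assume a: "j < m" "\<sigma> \<subseteq> {j<..<m}" "G \<in> \<G>" "pos \<G> T" "T \<subseteq> S"
    have "\<sigma> \<subseteq> {..<m}" using a(2) by auto
    then have e: "comb \<gamma>' \<sigma> = comb \<gamma> \<sigma>" "\<gamma>' j = \<gamma> j" "R' j = R j" using comb a(1) eq by simp_all
    show "\<exists>T'. pos \<G> T' \<and> T' \<subseteq> T \<and> (\<forall>x\<in>T'. \<forall>y\<in>T'. (x, y) \<in> G \<longrightarrow>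
        (act (comb \<gamma>' \<sigma>) x, act (\<gamma>' j) (act (comb \<gamma>' \<sigma>) y)) \<notin> R' j)"
      unfolding e using g a unfolding good_def robust_below_def by blast
  qed
  ultimately show ?thesis using g \<gamma>' eq unfolding good_def by simp
qed

lemma good_zero: "pos \<G> S \<Longrightarrow> (\<And>j. finite (\<gamma> j)) \<Longrightarrow> good 0 \<gamma> R F S"
  by (simp add: good_def distinct_orbits_def only_realized_edges_def robust_below_def)

text \<open>A trivial product fixes the graph \<open>F 0\<close>, which
  \<open>distinct_orbits\<close> allows only for the empty set of generators.\<close>

lemma good_comb_inj:
  assumes "good m \<gamma> R F S" "s \<subseteq> {..<m}" "comb \<gamma> s = {}"
  shows "s = {}"
proof (cases "m = 0")
  case False
  then have "distinct_orbits m \<gamma> F" using assms(1) unfolding good_def by blast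
  moreover have "graph_act act (comb \<gamma> s) (F 0) = F 0" using assms(3) by (simp add: graph_act_empty)
  ultimately show ?thesis using assms(2) False unfolding distinct_orbits_def by blast
qed (use assms(2) in auto)

lemma pos_no_return:
  assumes "pos \<G> T" "finite \<delta>" "\<delta> \<noteq> {}"
  shows "\<exists>T'. pos \<G> T' \<and> T' \<subseteq> T \<and> (\<forall>x\<in>T'. \<forall>y\<in>T'. act \<delta> x \<noteq> y)"
proof -
  obtain T' where T': "pos \<G> T'" "T' \<subseteq> T" "bounded_away \<delta> {} T'"
    using pos_bounded_away[OF assms(1) _ assms(2), of "{}"] assms(3) by auto
  then obtain \<epsilon> where e: "\<epsilon> > 0" "\<forall>u\<in>T'. \<forall>v\<in>T'. \<epsilon> \<le> dist (act \<delta> u) (act {} v)"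
    unfolding bounded_away_def by blast
  have "act \<delta> u \<noteq> v" if "u \<in> T'" "v \<in> T'" for u v
  proof
    assume "act \<delta> u = v"
    then have "\<epsilon> \<le> 0" using e(2) that by (metis act_empty dist_self)
    then show False using e(1) by simp
  qed
  then show ?thesis using T' by blast
qed

text \<open>If \<open>x\<close>, \<open>act c x\<close> lie in a prepared set and form an edge of \<open>R m\<close>, then putting \<open>c\<close> at
  position \<open>m\<close> creates no unwanted edge and keeps the orbits of the graphs \<open>F i\<close> distinct.\<close>

definition prepared :: "nat \<Rightarrow> (nat \<Rightarrow> nat set) \<Rightarrow> (nat \<Rightarrow> ('a \<times> 'a) set) \<Rightarrow> (nat \<Rightarrow> ('a \<times> 'a) set) \<Rightarrow> 'a set \<Rightarrow> 'a set \<Rightarrow> bool" where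
  "prepared m \<gamma> R F S T \<longleftrightarrow>
    (\<forall>s t G x y. s \<subseteq> {..<m} \<longrightarrow> t \<subseteq> {..<m} \<longrightarrow> G \<in> orbit_family \<gamma> F m \<longrightarrow> s \<noteq> t \<longrightarrow> x \<in> T \<longrightarrow> y \<in> T \<longrightarrow>
       (act (comb \<gamma> s) x, act (comb \<gamma> t) y) \<in> G \<longrightarrow>
       (\<exists>z\<in>S. (act (comb \<gamma> s) z, act (comb \<gamma> t) z) \<in> G)) \<and>
    (\<forall>j \<sigma> x y. j < m \<longrightarrow> \<sigma> \<subseteq> {j<..<m} \<longrightarrow> x \<in> T \<longrightarrow> y \<in> T \<longrightarrow> (x, y) \<in> R m \<longrightarrow>
       (act (comb \<gamma> \<sigma>) x, act (\<gamma> j) (act (comb \<gamma> \<sigma>) y)) \<notin> R j) \<and>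
    (\<forall>G\<in>orbit_family \<gamma> F m. G \<noteq> R m \<longrightarrow> anticlique (G \<inter> R m) T) \<and>
    (\<forall>c s i j x y. finite c \<longrightarrow> c \<noteq> {} \<longrightarrow> s \<subseteq> {..<m} \<longrightarrow> i \<le> m \<longrightarrow> j \<le> m \<longrightarrow>
       graph_act act c (graph_act act (comb \<gamma> s) (F i)) = F j \<longrightarrow> x \<in> T \<longrightarrow> y \<in> T \<longrightarrow> act c x \<noteq> y)"

lemmas prepared_nonedge = prepared_def[THEN iffD1, THEN conjunct1, rule_format]
lemmas prepared_robust = prepared_def[THEN iffD1, THEN conjunct2, THEN conjunct1, rule_format]
lemmas prepared_anticlique = prepared_def[THEN iffD1, THEN conjunct2, THEN conjunct2, THEN conjunct1, rule_format]
lemmas prepared_no_return = prepared_def[THEN iffD1, THEN conjunct2, THEN conjunct2, THEN conjunct2, rule_format]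

text \<open>Each clause of \<open>prepared\<close> consists of finitely many dense requirements
  inherited by subsets. They come, in turn, from closedness of the graphs, from robustness, from
  countable chromatic numbers and from freeness.\<close>

lemma exists_prepared:
  assumes g: "good m \<gamma> R F S" and Rm: "R m \<in> \<G>" and Fm: "F m \<in> \<G>"
  obtains T where "pos \<G> T" "T \<subseteq> S" "prepared m \<gamma> R F S T"
proof -
  have fin: "\<And>j. finite (\<gamma> j)" and RF: "\<And>j. j < m \<Longrightarrow> R j \<in> \<G> \<and> F j \<in> \<G>"
    and S: "pos \<G> S" and rb: "robust_below m \<gamma> R S"
    using g by (auto simp: good_def)
  have fc: "finite (comb \<gamma> s)" if "s \<subseteq> {..<m}" for s
    using that fin finite_subset by (intro finite_comb) blast+
  \<comment> \<open>If no single point of \<open>S\<close> gives an edge along \<open>s\<close> and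
    \<open>t\<close>, then by closedness nearby pairs of points do not either; the endpoints differ
    as the generators are independent.\<close>
  define K1 where "K1 = Pow {..<m} \<times> Pow {..<m} \<times> orbit_family \<gamma> F m"
  define Q1 where "Q1 = (\<lambda>(s, t, G) T. s \<noteq> t \<longrightarrow> (\<exists>x\<in>T. \<exists>y\<in>T. (act (comb \<gamma> s) x, act (comb \<gamma> t) y) \<in> G) \<longrightarrow>
     (\<exists>z\<in>S. (act (comb \<gamma> s) z, act (comb \<gamma> t) z) \<in> G))"
  have "\<exists>T. pos \<G> T \<and> T \<subseteq> S \<and> (\<forall>k\<in>K1. Q1 k T)"
  proof (rule pos_dense_finite[OF _ S])
    show "finite K1" unfolding K1_def using finite_orbit_family by simp
  next
    fix k T assume k: "k \<in> K1" and T: "pos \<G> T" "T \<subseteq> S"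
    obtain s t G where kk: "k = (s, t, G)" by (cases k)
    have st: "s \<subseteq> {..<m}" "t \<subseteq> {..<m}" "G \<in> orbit_family \<gamma> F m" using k by (auto simp: K1_def kk)
    have G: "G \<in> \<G>" using orbit_family_in[OF fin _ st(3)] RF by blast
    show "\<exists>T'. pos \<G> T' \<and> T' \<subseteq> T \<and> Q1 k T'"
    proof (cases "s = t \<or> (\<exists>z\<in>S. (act (comb \<gamma> s) z, act (comb \<gamma> t) z) \<in> G)")
      case True
      then show ?thesis using T(1) by (intro exI[of _ T]) (auto simp: Q1_def kk)
    next
      case False
      have "comb \<gamma> s \<noteq> comb \<gamma> t"
      proof
        assume e: "comb \<gamma> s = comb \<gamma> t"
        have "finite s" "finite t" using st(1,2) finite_subset by blast+
        then have "comb \<gamma> (sym_diff s t) = sym_diff (comb \<gamma> s) (comb \<gamma> t)" by (rule comb_sym_diff)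
        also have "\<dots> = {}" unfolding e by blast
        finally have c0: "comb \<gamma> (sym_diff s t) = {}" .
        have "sym_diff s t \<subseteq> {..<m}" using st(1,2) by blast
        from good_comb_inj[OF g this c0] have "sym_diff s t = {}" .
        then show False using False by blast
      qed
      then have ne: "act (comb \<gamma> s) x \<noteq> act (comb \<gamma> t) x" for x using act_inj[OF fc[OF st(1)] fc[OF st(2)]] by blast
      have "\<exists>U. open U \<and> x \<in> U \<and> (\<forall>u\<in>T \<inter> U. \<forall>v\<in>T \<inter> U. (act (comb \<gamma> s) u, act (comb \<gamma> t) v) \<notin> G)"
        if "x \<in> T" for x
      proof -
        have "(act (comb \<gamma> s) x, act (comb \<gamma> t) x) \<notin> G" using False that T(2) by blast
        then obtain U V where UV: "open U" "open V" "act (comb \<gamma> s) x \<in> U" "act (comb \<gamma> t) x \<in> V" "U \<times> V \<inter> G = {}"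
          using graph_nbhd[OF G ne] by blast
        let ?W = "act (comb \<gamma> s) -` U \<inter> act (comb \<gamma> t) -` V"
        have "open ?W" using UV(1,2) st(1,2) by (intro open_Int open_vimage continuous_act fc)
        then show ?thesis using UV(3-5) by (intro exI[of _ ?W]) auto
      qed
      then obtain T' where T': "pos \<G> T'" "T' \<subseteq> T" "\<forall>u\<in>T'. \<forall>v\<in>T'. (act (comb \<gamma> s) u, act (comb \<gamma> t) v) \<notin> G"
        using pos_local[OF T(1), of "\<lambda>T'. \<forall>u\<in>T'. \<forall>v\<in>T'. (act (comb \<gamma> s) u, act (comb \<gamma> t) v) \<notin> G"] by blast
      then show ?thesis by (intro exI[of _ T']) (auto simp: Q1_def kk)
    qed
  qed (auto simp: Q1_def split: prod.splits)
  then obtain T1 where T1: "pos \<G> T1" "T1 \<subseteq> S" "\<And>k. k \<in> K1 \<Longrightarrow> Q1 k T1" by blast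
  define K2 where "K2 = (SIGMA j:{..<m}. Pow {j<..<m})"
  define Q2 where "Q2 = (\<lambda>(j, \<sigma>) T. \<forall>x\<in>T. \<forall>y\<in>T. (x, y) \<in> R m \<longrightarrow>
       (act (comb \<gamma> \<sigma>) x, act (\<gamma> j) (act (comb \<gamma> \<sigma>) y)) \<notin> R j)"
  have "\<exists>T. pos \<G> T \<and> T \<subseteq> T1 \<and> (\<forall>k\<in>K2. Q2 k T)"
  proof (rule pos_dense_finite[OF _ T1(1)])
    show "finite K2" unfolding K2_def by auto
  next
    fix k T assume k: "k \<in> K2" and T: "pos \<G> T" "T \<subseteq> T1"
    obtain j \<sigma> where kk: "k = (j, \<sigma>)" by (cases k)
    have "j < m" "\<sigma> \<subseteq> {j<..<m}" "T \<subseteq> S" using k T(2) T1(2) by (auto simp: K2_def kk)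
    then show "\<exists>T'. pos \<G> T' \<and> T' \<subseteq> T \<and> Q2 k T'"
      using rb Rm T(1) unfolding robust_below_def Q2_def kk prod.case by blast
  qed (auto simp: Q2_def split: prod.splits)
  then obtain T2 where T2: "pos \<G> T2" "T2 \<subseteq> T1" "\<And>k. k \<in> K2 \<Longrightarrow> Q2 k T2" by blast
  \<comment> \<open>A countable cover by Borel anticliques of the intersection leaves a positive
    part in one of them.\<close>
  have "\<exists>T. pos \<G> T \<and> T \<subseteq> T2 \<and> (\<forall>G\<in>orbit_family \<gamma> F m - {R m}. anticlique (G \<inter> R m) T)"
  proof (rule pos_dense_finite[OF _ T2(1)])
    show "finite (orbit_family \<gamma> F m - {R m})" using finite_orbit_family by blast
  next
    fix G T assume G: "G \<in> orbit_family \<gamma> F m - {R m}" and T: "pos \<G> T" "T \<subseteq> T2"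
    have "G \<in> \<G>" using orbit_family_in[of \<gamma> m F G, OF fin] RF G by blast
    then obtain C where C: "countable C" "borel_anticlique_cover (G \<inter> R m) C"
      using graph_chromatic[OF _ Rm] G by blast
    have "\<And>B. B \<in> C \<Longrightarrow> B \<in> sets borel" "T \<subseteq> \<Union>C"
      using C(2) by (simp_all add: borel_anticlique_cover_def)
    then obtain B where B: "B \<in> C" "pos \<G> (T \<inter> B)"
      using pos_borel_cover[OF T(1) C(1)] by metis
    have "anticlique (G \<inter> R m) (T \<inter> B)"
      using C(2) B(1) unfolding borel_anticlique_cover_def anticlique_def by blast
    then show "\<exists>T'. pos \<G> T' \<and> T' \<subseteq> T \<and> anticlique (G \<inter> R m) T'" using B(2) by blast
  qed (auto simp: anticlique_def)
  then obtain T3 where T3: "pos \<G> T3" "T3 \<subseteq> T2" "\<And>G. G \<in> orbit_family \<gamma> F m - {R m} \<Longrightarrow> anticlique (G \<inter> R m) T3"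
    by blast
  \<comment> \<open>At most one group element carries a given graph to another, by freeness on the
    family, so only finitely many elements have to be forbidden.\<close>
  define C where "C s i j = {c. finite c \<and> graph_act act c (graph_act act (comb \<gamma> s) (F i)) = F j}" for s i j
  have finC: "finite (C s i j)" if si: "s \<subseteq> {..<m}" "i \<le> m" for s i j
  proof -
    have "F i \<in> \<G>" using si(2) RF[of i] Fm by (cases "i = m") auto
    then have G: "graph_act act (comb \<gamma> s) (F i) \<in> \<G>" by (rule graph_act_in[OF fc[OF si(1)]])
    have "C s i j \<subseteq> {c}" if "c \<in> C s i j" for c
    proof
      fix c' assume "c' \<in> C s i j"
      then have "c' = c"
        using that graph_act_inj[OF _ _ G, of c' c] unfolding C_def mem_Collect_eq by metis
      then show "c' \<in> {c}" by simp
    qed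
    then show ?thesis by (cases "C s i j = {}") (simp, meson equals0I finite.emptyI finite_insert finite_subset)
  qed
  define E where "E = (\<Union>k\<in>Pow {..<m} \<times> {..m} \<times> {..m}. C (fst k) (fst (snd k)) (snd (snd k)))"
  have "finite E" unfolding E_def
  proof (rule finite_UN_I)
    fix k assume "k \<in> Pow {..<m} \<times> {..m} \<times> {..m}"
    then show "finite (C (fst k) (fst (snd k)) (snd (snd k)))" by (intro finC) auto
  qed simp
  have E: "finite c" if c: "c \<in> E" for c using c unfolding E_def C_def by blast
  have "\<exists>T. pos \<G> T \<and> T \<subseteq> T3 \<and> (\<forall>c\<in>E - {{}}. \<forall>x\<in>T. \<forall>y\<in>T. act c x \<noteq> y)"
  proof (rule pos_dense_finite[OF _ T3(1)])
    show "finite (E - {{}})" using \<open>finite E\<close> by simp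
  next
    fix c T assume c: "c \<in> E - {{}}" and T: "pos \<G> T" "T \<subseteq> T3"
    have "finite c" "c \<noteq> {}" using c E by blast+
    then show "\<exists>T'. pos \<G> T' \<and> T' \<subseteq> T \<and> (\<forall>x\<in>T'. \<forall>y\<in>T'. act c x \<noteq> y)" by (rule pos_no_return[OF T(1)])
  qed auto
  then obtain T4 where T4: "pos \<G> T4" "T4 \<subseteq> T3" "\<And>c x y. c \<in> E - {{}} \<Longrightarrow> x \<in> T4 \<Longrightarrow> y \<in> T4 \<Longrightarrow> act c x \<noteq> y"
    by blast
  have sub: "T4 \<subseteq> T1" "T4 \<subseteq> T2" using T4(2) T3(2) T2(2) by blast+
  have "prepared m \<gamma> R F S T4"
    unfolding prepared_def
  proof (intro conjI allI impI ballI)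
    fix s t G x y
    assume a: "s \<subseteq> {..<m}" "t \<subseteq> {..<m}" "G \<in> orbit_family \<gamma> F m" "s \<noteq> t" "x \<in> T4" "y \<in> T4"
      "(act (comb \<gamma> s) x, act (comb \<gamma> t) y) \<in> G"
    have "Q1 (s, t, G) T1" using a(1-3) by (intro T1(3)) (simp add: K1_def)
    then show "\<exists>z\<in>S. (act (comb \<gamma> s) z, act (comb \<gamma> t) z) \<in> G"
      using a(4-7) sub(1) unfolding Q1_def by blast
  next
    fix j \<sigma> x y assume a: "j < m" "\<sigma> \<subseteq> {j<..<m}" "x \<in> T4" "y \<in> T4" "(x, y) \<in> R m"
    have "Q2 (j, \<sigma>) T2" using a(1,2) by (intro T2(3)) (simp add: K2_def)
    then show "(act (comb \<gamma> \<sigma>) x, act (\<gamma> j) (act (comb \<gamma> \<sigma>) y)) \<notin> R j"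
      using a(3-5) sub(2) unfolding Q2_def by blast
  next
    fix G assume "G \<in> orbit_family \<gamma> F m" "G \<noteq> R m"
    then have "anticlique (G \<inter> R m) T3" by (intro T3(3)) simp
    then show "anticlique (G \<inter> R m) T4" using T4(2) unfolding anticlique_def by blast
  next
    fix c s i j x y
    assume a: "finite c" "c \<noteq> {}" "s \<subseteq> {..<m}" "i \<le> m" "j \<le> m"
      "graph_act act c (graph_act act (comb \<gamma> s) (F i)) = F j" "x \<in> T4" "y \<in> T4"
    have "c \<in> C s i j" using a by (simp add: C_def)
    then have "c \<in> E" unfolding E_def using a(3-5) by (intro UN_I[of "(s, i, j)"]) auto
    then show "act c x \<noteq> y" using a T4(3) by blast
  qed
  moreover have "T4 \<subseteq> S" using sub T1(2) by blast
  ultimately show thesis using that T4(1) by blast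
qed

lemma act_comb_upd:
  assumes "\<And>j. finite (\<gamma> j)" "finite c" "s \<subseteq> {..<m}"
  shows "act (comb (\<gamma>(m := c)) (insert m s)) x = act (comb \<gamma> s) (act c x)"
proof -
  have fin: "finite s" using assms(3) finite_subset by blast
  have "act (comb (\<gamma>(m := c)) (s \<union> {m})) x =
      act (comb (\<gamma>(m := c)) s) (act (comb (\<gamma>(m := c)) {m}) x)"
    using assms fin by (intro act_comb_Un) auto
  moreover have "comb (\<gamma>(m := c)) s = comb \<gamma> s" using assms(3) by (intro comb_cong) auto
  ultimately show ?thesis by (simp add: comb_single)
qed

lemma comb_upd: "s \<subseteq> {..<m} \<Longrightarrow> comb (\<gamma>(m := c)) s = comb \<gamma> s"
  by (intro comb_cong) auto

text \<open>If \<open>s\<close> and \<open>t\<close> differ, the edge already occurs at a single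
  point of \<open>S\<close>. By the invariant they then differ in one \<open>j\<close> and the edge
  translates into \<open>R j\<close>, between points moved by \<sigma> and exactly the kind of edge
  that robustness of \<open>\<gamma> j\<close> excludes. So \<open>s = t\<close>, and the translated
  graph shares the edge \<open>(x, y)\<close> with \<open>R m\<close>, which forces
  equality.\<close>

lemma new_edge_realized:
  assumes g: "good m \<gamma> R F S" and Rm: "R m \<in> \<G>" and T: "T \<subseteq> S" "prepared m \<gamma> R F S T"
    and x: "x \<in> T" "y \<in> T" "(x, y) \<in> R m"
    and G: "k \<le> m" "G \<in> orbit_family \<gamma> F k"
    and st: "s \<subseteq> {..<m}" "t \<subseteq> {..<m}" "sym_diff s t \<subseteq> {k..}"
    and edge: "(act (comb \<gamma> s) x, act (comb \<gamma> t) y) \<in> G"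
  shows "s = t \<and> graph_act act (comb \<gamma> s) G = R m"
proof -
  have fin: "\<And>j. finite (\<gamma> j)" and RF: "\<And>j. j < m \<Longrightarrow> R j \<in> \<G> \<and> F j \<in> \<G>"
    and ore: "only_realized_edges m \<gamma> R F S"
    using g by (auto simp: good_def)
  have fins: "finite s" "finite t" using st(1,2) finite_subset by blast+
  have Gm: "G \<in> orbit_family \<gamma> F m" using G orbit_family_mono by blast
  have st_eq: "s = t"
  proof (rule ccontr)
    assume ne: "s \<noteq> t"
    obtain z where z: "z \<in> S" "(act (comb \<gamma> s) z, act (comb \<gamma> t) z) \<in> G"
      using prepared_nonedge[OF T(2) st(1,2) Gm ne x(1,2) edge] by blast
    obtain j where j: "sym_diff s t = {j}" "graph_act act (comb \<gamma> (s \<inter> {..<j})) G = R j"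
      using only_realized_edgesD[OF ore G st(1,2) ne st(3) z] by blast
    have jm: "j < m" using j(1) st(1,2) by blast
    \<comment> \<open>\<open>s\<close> and \<open>t\<close> agree except at \<open>j\<close>. The
      part \<open>r\<close> below \<open>j\<close> translates \<open>G\<close> to
      \<open>R j\<close>, the part \<sigma> above \<open>j\<close> moves the points.\<close>
    define r \<sigma> where "r = s \<inter> {..<j}" and "\<sigma> = s \<inter> {j<..<m}"
    have \<sigma>: "\<sigma> \<subseteq> {j<..<m}" by (auto simp: \<sigma>_def)
    have finr: "finite r" "finite \<sigma>" using fins by (auto simp: r_def \<sigma>_def)
    have fcr: "finite (comb \<gamma> r)" using fin finr by (intro finite_comb)
    have iff: "i \<in> t \<longleftrightarrow> i \<in> s" if "i \<noteq> j" for i using j(1) that by blast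
    have c1: "act (comb \<gamma> (r \<union> \<sigma>)) u = act (comb \<gamma> r) (act (comb \<gamma> \<sigma>) u)" for u
      using fin finr by (intro act_comb_Un) (auto simp: r_def \<sigma>_def)
    have c2: "act (comb \<gamma> (r \<union> ({j} \<union> \<sigma>))) u = act (comb \<gamma> r) (act (\<gamma> j) (act (comb \<gamma> \<sigma>) u))" for u
    proof -
      have "act (comb \<gamma> (r \<union> ({j} \<union> \<sigma>))) u = act (comb \<gamma> r) (act (comb \<gamma> ({j} \<union> \<sigma>)) u)"
        using fin finr by (intro act_comb_Un) (auto simp: r_def \<sigma>_def)
      also have "act (comb \<gamma> ({j} \<union> \<sigma>)) u = act (comb \<gamma> {j}) (act (comb \<gamma> \<sigma>) u)"
        using fin finr by (intro act_comb_Un) (auto simp: r_def \<sigma>_def)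
      finally show ?thesis by (simp add: comb_single)
    qed
    have no: "(act (comb \<gamma> \<sigma>) u, act (\<gamma> j) (act (comb \<gamma> \<sigma>) v)) \<notin> R j"
      if "u \<in> T" "v \<in> T" "(u, v) \<in> R m" for u v
      using prepared_robust[OF T(2) jm \<sigma> that] .
    have Rj: "R j \<in> \<G>" using RF jm by blast
    have Rj_iff: "(u, v) \<in> R j \<longleftrightarrow> (act (comb \<gamma> r) u, act (comb \<gamma> r) v) \<in> G" for u v
      using graph_act_iff[OF fcr, of u v G] j(2) by (simp add: r_def)
    have s_split: "i \<in> s \<longleftrightarrow> i \<in> r \<union> \<sigma> \<or> i = j \<and> j \<in> s" for i
      using st(1) by (cases i j rule: linorder_cases) (auto simp: r_def \<sigma>_def)
    have j_iff: "j \<in> t \<longleftrightarrow> j \<notin> s" using j(1) by blast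
    have t_split: "i \<in> t \<longleftrightarrow> i \<in> r \<union> \<sigma> \<or> i = j \<and> j \<notin> s" for i
      using s_split[of i] iff[of i] j_iff by (cases "i = j") (auto simp: r_def \<sigma>_def)
    show False
    proof (cases "j \<in> s")
      case False
      then have s: "s = r \<union> \<sigma>" and t: "t = r \<union> ({j} \<union> \<sigma>)"
        using s_split t_split by blast+
      have "(act (comb \<gamma> \<sigma>) x, act (\<gamma> j) (act (comb \<gamma> \<sigma>) y)) \<in> R j"
        using edge unfolding s t c1 c2 Rj_iff .
      then show False using no x by blast
    next
      case True
      then have s: "s = r \<union> ({j} \<union> \<sigma>)" and t: "t = r \<union> \<sigma>"
        using s_split t_split by blast+
      have "(act (\<gamma> j) (act (comb \<gamma> \<sigma>) x), act (comb \<gamma> \<sigma>) y) \<in> R j"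
        using edge unfolding s t c1 c2 Rj_iff .
      then show False using no x graph_sym[OF Rj] graph_sym[OF Rm] by blast
    qed
  qed
  have "(x, y) \<in> graph_act act (comb \<gamma> s) G"
    using edge st_eq fin fins by (simp add: graph_act_iff finite_comb)
  moreover have "graph_act act (comb \<gamma> s) G \<in> orbit_family \<gamma> F m"
    using fin Gm st(1) by (intro orbit_family_act)
  ultimately have "graph_act act (comb \<gamma> s) G = R m"
    using prepared_anticlique[OF T(2), of "graph_act act (comb \<gamma> s) G"] x unfolding anticlique_def by blast
  then show ?thesis using st_eq by blast
qed

text \<open>The new generator is a robust edge of \<open>R m\<close> inside a prepared set.
  Robustness provides for later stages, preparedness settles the conflicts with the earlier
  ones.\<close>

lemma good_step:
  assumes g: "good m \<gamma> R F S" and Rm: "R m \<in> \<G>" and Fm: "F m \<in> \<G>" "F m \<notin> orbit_family \<gamma> F m"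
  obtains c T where "finite c" "T \<subseteq> S" "\<And>x. x \<in> T \<Longrightarrow> act c x \<in> S \<and> (x, act c x) \<in> R m"
    "good (Suc m) (\<gamma>(m := c)) R F T"
proof -
  have fin: "\<And>j. finite (\<gamma> j)" and RF: "\<And>j. j < m \<Longrightarrow> R j \<in> \<G> \<and> F j \<in> \<G>"
    and S: "pos \<G> S" and rb: "robust_below m \<gamma> R S" and dis: "distinct_orbits m \<gamma> F"
    and ore: "only_realized_edges m \<gamma> R F S"
    using g by (auto simp: good_def)
  have fc: "finite (comb \<gamma> s)" if "s \<subseteq> {..<m}" for s
    using that fin finite_subset by (intro finite_comb) blast+
  obtain P where P: "pos \<G> P" "P \<subseteq> S" "prepared m \<gamma> R F S P"
    using exists_prepared[OF g Rm Fm(1)] by blast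
  obtain c T where c: "finite c" and T: "pos \<G> T" "T \<subseteq> P" "robust c (R m) T"
    and edge: "\<And>x. x \<in> T \<Longrightarrow> act c x \<in> P \<and> (x, act c x) \<in> R m"
    using robust_edges[OF P(1) Rm] by blast
  define \<gamma>' where "\<gamma>' = \<gamma>(m := c)"
  have fin': "finite (\<gamma>' j)" for j using fin c by (simp add: \<gamma>'_def)
  have TS: "T \<subseteq> S" using T(2) P(2) by blast
  have cS: "act c x \<in> S" if "x \<in> T" for x using edge[OF that] P(2) by blast
  have comb_old: "comb \<gamma>' s = comb \<gamma> s" if "s \<subseteq> {..<m}" for s
    using comb_upd[OF that] by (simp add: \<gamma>'_def)
  have comb_new: "act (comb \<gamma>' (insert m s)) x = act (comb \<gamma> s) (act c x)" if "s \<subseteq> {..<m}" for s x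
    using act_comb_upd[OF fin c that] by (simp add: \<gamma>'_def)
  have split: "s \<subseteq> {..<m} \<or> (\<exists>s0. s0 \<subseteq> {..<m} \<and> s = insert m s0)" if "s \<subseteq> {..<Suc m}" for s
  proof (cases "m \<in> s")
    case True
    then have "s = insert m (s - {m})" "s - {m} \<subseteq> {..<m}" using that by (auto simp: less_Suc_eq)
    then show ?thesis by blast
  next
    case False
    then have "s \<subseteq> {..<m}" using that by (force simp: less_Suc_eq)
    then show ?thesis by blast
  qed
  obtain x0 where x0: "x0 \<in> T" using pos_nonempty[OF T(1)] by blast
  have c_ne: "c \<noteq> {}"
    using edge[OF x0] graph_irrefl[OF Rm] act_empty by metis
  \<comment> \<open>The element \<open>c\<close> moves \<open>x0\<close> to another point of
    \<open>P\<close>, whereas elements carrying one of these graphs to another leave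
    \<open>P\<close>.\<close>
  have no_return: "graph_act act c (graph_act act (comb \<gamma> s) (F i)) \<noteq> F j"
    if "s \<subseteq> {..<m}" "i \<le> m" "j \<le> m" for s i j
  proof
    assume "graph_act act c (graph_act act (comb \<gamma> s) (F i)) = F j"
    moreover have "x0 \<in> P" "act c x0 \<in> P" using x0 T(2) edge[OF x0] by blast+
    ultimately have "act c x0 \<noteq> act c x0" using prepared_no_return[OF P(3) c c_ne that] by blast
    then show False by blast
  qed
  have "distinct_orbits (Suc m) \<gamma>' F"
    unfolding distinct_orbits_def
  proof (intro allI impI)
    fix s i j
    assume a: "s \<subseteq> {..<Suc m}" "i < Suc m" "j < Suc m" "graph_act act (comb \<gamma>' s) (F i) = F j"
    show "i = j \<and> s = {}"
    proof (cases "s \<subseteq> {..<m}")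
      case False
      then obtain s0 where s0: "s0 \<subseteq> {..<m}" "s = insert m s0" using split[OF a(1)] by blast
      have "(x, y) \<in> graph_act act (comb \<gamma>' s) (F i) \<longleftrightarrow>
          (x, y) \<in> graph_act act c (graph_act act (comb \<gamma> s0) (F i))" for x y
      proof -
        have "finite s" using a(1) finite_subset by blast
        then have "finite (comb \<gamma>' s)" using fin' by (intro finite_comb)
        then show ?thesis using c fc[OF s0(1)] by (simp add: graph_act_iff s0(2) comb_new[OF s0(1)])
      qed
      then have "graph_act act (comb \<gamma>' s) (F i) = graph_act act c (graph_act act (comb \<gamma> s0) (F i))" by auto
      then show ?thesis using no_return[OF s0(1), of i j] a(2-4) by simp
    next
      case True
      then have e: "graph_act act (comb \<gamma> s) (F i) = F j" using a(4) comb_old by simp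
      consider "i < m" "j < m" | "i = m" "j = m" | "i = m" "j < m" | "i < m" "j = m"
        using a(2,3) by linarith
      then show ?thesis
      proof cases
        case 1
        then show ?thesis using distinct_orbitsD[OF dis True] e by blast
      next
        case 2
        then have "comb \<gamma> s = {}" using e Fm(1) fc[OF True] by (intro graph_act_free) auto
        then show ?thesis using good_comb_inj[OF g True] 2 by simp
      next
        case 3
        have "graph_act act (comb \<gamma> s) (F j) = graph_act act (comb \<gamma> s) (graph_act act (comb \<gamma> s) (F i))"
          using e by simp
        also have "\<dots> = F m" using 3 fc[OF True] by (simp add: graph_act_graph_act graph_act_empty)
        finally have "F m \<in> orbit_family \<gamma> F m" using True 3 unfolding orbit_family_def by blast
        then show ?thesis using Fm(2) by blast
      next
        case 4
        then have "F m \<in> orbit_family \<gamma> F m" using True e unfolding orbit_family_def by blast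
        then show ?thesis using Fm(2) by blast
      qed
    qed
  qed
  moreover have "only_realized_edges (Suc m) \<gamma>' R F T"
    unfolding only_realized_edges_def
  proof (intro allI impI)
    fix k G s t x
    assume a: "k \<le> Suc m" "G \<in> orbit_family \<gamma>' F k" "s \<subseteq> {..<Suc m}" "t \<subseteq> {..<Suc m}" "s \<noteq> t"
      "sym_diff s t \<subseteq> {k..}" "x \<in> T" "(act (comb \<gamma>' s) x, act (comb \<gamma>' t) x) \<in> G"
    \<comment> \<open>The case \<open>k = Suc m\<close> is void: \<open>s\<close> and
      \<open>t\<close> differ somewhere, and all their elements are below \<open>Suc m\<close>.
      Hence \<open>G\<close> was under control before \<open>c\<close> was chosen.\<close>
    obtain i where "i \<in> sym_diff s t" using a(5) by blast
    then have "i < Suc m" "k \<le> i" using a(3,4,6) by blast+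
    then have km: "k \<le> m" by simp
    then have Gk: "G \<in> orbit_family \<gamma> F k"
      using a(2) orbit_family_cong[of k \<gamma>' \<gamma> F F] by (simp add: \<gamma>'_def)
    have Gin: "G \<in> \<G>" using orbit_family_in[OF fin _ Gk] RF km by (meson less_le_trans)
    have xP: "x \<in> P" "act c x \<in> P" "(x, act c x) \<in> R m" using a(7) T(2) edge[OF a(7)] by blast+
    let ?c = "\<exists>j. sym_diff s t = {j} \<and> graph_act act (comb \<gamma>' (s \<inter> {..<j})) G = R j"
    \<comment> \<open>Both or neither of \<open>s\<close> and \<open>t\<close> contain
      \<open>m\<close>: the edge is one of the previous stage, at \<open>act c x\<close> or at
      \<open>x\<close>.\<close>
    have old: ?c if st0: "s0 \<subseteq> {..<m}" "t0 \<subseteq> {..<m}" "sym_diff s t = sym_diff s0 t0" "s0 = s \<inter> {..<m}"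
      and z: "z \<in> S" "(act (comb \<gamma> s0) z, act (comb \<gamma> t0) z) \<in> G" for s0 t0 z
    proof -
      have "s0 \<noteq> t0" using st0(3) a(5) by blast
      then obtain j where j: "sym_diff s0 t0 = {j}" "graph_act act (comb \<gamma> (s0 \<inter> {..<j})) G = R j"
        using only_realized_edgesD[OF ore km Gk st0(1,2) _ _ z] a(6) unfolding st0(3) by blast
      have "j < m" using j(1) st0(1,2) by blast
      then have "s \<inter> {..<j} = s0 \<inter> {..<j}" unfolding st0(4) by auto
      moreover have "comb \<gamma>' (s0 \<inter> {..<j}) = comb \<gamma> (s0 \<inter> {..<j})" using st0(1) by (intro comb_old) blast
      ultimately show ?c using j st0(3) by (intro exI[of _ j]) simp
    qed
    \<comment> \<open>Exactly one of \<open>s\<close> and \<open>t\<close> contains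
      \<open>m\<close>. By symmetry of \<open>G\<close> the endpoint moved by \<open>c\<close> is
      put second, so the disjunction covers both cases.\<close>
    have new: ?c if st0: "s0 \<subseteq> {..<m}" "t0 \<subseteq> {..<m}" "s0 = s \<inter> {..<m}" "sym_diff s t = insert m (sym_diff s0 t0)"
      and e: "(act (comb \<gamma> s0) x, act (comb \<gamma> t0) (act c x)) \<in> G \<or> (act (comb \<gamma> t0) x, act (comb \<gamma> s0) (act c x)) \<in> G"
      for s0 t0
    proof -
      have sub: "sym_diff s0 t0 \<subseteq> {k..}" "sym_diff t0 s0 \<subseteq> {k..}" using st0(4) a(6) by blast+
      have "s0 = t0 \<and> graph_act act (comb \<gamma> s0) G = R m"
        using e
      proof
        assume "(act (comb \<gamma> s0) x, act (comb \<gamma> t0) (act c x)) \<in> G"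
        then show ?thesis
          using new_edge_realized[OF g Rm P(2,3) xP km Gk st0(1,2) sub(1)] by blast
      next
        assume "(act (comb \<gamma> t0) x, act (comb \<gamma> s0) (act c x)) \<in> G"
        then have "t0 = s0 \<and> graph_act act (comb \<gamma> t0) G = R m"
          by (rule new_edge_realized[OF g Rm P(2,3) xP km Gk st0(2,1) sub(2)])
        then show ?thesis by blast
      qed
      then have "sym_diff s t = {m}" "graph_act act (comb \<gamma>' (s \<inter> {..<m})) G = R m"
        using st0(3,4) comb_old[OF st0(1)] by auto
      then show ?c by blast
    qed
    have sp: "(s \<subseteq> {..<m} \<and> s = s \<inter> {..<m}) \<or> (\<exists>s0. s0 \<subseteq> {..<m} \<and> s = insert m s0 \<and> s0 = s \<inter> {..<m})"
      using split[OF a(3)] by auto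
    then show ?c
    proof (elim disjE exE conjE)
      assume s: "s \<subseteq> {..<m}" "s = s \<inter> {..<m}"
      from split[OF a(4)] show ?c
      proof (elim disjE exE conjE)
        assume t: "t \<subseteq> {..<m}"
        show ?c
          by (rule old[OF s(1) t refl s(2), of x]) (use a(7,8) TS comb_old s(1) t in auto)
      next
        fix t0 assume t: "t0 \<subseteq> {..<m}" "t = insert m t0"
        have "sym_diff s t = insert m (sym_diff s t0)" using s(1) t by auto
        moreover have "(act (comb \<gamma> s) x, act (comb \<gamma> t0) (act c x)) \<in> G"
          using a(8) unfolding t(2) comb_new[OF t(1)] comb_old[OF s(1)] .
        ultimately show ?c by (intro new[OF s(1) t(1) s(2)]) auto
      qed
    next
      fix s0 assume s: "s0 \<subseteq> {..<m}" "s = insert m s0" "s0 = s \<inter> {..<m}"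
      from split[OF a(4)] show ?c
      proof (elim disjE exE conjE)
        assume t: "t \<subseteq> {..<m}"
        have "sym_diff s t = insert m (sym_diff s0 t)" using s(1,2) t by auto
        moreover have "(act (comb \<gamma> s0) (act c x), act (comb \<gamma> t) x) \<in> G"
          using a(8) unfolding s(2) comb_new[OF s(1)] comb_old[OF t] .
        then have "(act (comb \<gamma> t) x, act (comb \<gamma> s0) (act c x)) \<in> G" by (rule graph_sym[OF Gin])
        ultimately show ?c by (intro new[OF s(1) t s(3)]) auto
      next
        fix t0 assume t: "t0 \<subseteq> {..<m}" "t = insert m t0"
        have "sym_diff s t = sym_diff s0 t0" using s(1,2) t by auto
        moreover have "(act (comb \<gamma> s0) (act c x), act (comb \<gamma> t0) (act c x)) \<in> G"
          using a(8) unfolding s(2) t(2) comb_new[OF s(1)] comb_new[OF t(1)] .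
        ultimately show ?c by (intro old[OF s(1) t(1) _ s(3) cS[OF a(7)]])
      qed
    qed
  qed
  moreover have "robust_below (Suc m) \<gamma>' R T"
    unfolding robust_below_def
  proof (intro allI impI)
    fix j \<sigma> G W assume a: "j < Suc m" "\<sigma> \<subseteq> {j<..<Suc m}" "G \<in> \<G>" "pos \<G> W" "W \<subseteq> T"
    let ?c = "\<exists>T'. pos \<G> T' \<and> T' \<subseteq> W \<and> (\<forall>x\<in>T'. \<forall>y\<in>T'. (x, y) \<in> G \<longrightarrow>
        (act (comb \<gamma>' \<sigma>) x, act (\<gamma>' j) (act (comb \<gamma>' \<sigma>) y)) \<notin> R j)"
    have WS: "W \<subseteq> S" using a(5) TS by blast
    show ?c
    proof (cases "j = m")
      \<comment> \<open>For \<open>j = m\<close> nothing lies above \<open>j\<close> yet, and the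
        claim is the robustness of \<open>c\<close>.\<close>
      case True
      then have "{j<..<Suc m} = {}" by auto
      then have "\<sigma> = {}" "\<gamma>' j = c" using a(2) True by (auto simp: \<gamma>'_def)
      then show ?thesis
        using T(3) a(3-5) True unfolding robust_def by (simp add: comb_empty act_empty)
    next
      case False
      then have jm: "j < m" "\<gamma>' j = \<gamma> j" using a(1) by (auto simp: \<gamma>'_def)
      have sg: "j < i \<and> i < Suc m" if "i \<in> \<sigma>" for i using subsetD[OF a(2) that] by simp
      then have sm: "\<sigma> \<subseteq> {..<Suc m}" by blast
      from split[OF this] show ?thesis
      proof (elim disjE exE conjE)
        assume s: "\<sigma> \<subseteq> {..<m}"
        have "\<sigma> \<subseteq> {j<..<m}"
        proof
          fix i assume "i \<in> \<sigma>"
          then show "i \<in> {j<..<m}" using subsetD[OF s] sg by simp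
        qed
        then show ?c unfolding comb_old[OF s] jm(2)
          using robust_belowD[OF rb jm(1) _ a(3,4) WS] by blast
      next
        fix s0 assume s: "s0 \<subseteq> {..<m}" "\<sigma> = insert m s0"
        have s0: "s0 \<subseteq> {j<..<m}"
        proof
          fix i assume "i \<in> s0"
          then show "i \<in> {j<..<m}" using subsetD[OF s(1)] sg s(2) by simp
        qed
        \<comment> \<open>When \<open>m\<close> belongs to \<sigma>, the old property is applied to
          the translates by \<open>c\<close> of \<open>W\<close> and of \<open>G\<close>; the
          positive set obtained is moved back by \<open>c\<close>.\<close>
        have "act c ` W \<subseteq> S" using cS a(5) by blast
        then obtain V where V: "pos \<G> V" "V \<subseteq> act c ` W"
          "\<forall>x\<in>V. \<forall>y\<in>V. (x, y) \<in> graph_act act c G \<longrightarrow>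
            (act (comb \<gamma> s0) x, act (\<gamma> j) (act (comb \<gamma> s0) y)) \<notin> R j"
          using robust_belowD[OF rb jm(1) s0 graph_act_in[OF c a(3)] pos_act[OF c a(4)]] by blast
        have "act c ` V \<subseteq> W"
        proof
          fix x assume "x \<in> act c ` V"
          then obtain w where "w \<in> W" "x = act c (act c w)" using V(2) by blast
          then show "x \<in> W" by (simp add: act_invol[OF c])
        qed
        moreover have "(act (comb \<gamma>' \<sigma>) x, act (\<gamma>' j) (act (comb \<gamma>' \<sigma>) y)) \<notin> R j"
          if xy: "x \<in> act c ` V" "y \<in> act c ` V" "(x, y) \<in> G" for x y
        proof -
          obtain u v where uv: "u \<in> V" "x = act c u" "v \<in> V" "y = act c v" using xy(1,2) by blast
          have "(u, v) \<in> graph_act act c G" using xy(3) uv c by (simp add: graph_act_iff)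
          then have "(act (comb \<gamma> s0) u, act (\<gamma> j) (act (comb \<gamma> s0) v)) \<notin> R j" using V(3) uv by blast
          then show ?thesis
            unfolding s(2) comb_new[OF s(1)] jm(2) uv by (simp add: act_invol[OF c])
        qed
        moreover have "pos \<G> (act c ` V)" by (rule pos_act[OF c V(1)])
        ultimately show ?c by blast
      qed
    qed
  qed
  moreover have "\<forall>j<Suc m. R j \<in> \<G> \<and> F j \<in> \<G>" using RF Rm Fm(1) by (auto simp: less_Suc_eq)
  ultimately have "good (Suc m) \<gamma>' R F T" using fin' T(1) by (simp add: good_def)
  then show thesis
    using that[OF c TS] edge P(2) unfolding \<gamma>'_def by blast
qed

end

section \<open>Fusion\<close>

type_synonym 'a stage = "(nat \<Rightarrow> nat set) \<times> (nat \<Rightarrow> ('a \<times> 'a) set) \<times> (nat \<Rightarrow> ('a \<times> 'a) set) \<times>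
  (nat \<Rightarrow> nat) set \<times> ((nat \<Rightarrow> nat) \<Rightarrow> 'a)"

text \<open>Codes: \<open>third 0\<close> and \<open>third 1\<close> recover codes of a point and of its translate at the previous
  stage, \<open>third 2\<close> is a witness for membership in the new set.\<close>

definition third :: "nat \<Rightarrow> (nat \<Rightarrow> nat) \<Rightarrow> nat \<Rightarrow> nat" where
  "third i d = (\<lambda>n. d (3 * n + i))"

lemma continuous_third: "continuous_on UNIV (third i)"
  unfolding third_def by (rule continuous_on_reindex)

lemma exists_thirds: "\<exists>d. third 0 d = x \<and> third 1 d = y \<and> third 2 d = z"
proof -
  define d where "d n = (if n mod 3 = 0 then x (n div 3) else if n mod 3 = 1 then y (n div 3) else z (n div 3))" for n
  have "(3 * n + i) div 3 = n" "(3 * n + i) mod 3 = i" if "i < 3" for n i :: nat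
    using that by simp_all
  from this[of 0] this[of 1] this[of 2]
  have "third 0 d = x" "third 1 d = y" "third 2 d = z" unfolding third_def d_def fun_eq_iff by simp_all
  then show ?thesis by blast
qed

section \<open>One stage of the fusion on codes\<close>

context free_graph_family
begin

text \<open>Keeping codes of both \<open>x\<close> and \<open>act c x\<close> inside the old
  \<open>K\<close> lets later limits be traced back along either of them. There are countably many
  strings of length \<open>L\<close>, so one of them can be fixed as the beginning of all codes
  without losing positivity.\<close>

lemma code_step:
  assumes K: "closed K" "continuous_on UNIV (g :: (nat \<Rightarrow> nat) \<Rightarrow> 'a)"
    and T: "pos \<G> T" "T \<subseteq> g ` K" "act c ` T \<subseteq> g ` K" and c: "finite c"
  obtains K' where "closed K'" "pos \<G> ((\<lambda>d. g (third 0 d)) ` K')" "(\<lambda>d. g (third 0 d)) ` K' \<subseteq> T"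
    "\<And>d. d \<in> K' \<Longrightarrow> third 0 d \<in> K \<and> third 1 d \<in> K \<and> act c (g (third 0 d)) = g (third 1 d)"
    "\<And>d d' i. d \<in> K' \<Longrightarrow> d' \<in> K' \<Longrightarrow> i < L \<Longrightarrow> d i = d' i"
proof -
  obtain M k where M: "closed M" "continuous_on UNIV (k :: (nat \<Rightarrow> nat) \<Rightarrow> 'a)" "T = k ` M"
    using T(1) unfolding pos_def souslin_def by blast
  have cg: "continuous_on UNIV (\<lambda>d. g (third i d))" for i
    by (rule continuous_on_compose2[OF K(2) continuous_third]) simp
  have ck: "continuous_on UNIV (\<lambda>d. k (third i d))" for i
    by (rule continuous_on_compose2[OF M(2) continuous_third]) simp
  have cc: "continuous_on UNIV (\<lambda>d. act c (g (third i d)))" for i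
    by (rule continuous_on_compose2[OF continuous_act[OF c] cg]) simp
  define W where "W = third 0 -` K \<inter> third 1 -` K \<inter> third 2 -` M \<inter>
    {d. k (third 2 d) = g (third 0 d)} \<inter> {d. act c (g (third 0 d)) = g (third 1 d)}"
  have W: "closed W" unfolding W_def
    by (intro closed_Int closed_vimage K(1) M(1) continuous_third closed_Collect_eq cg ck cc)
  have WT: "(\<lambda>d. g (third 0 d)) ` W \<subseteq> T"
  proof
    fix x assume "x \<in> (\<lambda>d. g (third 0 d)) ` W"
    then obtain d where "third 2 d \<in> M" "x = k (third 2 d)" by (auto simp: W_def)
    then show "x \<in> T" unfolding M(3) by blast
  qed
  have TW: "T \<subseteq> (\<Union>u\<in>{u. length u = L}. (\<lambda>d. g (third 0 d)) ` (W \<inter> string_cylinder u))"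
  proof
    fix x assume x: "x \<in> T"
    obtain m where m: "m \<in> M" "x = k m" using x M(3) by blast
    obtain u where u: "u \<in> K" "x = g u" using x T(2) by blast
    obtain v where v: "v \<in> K" "act c x = g v" using x T(3) by blast
    obtain d where d: "third 0 d = u" "third 1 d = v" "third 2 d = m" using exists_thirds by blast
    have "d \<in> W" using m u v d by (simp add: W_def)
    moreover have "d \<in> string_cylinder (map d [0..<L])"
      by (simp add: string_cylinder_def cylinder_def)
    ultimately have "x \<in> (\<lambda>d. g (third 0 d)) ` (W \<inter> string_cylinder (map d [0..<L]))"
      using u(2) d(1) by blast
    then show "x \<in> (\<Union>u\<in>{u. length u = L}. (\<lambda>d. g (third 0 d)) ` (W \<inter> string_cylinder u))"
      by (intro UN_I[of "map d [0..<L]"]) simp_all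
  qed
  have "\<exists>u. length u = L \<and> (\<lambda>d. g (third 0 d)) ` (W \<inter> string_cylinder u) \<notin> graph_ideal \<G>"
  proof (rule ccontr)
    assume "\<not> ?thesis"
    then have "(\<Union>u\<in>{u. length u = L}. (\<lambda>d. g (third 0 d)) ` (W \<inter> string_cylinder u)) \<in> graph_ideal \<G>"
      by (intro graph_ideal_Union countable_image countableI_type) blast
    then have "T \<in> graph_ideal \<G>" by (rule graph_ideal_subset[OF _ TW])
    then show False using T(1) by (simp add: pos_def)
  qed
  then obtain u where u: "length u = L" "(\<lambda>d. g (third 0 d)) ` (W \<inter> string_cylinder u) \<notin> graph_ideal \<G>" by blast
  let ?K = "W \<inter> string_cylinder u"
  have cK: "closed ?K" unfolding string_cylinder_def using W closed_cylinder by (rule closed_Int)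
  show thesis
  proof (rule that[of ?K])
    show "closed ?K" by (rule cK)
    have "souslin ((\<lambda>d. g (third 0 d)) ` ?K)" unfolding souslin_def using cK cg by blast
    then show "pos \<G> ((\<lambda>d. g (third 0 d)) ` ?K)" using u(2) by (simp add: pos_def)
    show "(\<lambda>d. g (third 0 d)) ` ?K \<subseteq> T" using WT by blast
    fix d assume d: "d \<in> ?K"
    then show "third 0 d \<in> K \<and> third 1 d \<in> K \<and> act c (g (third 0 d)) = g (third 1 d)" by (simp add: W_def)
    fix d' i assume "d' \<in> ?K" "i < L"
    then show "d i = d' i" using d u(1) by (simp add: string_cylinder_def cylinder_def)
  qed
qed

lemma infinite_family:
  assumes "G \<in> \<G>"
  shows "infinite \<G>"
proof
  assume "finite \<G>"
  moreover have "range (\<lambda>n :: nat. graph_act act {n} G) \<subseteq> \<G>" using graph_act_in[OF _ assms] by auto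
  ultimately have "finite (range (\<lambda>n :: nat. graph_act act {n} G))" by (rule rev_finite_subset)
  moreover have "inj (\<lambda>n :: nat. graph_act act {n} G)"
  proof (rule injI)
    fix n m :: nat assume "graph_act act {n} G = graph_act act {m} G"
    then have "{n} = {m}" by (intro graph_act_inj[OF _ _ assms]) auto
    then show "n = m" by simp
  qed
  ultimately show False using finite_imageD infinite_UNIV_nat by blast
qed

text \<open>Taking the least index ensures that no graph is passed over forever, see
  \<open>image_graph_surj\<close>.\<close>

definition next_graph :: "(nat \<Rightarrow> nat set) \<Rightarrow> (nat \<Rightarrow> ('a \<times> 'a) set) \<Rightarrow> nat \<Rightarrow> ('a \<times> 'a) set" where
  "next_graph \<gamma> F m = from_nat_into \<G> (LEAST i. from_nat_into \<G> i \<notin> orbit_family \<gamma> F m)"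

lemma next_graph:
  assumes "G \<in> \<G>"
  shows "next_graph \<gamma> F m \<in> \<G>" "next_graph \<gamma> F m \<notin> orbit_family \<gamma> F m"
proof -
  have ne: "\<G> \<noteq> {}" using assms by blast
  then show "next_graph \<gamma> F m \<in> \<G>" unfolding next_graph_def by (rule from_nat_into)
  have "\<not> \<G> \<subseteq> orbit_family \<gamma> F m"
    using infinite_family[OF assms] finite_orbit_family finite_subset by blast
  then obtain G' where "G' \<in> \<G>" "G' \<notin> orbit_family \<gamma> F m" by blast
  then have "\<exists>i. from_nat_into \<G> i \<notin> orbit_family \<gamma> F m"
    using from_nat_into_surj[OF countable_family] by metis
  then show "next_graph \<gamma> F m \<notin> orbit_family \<gamma> F m" unfolding next_graph_def by (rule LeastI_ex)
qed

definition true_positions :: "bool list \<Rightarrow> nat set" where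
  "true_positions t = {i. i < length t \<and> t ! i}"

lemma finite_true_positions: "finite (true_positions t)"
  by (simp add: true_positions_def)

text \<open>At stage \<open>m\<close> the edges of the image of the graph \<open>n\<close> are realized if \<open>b n\<close> contains a string of
  length \<open>m\<close>.  Otherwise the stage realizes edges of a graph not considered so far, which does
  no harm to the earlier ones.\<close>

definition realized_spec ::
    "(nat \<Rightarrow> bool list set) \<Rightarrow> nat \<Rightarrow> (nat \<Rightarrow> nat set) \<Rightarrow> (nat \<Rightarrow> ('a \<times> 'a) set) \<Rightarrow> ('a \<times> 'a) set \<Rightarrow> bool" where
  "realized_spec b m \<gamma> F G \<longleftrightarrow>
     (\<forall>n t. n < m \<longrightarrow> t \<in> b n \<longrightarrow> length t = m \<longrightarrow> G = graph_act act (comb \<gamma> (true_positions t)) (F n)) \<and>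
     ((\<exists>n t. n < m \<and> t \<in> b n \<and> length t = m) \<or> G = next_graph \<gamma> F m)"

text \<open>The length \<open>m\<close> determines \<open>n\<close>, since the sets
  \<open>a n\<close> are disjoint, and then the string, since \<open>b n\<close> has at most one of
  each length. So the demands on \<open>G\<close> cannot conflict.\<close>

lemma exists_realized:
  assumes par: "graph_parameters a b" and G0: "G0 \<in> \<G>"
    and fin: "\<And>j. finite (\<gamma> j)" and F: "\<And>j. j < m \<Longrightarrow> F j \<in> \<G>"
  obtains G where "G \<in> \<G>" "realized_spec b m \<gamma> F G"
proof (cases "\<exists>n t. n < m \<and> t \<in> b n \<and> length t = m")
  case True
  then obtain n t where nt: "n < m" "t \<in> b n" "length t = m" by blast
  have uniq: "n' = n \<and> t' = t" if "t' \<in> b n'" "length t' = m" for n' t'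
  proof -
    have disj: "disjoint_family a"
      and bs: "\<And>n. (\<forall>t\<in>b n. length t \<in> a n) \<and> (\<forall>s\<in>b n. \<forall>t\<in>b n. s \<noteq> t \<longrightarrow> length s \<noteq> length t)"
      using par unfolding graph_parameters_def by simp_all
    have "m \<in> a n" "m \<in> a n'" using bs nt that by metis+
    then have "n' = n" using disj unfolding disjoint_family_on_def by blast
    then show ?thesis using bs nt that by metis
  qed
  show thesis
  proof (rule that)
    show "graph_act act (comb \<gamma> (true_positions t)) (F n) \<in> \<G>"
      using fin F nt(1) finite_true_positions by (intro graph_act_in finite_comb) auto
    show "realized_spec b m \<gamma> F (graph_act act (comb \<gamma> (true_positions t)) (F n))"
      unfolding realized_spec_def using True uniq by blast
  qed
next
  case False
  then have "realized_spec b m \<gamma> F (next_graph \<gamma> F m)" unfolding realized_spec_def by blast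
  then show thesis using that next_graph(1)[OF G0] by blast
qed

definition group_element :: "nat \<Rightarrow> nat set" where
  "group_element = from_nat_into (Collect finite)"

lemma range_group_element: "range group_element = Collect finite"
  unfolding group_element_def using countable_Collect_finite by (intro range_from_nat_into) auto

lemma finite_group_element: "finite (group_element i)"
  using range_group_element by blast

text \<open>Treats finitely many coincidences at each stage so that in the limit orbit equivalence
  of image points comes only from the generators.\<close>

definition separated :: "nat \<Rightarrow> (nat \<Rightarrow> nat set) \<Rightarrow> 'a set \<Rightarrow> bool" where
  "separated m \<gamma> S \<longleftrightarrow> (\<forall>s i x y. s \<subseteq> {..<Suc m} \<longrightarrow> i \<le> m \<longrightarrow> comb \<gamma> s \<noteq> group_element i \<longrightarrow>
     x \<in> S \<longrightarrow> y \<in> S \<longrightarrow> act (comb \<gamma> s) x \<noteq> act (group_element i) y)"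

lemma separated_subset: "separated m \<gamma> S \<Longrightarrow> T \<subseteq> S \<Longrightarrow> separated m \<gamma> T"
  unfolding separated_def by (meson subsetD)

lemma exists_separated:
  assumes "pos \<G> S" "\<And>j. finite (\<gamma> j)"
  obtains T where "pos \<G> T" "T \<subseteq> S" "separated m \<gamma> T"
proof -
  have fc: "finite (comb \<gamma> s)" if "s \<subseteq> {..<Suc m}" for s
    using that assms(2) finite_subset by (intro finite_comb) blast+
  let ?D = "\<lambda>k. sym_diff (comb \<gamma> (fst k)) (group_element (snd k))"
  let ?K = "{k \<in> Pow {..<Suc m} \<times> {..m}. comb \<gamma> (fst k) \<noteq> group_element (snd k)}"
  have "\<exists>T. pos \<G> T \<and> T \<subseteq> S \<and> (\<forall>k\<in>?K. \<forall>x\<in>T. \<forall>y\<in>T. act (?D k) x \<noteq> y)"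
  proof (rule pos_dense_finite[OF _ assms(1)])
    fix k T assume k: "k \<in> ?K" and T: "pos \<G> T" "T \<subseteq> S"
    have "finite (?D k)" using k fc finite_group_element by auto
    moreover have "?D k \<noteq> {}" using k by blast
    ultimately show "\<exists>T'. pos \<G> T' \<and> T' \<subseteq> T \<and> (\<forall>x\<in>T'. \<forall>y\<in>T'. act (?D k) x \<noteq> y)"
      by (rule pos_no_return[OF T(1)])
  next
    fix k T T' assume "\<forall>x\<in>T. \<forall>y\<in>T. act (?D k) x \<noteq> y" "T' \<subseteq> T"
    then show "\<forall>x\<in>T'. \<forall>y\<in>T'. act (?D k) x \<noteq> y" by blast
  qed simp
  then obtain T where T: "pos \<G> T" "T \<subseteq> S" "\<forall>k\<in>?K. \<forall>x\<in>T. \<forall>y\<in>T. act (?D k) x \<noteq> y" by (elim exE conjE)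
  have "separated m \<gamma> T"
    unfolding separated_def
  proof (intro allI impI notI)
    fix s i x y assume a: "s \<subseteq> {..<Suc m}" "i \<le> m" "comb \<gamma> s \<noteq> group_element i" "x \<in> T" "y \<in> T"
      "act (comb \<gamma> s) x = act (group_element i) y"
    have "(s, i) \<in> ?K" using a(1-3) by simp
    then have ne: "act (?D (s, i)) x \<noteq> y" using T(3) a(4,5) by blast
    have "act (?D (s, i)) x = act (group_element i) (act (comb \<gamma> s) x)"
      using fc[OF a(1)] finite_group_element by (simp add: act_act Un_commute)
    also have "\<dots> = y" using a(6) finite_group_element by (simp add: act_invol)
    finally show False using ne by blast
  qed
  then show thesis using that T(1,2) by blast
qed

text \<open>Origin of the bound \<open>Suc m * 3 ^ Suc m\<close>: passing down one level sends entry
  \<open>n\<close> to entry \<open>3 * n\<close> or \<open>3 * n + 1\<close> of the code above.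
  Entry \<open>i\<close> of a code at level \<open>j\<close> is thus found, \<open>Suc i\<close>
  levels higher, at a place below \<open>Suc i * 3 ^ Suc i\<close>, which is covered by the bound
  for \<open>m = j + i\<close>.\<close>

definition fusion_step ::
    "(nat \<Rightarrow> bool list set) \<Rightarrow> nat \<Rightarrow> 'a stage \<Rightarrow> 'a stage \<Rightarrow> bool" where
  "fusion_step b m = (\<lambda>(\<gamma>, R, F, K, g) (\<gamma>', R', F', K', g').
     (\<exists>c G. \<gamma>' = \<gamma>(m := c) \<and> R' = R(m := G) \<and> F' = F(m := next_graph \<gamma> F m) \<and> realized_spec b m \<gamma> F G \<and>
       g' = (\<lambda>d. g (third 0 d)) \<and> separated m \<gamma>' (g' ` K') \<and>
       (\<forall>d\<in>K'. third 0 d \<in> K \<and> third 1 d \<in> K \<and> act c (g (third 0 d)) = g (third 1 d) \<and>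
          (g (third 0 d), g (third 1 d)) \<in> G) \<and>
       (\<forall>d\<in>K'. \<forall>d'\<in>K'. \<forall>i<Suc m * 3 ^ Suc m. d i = d' i)))"

definition fusion_state :: "nat \<Rightarrow> 'a stage \<Rightarrow> bool" where
  "fusion_state m = (\<lambda>(\<gamma>, R, F, K, g). closed K \<and> continuous_on UNIV g \<and> good m \<gamma> R F (g ` K))"

lemma exists_fusion_step:
  assumes par: "graph_parameters a b" and G0: "G0 \<in> \<G>" and w: "fusion_state m w"
  shows "\<exists>w'. fusion_state (Suc m) w' \<and> fusion_step b m w w'"
proof -
  obtain \<gamma> R F K g where ww: "w = (\<gamma>, R, F, K, g)" by (cases w)
  have K: "closed K" "continuous_on UNIV g" and g: "good m \<gamma> R F (g ` K)"
    using w by (simp_all add: fusion_state_def ww)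
  have fin: "\<And>j. finite (\<gamma> j)" and Fin: "\<And>j. j < m \<Longrightarrow> F j \<in> \<G>" using g by (simp_all add: good_def)
  obtain G where G: "G \<in> \<G>" "realized_spec b m \<gamma> F G" 
    by (rule exists_realized[of a b G0 \<gamma> m F, OF par G0 fin Fin])
  define R' where "R' = R(m := G)"
  define F' where "F' = F(m := next_graph \<gamma> F m)"
  have fam: "orbit_family \<gamma> F' m = orbit_family \<gamma> F m" by (rule orbit_family_cong) (simp_all add: F'_def)
  have g': "good m \<gamma> R' F' (g ` K)" by (rule good_cong[where \<gamma>' = \<gamma>, OF g fin]) (simp_all add: R'_def F'_def)
  have RF': "R' m \<in> \<G>" "F' m \<in> \<G>" "F' m \<notin> orbit_family \<gamma> F' m"
    unfolding fam using G(1) next_graph[OF G0] by (simp_all add: R'_def F'_def)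
  obtain c T where c: "finite c" and T: "T \<subseteq> g ` K" "\<And>x. x \<in> T \<Longrightarrow> act c x \<in> g ` K \<and> (x, act c x) \<in> R' m"
    and gT: "good (Suc m) (\<gamma>(m := c)) R' F' T"
    by (rule good_step[OF g' RF'], (rule that; assumption))
  have fin': "\<And>j. finite ((\<gamma>(m := c)) j)" and pT: "pos \<G> T" using gT by (simp_all add: good_def)
  obtain T' where T': "pos \<G> T'" "T' \<subseteq> T" "separated m (\<gamma>(m := c)) T'"
    by (rule exists_separated[of T "\<gamma>(m := c)" m, OF pT fin'])
  have sub: "T' \<subseteq> g ` K" "act c ` T' \<subseteq> g ` K" using T T'(2) by blast+
  obtain K' where K': "closed K'" "pos \<G> ((\<lambda>d. g (third 0 d)) ` K')" "(\<lambda>d. g (third 0 d)) ` K' \<subseteq> T'"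
    and K1: "\<And>d. d \<in> K' \<Longrightarrow> third 0 d \<in> K \<and> third 1 d \<in> K \<and> act c (g (third 0 d)) = g (third 1 d)"
    and K2: "\<And>d d' i. d \<in> K' \<Longrightarrow> d' \<in> K' \<Longrightarrow> i < Suc m * 3 ^ Suc m \<Longrightarrow> d i = d' i"
    by (rule code_step[OF K T'(1) sub c, where L = "Suc m * 3 ^ Suc m"], (rule that; assumption))
  define g1 where "g1 = (\<lambda>d. g (third 0 d))"
  have "continuous_on UNIV g1" unfolding g1_def
    by (rule continuous_on_compose2[OF K(2) continuous_third]) simp
  moreover have "good (Suc m) (\<gamma>(m := c)) R' F' (g1 ` K')"
    by (rule good_subset[OF gT]) (use K'(2,3) T'(2) in \<open>auto simp: g1_def\<close>)
  ultimately have "fusion_state (Suc m) (\<gamma>(m := c), R', F', K', g1)"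
    using K'(1) by (simp add: fusion_state_def)
  moreover have "fusion_step b m w (\<gamma>(m := c), R', F', K', g1)"
    unfolding fusion_step_def ww prod.case
  proof (intro exI[of _ c] exI[of _ G] conjI refl ballI allI impI)
    show "R' = R(m := G)" "F' = F(m := next_graph \<gamma> F m)" "g1 = (\<lambda>d. g (third 0 d))" "realized_spec b m \<gamma> F G"
      using G(2) by (simp_all add: R'_def F'_def g1_def)
    have g1T: "g1 ` K' \<subseteq> T'" using K'(3) by (simp add: g1_def)
    show "separated m (\<gamma>(m := c)) (g1 ` K')"
      by (rule separated_subset[OF T'(3) g1T])
    fix d assume d: "d \<in> K'"
    show "third 0 d \<in> K" "third 1 d \<in> K" "act c (g (third 0 d)) = g (third 1 d)" using K1[OF d] by blast+
    have "g (third 0 d) \<in> T" using K'(3) T'(2) d by blast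
    then have "(g (third 0 d), act c (g (third 0 d))) \<in> R' m" using T(2) by blast
    then show "(g (third 0 d), g (third 1 d)) \<in> G" using K1[OF d] by (simp add: R'_def)
    fix d' i assume "d' \<in> K'" "i < Suc m * 3 ^ Suc m"
    then show "d i = d' i" by (rule K2[OF d])
  qed
  ultimately show ?thesis by blast
qed

end

section \<open>The sequence of stages and its limit\<close>

locale fusion_sequence = free_graph_family act \<G>
  for act :: "nat set \<Rightarrow> 'a \<Rightarrow> 'a::polish_space" and \<G> +
  fixes a :: "nat \<Rightarrow> nat set" and b :: "nat \<Rightarrow> bool list set"
    and \<gamma> :: "nat \<Rightarrow> nat set" and R F :: "nat \<Rightarrow> ('a \<times> 'a) set"
    and K :: "nat \<Rightarrow> (nat \<Rightarrow> nat) set" and g :: "nat \<Rightarrow> (nat \<Rightarrow> nat) \<Rightarrow> 'a"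
  assumes parameters: "graph_parameters a b"
    and closed_codes: "closed (K m)"
    and continuous_code: "continuous_on UNIV (g m)"
    and good: "good m \<gamma> R F (g m ` K m)"
    and next_graph_eq: "F m = next_graph \<gamma> F m"
    and realized: "realized_spec b m \<gamma> F (R m)"
    and code_Suc: "g (Suc m) d = g m (third 0 d)"
    and separated: "separated m \<gamma> (g (Suc m) ` K (Suc m))"
    and code_translate: "d \<in> K (Suc m) \<Longrightarrow> third 0 d \<in> K m \<and> third 1 d \<in> K m \<and>
      act (\<gamma> m) (g m (third 0 d)) = g m (third 1 d) \<and> (g m (third 0 d), g m (third 1 d)) \<in> R m"
    and code_prefix: "d \<in> K (Suc m) \<Longrightarrow> d' \<in> K (Suc m) \<Longrightarrow> i < Suc m * 3 ^ Suc m \<Longrightarrow> d i = d' i"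

lemma (in free_graph_family) next_graph_cong:
  assumes "\<And>j. j < m \<Longrightarrow> \<gamma> j = \<gamma>' j" "\<And>j. j < m \<Longrightarrow> F j = F' j"
  shows "next_graph \<gamma> F m = next_graph \<gamma>' F' m"
  unfolding next_graph_def using orbit_family_cong[OF assms] by simp

lemma (in free_graph_family) realized_spec_cong:
  assumes r: "realized_spec b m \<gamma> F G" and eq: "\<And>j. j < m \<Longrightarrow> \<gamma> j = \<gamma>' j" "\<And>j. j < m \<Longrightarrow> F j = F' j"
  shows "realized_spec b m \<gamma>' F' G"
proof -
  have "comb \<gamma>' (true_positions t) = comb \<gamma> (true_positions t)" if "length t = m" for t
    using that eq(1) by (intro comb_cong) (auto simp: true_positions_def)
  note comb = this
  have r1: "G = graph_act act (comb \<gamma> (true_positions t)) (F n)"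
    if "n < m" "t \<in> b n" "length t = m" for n t
    using r that unfolding realized_spec_def by blast
  have r2: "(\<exists>n t. n < m \<and> t \<in> b n \<and> length t = m) \<or> G = next_graph \<gamma> F m"
    using r unfolding realized_spec_def by (rule conjunct2)
  show ?thesis
    unfolding realized_spec_def
  proof (intro conjI allI impI)
    fix n t assume nt: "n < m" "t \<in> b n" "length t = m"
    show "G = graph_act act (comb \<gamma>' (true_positions t)) (F' n)"
      using r1[OF nt] unfolding comb[OF nt(3)] eq(2)[OF nt(1)] .
  next
    have "next_graph \<gamma>' F' m = next_graph \<gamma> F m" using next_graph_cong[OF eq] by simp
    then show "(\<exists>n t. n < m \<and> t \<in> b n \<and> length t = m) \<or> G = next_graph \<gamma>' F' m"
      using r2 by simp
  qed
qed

lemma (in free_graph_family) separated_cong: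
  assumes "separated m \<gamma> S" "\<And>j. j < Suc m \<Longrightarrow> \<gamma> j = \<gamma>' j"
  shows "separated m \<gamma>' S"
proof -
  have "comb \<gamma>' s = comb \<gamma> s" if "s \<subseteq> {..<Suc m}" for s
    using that assms(2) by (intro comb_cong) (metis lessThan_iff subsetD)
  then show ?thesis using assms(1) unfolding separated_def by simp
qed

lemma (in free_graph_family) exists_fusion_sequence:
  assumes par: "graph_parameters a b" and G0: "G0 \<in> \<G>" and A: "pos \<G> A"
  obtains \<gamma> R F K g where "fusion_sequence act \<G> a b \<gamma> R F K g" "g 0 ` K 0 = A"
proof -
  obtain K0 g0 where K0: "closed K0" "continuous_on UNIV (g0 :: (nat \<Rightarrow> nat) \<Rightarrow> 'a)" "A = g0 ` K0"
    using A unfolding pos_def souslin_def by blast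
  \<comment> \<open>The empty sets are placeholders: the invariant at stage 0 only asks the
    generators to be finite, and stage \<open>m\<close> overwrites the values at
    \<open>m\<close>.\<close>
  define w0 where "w0 = ((\<lambda>_. {}) :: nat \<Rightarrow> nat set, (\<lambda>_. {}) :: nat \<Rightarrow> ('a \<times> 'a) set,
    (\<lambda>_. {}) :: nat \<Rightarrow> ('a \<times> 'a) set, K0, g0)"
  have w0: "fusion_state 0 w0"
    unfolding fusion_state_def w0_def prod.case using K0 A good_zero by simp
  define P where "P m w \<longleftrightarrow> fusion_state m w \<and> (m = 0 \<longrightarrow> w = w0)" for m w
  have "P 0 w0" using w0 by (simp add: P_def)
  then have "\<exists>w. P 0 w" by blast
  moreover have "\<exists>w'. P (Suc m) w' \<and> fusion_step b m w w'" if "P m w" for m w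
    using exists_fusion_step[OF par G0, of m w] that by (simp add: P_def)
  ultimately obtain w where w: "\<And>m. P m (w m)" "\<And>m. fusion_step b m (w m) (w (Suc m))"
    using dependent_nat_choice[of P "fusion_step b"] by blast
  define \<gamma> R F K g where "\<gamma> m = fst (w m)" and "R m = fst (snd (w m))" and "F m = fst (snd (snd (w m)))"
    and "K m = fst (snd (snd (snd (w m))))" and "g m = snd (snd (snd (snd (w m))))" for m
  have weq: "w m = (\<gamma> m, R m, F m, K m, g m)" for m
    by (simp add: \<gamma>_def R_def F_def K_def g_def)
  have state: "closed (K m)" "continuous_on UNIV (g m)" "good m (\<gamma> m) (R m) (F m) (g m ` K m)" for m
    using w(1)[of m] unfolding P_def fusion_state_def weq by simp_all
  have step: "\<exists>c G. \<gamma> (Suc m) = (\<gamma> m)(m := c) \<and> R (Suc m) = (R m)(m := G) \<and>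
       F (Suc m) = (F m)(m := next_graph (\<gamma> m) (F m) m) \<and> realized_spec b m (\<gamma> m) (F m) G \<and>
       g (Suc m) = (\<lambda>d. g m (third 0 d)) \<and> separated m (\<gamma> (Suc m)) (g (Suc m) ` K (Suc m)) \<and>
       (\<forall>d\<in>K (Suc m). third 0 d \<in> K m \<and> third 1 d \<in> K m \<and> act c (g m (third 0 d)) = g m (third 1 d) \<and>
          (g m (third 0 d), g m (third 1 d)) \<in> G) \<and>
       (\<forall>d\<in>K (Suc m). \<forall>d'\<in>K (Suc m). \<forall>i<Suc m * 3 ^ Suc m. d i = d' i)" for m
    using w(2)[of m] unfolding fusion_step_def weq prod.case .
  \<comment> \<open>The value at \<open>j\<close> is set in the step to stage \<open>Suc j\<close>
    and never changes afterwards.\<close>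
  define \<gamma>s Rs Fs where "\<gamma>s j = \<gamma> (Suc j) j" and "Rs j = R (Suc j) j" and "Fs j = F (Suc j) j" for j
  have stable: "\<gamma> (Suc j + k) j = \<gamma>s j \<and> R (Suc j + k) j = Rs j \<and> F (Suc j + k) j = Fs j" for j k
  proof (induction k)
    case (Suc k)
    obtain c G where "\<gamma> (Suc (Suc j + k)) = (\<gamma> (Suc j + k))(Suc j + k := c)"
      "R (Suc (Suc j + k)) = (R (Suc j + k))(Suc j + k := G)"
      "F (Suc (Suc j + k)) = (F (Suc j + k))(Suc j + k := next_graph (\<gamma> (Suc j + k)) (F (Suc j + k)) (Suc j + k))"
      using step[of "Suc j + k"] by (elim exE conjE)
    then show ?case using Suc by simp
  qed (simp add: \<gamma>s_def Rs_def Fs_def)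
  have eq: "\<gamma> m j = \<gamma>s j" "R m j = Rs j" "F m j = Fs j" if "j < m" for m j
    using stable[of j "m - Suc j"] that by simp_all
  have fin: "finite (\<gamma>s j)" for j using state(3)[of "Suc j"] by (simp add: good_def \<gamma>s_def)
  have "fusion_sequence act \<G> a b \<gamma>s Rs Fs K g"
  proof (unfold_locales, fact par, fact state(1), fact state(2))
    fix m
    show "good m \<gamma>s Rs Fs (g m ` K m)"
      by (rule good_cong[OF state(3)[of m], where \<gamma>' = \<gamma>s, OF fin]) (rule eq; assumption)+
    obtain c G where s: "\<gamma> (Suc m) = (\<gamma> m)(m := c)" "R (Suc m) = (R m)(m := G)"
       "F (Suc m) = (F m)(m := next_graph (\<gamma> m) (F m) m)" "realized_spec b m (\<gamma> m) (F m) G"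
       "g (Suc m) = (\<lambda>d. g m (third 0 d))" "separated m (\<gamma> (Suc m)) (g (Suc m) ` K (Suc m))"
       "\<forall>d\<in>K (Suc m). third 0 d \<in> K m \<and> third 1 d \<in> K m \<and> act c (g m (third 0 d)) = g m (third 1 d) \<and>
          (g m (third 0 d), g m (third 1 d)) \<in> G"
       "\<forall>d\<in>K (Suc m). \<forall>d'\<in>K (Suc m). \<forall>i<Suc m * 3 ^ Suc m. d i = d' i"
      using step[of m] by (elim exE conjE)
    have now: "\<gamma>s m = c" "Rs m = G" "Fs m = next_graph (\<gamma> m) (F m) m"
      using s(1-3) by (simp_all add: \<gamma>s_def Rs_def Fs_def)
    show "Fs m = next_graph \<gamma>s Fs m"
      unfolding now by (rule next_graph_cong) (rule eq; assumption)+
    show "realized_spec b m \<gamma>s Fs (Rs m)"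
      unfolding now by (rule realized_spec_cong[OF s(4)]) (rule eq; assumption)+
    show "separated m \<gamma>s (g (Suc m) ` K (Suc m))"
      by (rule separated_cong[OF s(6)]) (rule eq; assumption)
    fix d
    show "g (Suc m) d = g m (third 0 d)" using s(5) by simp
    assume d: "d \<in> K (Suc m)"
    show "third 0 d \<in> K m \<and> third 1 d \<in> K m \<and>
      act (\<gamma>s m) (g m (third 0 d)) = g m (third 1 d) \<and> (g m (third 0 d), g m (third 1 d)) \<in> Rs m"
      unfolding now using s(7) d by blast
    fix d' i assume "d' \<in> K (Suc m)" "i < Suc m * 3 ^ Suc m"
    then show "d i = d' i" using s(8) d by blast
  qed
  moreover have "g 0 ` K 0 = A"
    using w(1)[of 0] K0(3) by (simp add: P_def g_def K_def w0_def)
  ultimately show thesis using that by blast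
qed

context fusion_sequence
begin

lemma finite_generator: "finite (\<gamma> j)"
  using good[of 0] by (simp add: good_def)

lemma finite_comb_generators: "finite s \<Longrightarrow> finite (comb \<gamma> s)"
  by (intro finite_comb finite_generator)

lemma base_graph_in: "F n \<in> \<G>"
  using good[of "Suc n"] by (simp add: good_def)

lemmas code_translateD =
  code_translate[THEN conjunct1] code_translate[THEN conjunct2, THEN conjunct1]
  code_translate[THEN conjunct2, THEN conjunct2, THEN conjunct1]
  code_translate[THEN conjunct2, THEN conjunct2, THEN conjunct2]

section \<open>The codes of the points of the Cantor space\<close>

text \<open>The place, \<open>r\<close> levels up, of the entry which becomes entry \<open>i\<close>
  at level \<open>j\<close> when the digits of \<open>z\<close> select between the codes of a point
  and of its translate.\<close>

fun position :: "(nat \<Rightarrow> bool) \<Rightarrow> nat \<Rightarrow> nat \<Rightarrow> nat \<Rightarrow> nat" where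
  "position z j i 0 = i"
| "position z j i (Suc r) = 3 * position z j i r + of_bool (z (j + r))"

definition pull :: "(nat \<Rightarrow> bool) \<Rightarrow> nat \<Rightarrow> nat \<Rightarrow> (nat \<Rightarrow> nat) \<Rightarrow> nat \<Rightarrow> nat" where
  "pull z j r d = (\<lambda>i. d (position z j i r))"

lemma position_less: "position z j i r < Suc i * 3 ^ r"
proof (induction r)
  case (Suc r)
  have "position z j i (Suc r) \<le> 3 * position z j i r + 1" by simp
  also have "\<dots> < 3 * (Suc i * 3 ^ r)" using Suc.IH by linarith
  finally show ?case by (simp add: ac_simps)
qed simp

lemma position_add: "position z j i (r + s) = position z (j + r) (position z j i r) s"
  by (induction s) (simp_all add: add.assoc)

lemma position_cong: "(\<And>k. k < r \<Longrightarrow> z (j + k) = z' (j + k)) \<Longrightarrow> position z j i r = position z' j i r"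
  by (induction r) simp_all

lemma pull_Suc: "pull z j (Suc r) d = pull z j r (third (of_bool (z (j + r))) d)"
  by (simp add: pull_def third_def)

lemma pull_mem: "d \<in> K (j + r) \<Longrightarrow> pull z j r d \<in> K j"
proof (induction r arbitrary: d)
  case 0
  then show ?case by (simp add: pull_def)
next
  case (Suc r)
  then have "third (of_bool (z (j + r))) d \<in> K (j + r)"
    using code_translateD(1,2)[of d "j + r"] by (cases "z (j + r)") auto
  then show ?case unfolding pull_Suc by (rule Suc.IH)
qed

definition seed :: "nat \<Rightarrow> nat \<Rightarrow> nat" where
  "seed m = (SOME d. d \<in> K m)"

lemma seed_mem: "seed m \<in> K m"
proof -
  have "pos \<G> (g m ` K m)" using good[of m] by (simp add: good_def)
  then have "K m \<noteq> {}" using pos_nonempty by blast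
  then show ?thesis unfolding seed_def by (simp add: some_in_eq)
qed

text \<open>Entry \<open>i\<close> is read off an arbitrary code \<open>Suc i\<close> levels higher.
  The fixed beginnings make the choice of \<open>seed\<close> irrelevant, which takes the place of
  compactness.\<close>

definition code :: "nat \<Rightarrow> (nat \<Rightarrow> bool) \<Rightarrow> nat \<Rightarrow> nat" where
  "code j z = (\<lambda>i. pull z j (Suc i) (seed (j + Suc i)) i)"

lemma code_eq_pull:
  assumes d: "d \<in> K (j + r)" and r: "i < r"
  shows "code j z i = pull z j r d i"
proof -
  define q where "q = position z j i (Suc i)"
  define s where "s = r - Suc i"
  have rs: "r = Suc i + s" using r by (simp add: s_def)
  have "pull z (j + Suc i) s d \<in> K (j + Suc i)"
    using d by (intro pull_mem) (simp add: rs add.assoc)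
  moreover have "q < Suc (j + i) * 3 ^ Suc (j + i)"
  proof -
    have "q < Suc i * 3 ^ Suc i" unfolding q_def by (rule position_less)
    also have "\<dots> \<le> Suc (j + i) * 3 ^ Suc (j + i)" by (intro mult_mono power_increasing) auto
    finally show ?thesis .
  qed
  ultimately have "seed (j + Suc i) q = pull z (j + Suc i) s d q"
    using code_prefix[of "seed (j + Suc i)" "j + i" "pull z (j + Suc i) s d" q] seed_mem[of "j + Suc i"]
    by simp
  then show ?thesis
    unfolding code_def pull_def q_def rs position_add by simp
qed

text \<open>The limit code agrees with codes pulled down into the closed set \<open>K j\<close> on
  arbitrarily long beginnings.\<close>

lemma code_mem: "code j z \<in> K j"
proof (rule ccontr)
  assume "code j z \<notin> K j"
  then obtain n where n: "cylinder (code j z) n \<subseteq> - K j"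
    using open_contains_cylinder[of "- K j" "code j z"] closed_codes open_Compl by blast
  have "pull z j n (seed (j + n)) \<in> cylinder (code j z) n"
    using code_eq_pull[OF seed_mem] by (simp add: cylinder_def)
  moreover have "pull z j n (seed (j + n)) \<in> K j" by (rule pull_mem[OF seed_mem])
  ultimately show False using n by blast
qed

lemma code_third: "code j z = third (of_bool (z j)) (code (Suc j) z)"
proof
  fix i
  define k :: nat where "k = 3 * i + of_bool (z j)"
  define r where "r = Suc k"
  have "position z j i (Suc 0 + r) = position z (j + Suc 0) (position z j i (Suc 0)) r"
    by (rule position_add)
  then have p: "position z j i (Suc r) = position z (Suc j) k r" by (simp add: k_def)
  have "code j z i = pull z j (Suc r) (seed (j + Suc r)) i"
    by (rule code_eq_pull[OF seed_mem]) (simp add: r_def k_def)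
  also have "\<dots> = pull z (Suc j) r (seed (Suc j + r)) k" unfolding pull_def p by simp
  also have "\<dots> = code (Suc j) z k"
    by (rule code_eq_pull[OF seed_mem, symmetric]) (simp add: r_def)
  also have "\<dots> = third (of_bool (z j)) (code (Suc j) z) i" by (simp add: third_def k_def)
  finally show "code j z i = third (of_bool (z j)) (code (Suc j) z) i" .
qed

lemma code_cong:
  assumes "\<And>k. k \<ge> j \<Longrightarrow> z k = z' k"
  shows "code j z = code j z'"
proof -
  have "position z j i r = position z' j i r" for i r using assms by (intro position_cong) simp
  then show ?thesis unfolding code_def pull_def by presburger
qed

section \<open>The embedding\<close>

definition point :: "nat \<Rightarrow> (nat \<Rightarrow> bool) \<Rightarrow> 'a" where
  "point m z = g m (code m z)"

definition prefix :: "(nat \<Rightarrow> bool) \<Rightarrow> nat \<Rightarrow> nat set" where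
  "prefix z m = {i. i < m \<and> z i}"

lemma finite_prefix: "finite (prefix z m)"
  by (simp add: prefix_def)

lemma prefix_subset: "prefix z m \<subseteq> {..<m}"
  by (auto simp: prefix_def)

lemma point_mem: "point m z \<in> g m ` K m"
  unfolding point_def using code_mem by blast

lemma point_edge: "(point (Suc m) z, act (\<gamma> m) (point (Suc m) z)) \<in> R m"
  using code_translateD(3,4)[OF code_mem[of "Suc m" z]] unfolding point_def code_Suc by simp

lemma point_step: "point m z = (if z m then act (\<gamma> m) (point (Suc m) z) else point (Suc m) z)"
  using code_translateD(3)[OF code_mem[of "Suc m" z]] unfolding point_def code_Suc code_third[of m z] by simp

lemma point_cong: "(\<And>k. k \<ge> m \<Longrightarrow> z k = z' k) \<Longrightarrow> point m z = point m z'"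
  unfolding point_def using code_cong by metis

text \<open>The equivariance of the embedding: undoing the first \<open>m\<close> digits amounts to
  acting by the corresponding generators on a point which depends only on the later digits.\<close>

lemma point_0: "point 0 z = act (comb \<gamma> (prefix z m)) (point m z)"
proof (induction m)
  case 0
  then show ?case by (simp add: prefix_def comb_empty act_empty)
next
  case (Suc m)
  show ?case
  proof (cases "z m")
    case True
    then have "prefix z (Suc m) = prefix z m \<union> {m}" by (auto simp: prefix_def less_Suc_eq)
    moreover have "act (comb \<gamma> (prefix z m \<union> {m})) x = act (comb \<gamma> (prefix z m)) (act (comb \<gamma> {m}) x)" for x
      by (intro act_comb_Un finite_generator finite_prefix) (auto simp: prefix_def)
    ultimately show ?thesis using Suc point_step[of m z] True by (simp add: comb_single)
  next
    case False
    then have "prefix z (Suc m) = prefix z m" by (auto simp: prefix_def less_Suc_eq)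
    then show ?thesis using Suc point_step[of m z] False by simp
  qed
qed

lemma continuous_point: "continuous_on UNIV (point 0)"
proof -
  have "continuous_on UNIV (\<lambda>z. code 0 z i)" for i
  proof -
    have "open ((\<lambda>z. code 0 z i) -` B)" for B
    proof -
      have "cylinder z (Suc i) \<subseteq> (\<lambda>z. code 0 z i) -` B" if "z \<in> (\<lambda>z. code 0 z i) -` B" for z
      proof
        fix z' assume "z' \<in> cylinder z (Suc i)"
        then have "position z' 0 i (Suc i) = position z 0 i (Suc i)"
          by (intro position_cong) (simp add: cylinder_def)
        then have "code 0 z' i = code 0 z i" unfolding code_def pull_def by simp
        then show "z' \<in> (\<lambda>z. code 0 z i) -` B" using that by simp
      qed
      then have "(\<lambda>z. code 0 z i) -` B = (\<Union>z\<in>(\<lambda>z. code 0 z i) -` B. cylinder z (Suc i))"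
        using mem_cylinder_self by blast
      then show ?thesis by (metis open_UN open_cylinder)
    qed
    then show ?thesis by (simp add: continuous_on_open_vimage)
  qed
  then have "continuous_on UNIV (code 0)" by (intro continuous_on_coordinatewise_then_product)
  then show ?thesis
    unfolding point_def by (intro continuous_on_compose2[OF continuous_code]) auto
qed

lemma sym_diff_prefix: "sym_diff (prefix z m) (prefix z' m) = {i. i < m \<and> z i \<noteq> z' i}"
  by (auto simp: prefix_def)

lemma act_comb_act_comb:
  "finite s \<Longrightarrow> finite t \<Longrightarrow> act (comb \<gamma> s) (act (comb \<gamma> t) x) = act (comb \<gamma> (sym_diff s t)) x"
  by (rule act_comb_sym_diff[OF finite_generator, symmetric])

text \<open>From the stage on at which \<delta> is considered by \<open>separated\<close>, the
  product of the generators at the places of difference below the stage equals \<delta>. By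
  independence it would change at any further place of difference, so there is none.\<close>

lemma orbit_reflection:
  assumes d: "finite \<delta>" and eq: "point 0 z' = act \<delta> (point 0 z)"
  shows "finite {i. z i \<noteq> z' i} \<and> \<delta> = comb \<gamma> {i. z i \<noteq> z' i}"
proof -
  obtain i where i: "group_element i = \<delta>" using d range_group_element by (metis imageE mem_Collect_eq)
  define D where "D = {i. z i \<noteq> z' i}"
  have comb_D: "comb \<gamma> (D \<inter> {..<Suc m}) = \<delta>" if m: "i \<le> m" for m
  proof (rule ccontr)
    assume ne: "comb \<gamma> (D \<inter> {..<Suc m}) \<noteq> \<delta>"
    let ?s = "prefix z (Suc m)" and ?t = "prefix z' (Suc m)"
    have D: "D \<inter> {..<Suc m} = sym_diff ?s ?t" unfolding sym_diff_prefix D_def by auto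
    have fs: "finite ?s" "finite ?t" by (rule finite_prefix)+
    have "act (comb \<gamma> ?t) (point (Suc m) z') = act \<delta> (act (comb \<gamma> ?s) (point (Suc m) z))"
      using eq unfolding point_0[of _ "Suc m"] .
    then have "act (comb \<gamma> ?s) (act (comb \<gamma> ?t) (point (Suc m) z')) =
        act (comb \<gamma> ?s) (act \<delta> (act (comb \<gamma> ?s) (point (Suc m) z)))" by simp
    also have "\<dots> = act \<delta> (act (comb \<gamma> ?s) (act (comb \<gamma> ?s) (point (Suc m) z)))"
      by (rule act_commute[OF finite_comb_generators[OF fs(1)] d])
    also have "\<dots> = act \<delta> (point (Suc m) z)" by (simp add: act_invol[OF finite_comb_generators[OF fs(1)]])
    finally have "act (comb \<gamma> (D \<inter> {..<Suc m})) (point (Suc m) z') = act \<delta> (point (Suc m) z)"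
      unfolding act_comb_act_comb[OF fs] D .
    moreover have "act (comb \<gamma> (D \<inter> {..<Suc m})) (point (Suc m) z') \<noteq> act (group_element i) (point (Suc m) z)"
      using separated[of m] m ne point_mem unfolding separated_def i[symmetric] by simp
    ultimately show False using i by simp
  qed
  have sub: "D \<subseteq> {..<Suc i}"
  proof
    fix k assume k: "k \<in> D"
    show "k \<in> {..<Suc i}"
    proof (rule ccontr)
      assume "k \<notin> {..<Suc i}"
      then have ik: "i < k" by simp
      let ?D1 = "D \<inter> {..<Suc i}" and ?D2 = "D \<inter> {..<Suc k}"
      have "comb \<gamma> (sym_diff ?D1 ?D2) = sym_diff (comb \<gamma> ?D1) (comb \<gamma> ?D2)" by (intro comb_sym_diff) auto
      also have "\<dots> = {}" using comb_D[of i] comb_D[of k] ik by simp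
      finally have c: "comb \<gamma> (sym_diff ?D1 ?D2) = {}" .
      have "sym_diff ?D1 ?D2 \<subseteq> {..<Suc k}" using ik by auto
      from good_comb_inj[OF good this c] have "sym_diff ?D1 ?D2 = {}" .
      moreover have "k \<in> sym_diff ?D1 ?D2" using k ik by simp
      ultimately show False by blast
    qed
  qed
  then have "D \<inter> {..<Suc i} = D" by blast
  then have "comb \<gamma> D = \<delta>" using comb_D[of i] by simp
  moreover have "finite D" using sub finite_subset by blast
  ultimately show ?thesis unfolding D_def by simp
qed

lemma comb_eq_emptyD:
  assumes "finite s" "comb \<gamma> s = {}"
  shows "s = {}"
proof -
  obtain m where "\<forall>i\<in>s. i < m" using assms(1) finite_nat_set_iff_bounded by blast
  then have "s \<subseteq> {..<m}" by blast
  then show ?thesis using good_comb_inj[OF good _ assms(2)] by blast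
qed

lemma inj_point: "inj (point 0)"
proof (rule injI)
  fix z z' assume "point 0 z = point 0 z'"
  then have "point 0 z' = act {} (point 0 z)" by (simp add: act_empty)
  then have "finite {i. z i \<noteq> z' i}" "comb \<gamma> {i. z i \<noteq> z' i} = {}" using orbit_reflection[of "{}"] by auto
  then have "{i. z i \<noteq> z' i} = {}" by (rule comb_eq_emptyD)
  then show "z = z'" by auto
qed

end

section \<open>Edges between points of the image\<close>

lemma cantor_graph_edge_iff:
  "(x, y) \<in> graph_act cantor_act \<delta> (cantor_graph T) \<longleftrightarrow>
    (\<exists>m. {k. x k \<noteq> y k} = {m} \<and> restr (cantor_act \<delta> x) m \<in> T)"
proof -
  have "cantor_act \<delta> x k = cantor_act \<delta> y k \<longleftrightarrow> x k = y k" for k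
    by (auto simp: cantor_act_apply)
  moreover have "x m \<noteq> y m \<and> (\<forall>k. k \<noteq> m \<longrightarrow> x k = y k) \<longleftrightarrow> {k. x k \<noteq> y k} = {m}" for m
    by blast
  ultimately show ?thesis
    by (simp only: graph_act_cantor_iff cantor_graph_def mem_Collect_eq prod.case conj_assoc[symmetric])
qed

context fusion_sequence
begin

lemma length_restr: "length (restr x m) = m"
  by (simp add: restr_def)

lemma true_positions_restr:
  assumes "\<delta> \<subseteq> {..<m}"
  shows "true_positions (restr (cantor_act \<delta> x) m) = sym_diff (prefix x m) \<delta>"
  using assms by (auto simp: true_positions_def restr_def prefix_def cantor_act_apply)

lemma true_positions_inj:
  assumes "true_positions s = true_positions t" "length s = length t"
  shows "s = t"
proof (rule nth_equalityI[OF assms(2)])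
  fix i assume "i < length s"
  then show "s ! i = t ! i" using assms unfolding true_positions_def set_eq_iff mem_Collect_eq by metis
qed

lemma image_graph_inj:
  assumes d: "finite \<delta>" "finite \<delta>'"
    and eq: "graph_act act (comb \<gamma> \<delta>) (F n) = graph_act act (comb \<gamma> \<delta>') (F n')"
  shows "\<delta> = \<delta>' \<and> n = n'"
proof -
  let ?D = "sym_diff \<delta>' \<delta>"
  have "finite (insert n (insert n' ?D))" using d by simp
  then obtain m where m: "\<forall>i\<in>insert n (insert n' ?D). i < m" using finite_nat_set_iff_bounded by blast
  have fc: "finite (comb \<gamma> \<delta>)" "finite (comb \<gamma> \<delta>')" using d finite_comb_generators by blast+
  have "graph_act act (comb \<gamma> \<delta>') (graph_act act (comb \<gamma> \<delta>) (F n)) =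
      graph_act act (comb \<gamma> \<delta>') (graph_act act (comb \<gamma> \<delta>') (F n'))" by (simp only: eq)
  then have "graph_act act (comb \<gamma> ?D) (F n) = F n'"
    using fc by (simp add: graph_act_graph_act graph_act_empty comb_sym_diff[OF d(2,1)])
  moreover have dis: "distinct_orbits m \<gamma> F" using good[of m] by (simp add: good_def)
  moreover have sub: "?D \<subseteq> {..<m}" "n < m" "n' < m" using m by blast+
  ultimately have "n = n' \<and> ?D = {}" using distinct_orbitsD[OF dis sub] by blast
  then show ?thesis by blast
qed

lemma image_graph_in: "finite \<delta> \<Longrightarrow> graph_act act (comb \<gamma> \<delta>) (F n) \<in> \<G>"
  by (intro graph_act_in finite_comb_generators base_graph_in)

text \<open>A graph missed at all stages would bound the indices chosen by
  \<open>next_graph\<close>, so that only finitely many representatives could occur; but they are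
  pairwise distinct.\<close>

lemma image_graph_surj:
  assumes "G \<in> \<G>"
  obtains \<delta> n where "finite \<delta>" "G = graph_act act (comb \<gamma> \<delta>) (F n)"
proof -
  have "\<exists>m. G \<in> orbit_family \<gamma> F m"
  proof (rule ccontr)
    assume no: "\<not> ?thesis"
    obtain i0 where i0: "from_nat_into \<G> i0 = G" using from_nat_into_surj[OF countable_family assms] by blast
    have "F m \<in> from_nat_into \<G> ` {..i0}" for m
    proof -
      have "(LEAST i. from_nat_into \<G> i \<notin> orbit_family \<gamma> F m) \<le> i0"
        using no i0 by (intro Least_le) blast
      moreover have "F m = from_nat_into \<G> (LEAST i. from_nat_into \<G> i \<notin> orbit_family \<gamma> F m)"
        using next_graph_eq[of m] unfolding next_graph_def .
      ultimately show ?thesis by blast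
    qed
    then have "finite (range F)" by (meson finite_atMost finite_imageI finite_subset image_subsetI)
    moreover have "inj F"
    proof (rule injI)
      fix n n' assume "F n = F n'"
      then show "n = n'" using image_graph_inj[of "{}" "{}" n n'] by simp
    qed
    ultimately show False using finite_imageD infinite_UNIV_nat by blast
  qed
  then obtain s m i where s: "s \<subseteq> {..<m}" "G = graph_act act (comb \<gamma> s) (F i)"
    unfolding orbit_family_def by blast
  have "finite s" using s(1) finite_subset by blast
  then show thesis using that s(2) by blast
qed

text \<open>The common prefix moves \<open>u\<close> and \<open>act (\<gamma> m) u\<close>, an edge
  of \<open>R m\<close>, to the two image points. The graph \<open>R m\<close> was chosen as the
  translate of \<open>F n\<close> by the true positions of the string, and these are the common
  prefix changed by \<delta>.\<close>

lemma point_edge_forward: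
  assumes d: "\<delta> \<subseteq> {..<k}" and n: "n < k" and xy: "{i. x i \<noteq> y i} = {m}" and m: "k \<le> m" "\<not> x m"
    and t: "restr (cantor_act \<delta> x) m \<in> b n"
  shows "(point 0 x, point 0 y) \<in> graph_act act (comb \<gamma> \<delta>) (F n)"
proof -
  have fd: "finite \<delta>" using d finite_subset by blast
  have ym: "y m" using xy m(2) by auto
  have same: "x i = y i" if "i \<noteq> m" for i using xy that by blast
  define s where "s = prefix x m"
  have fs: "finite s" unfolding s_def by (rule finite_prefix)
  have s: "prefix y m = s" unfolding s_def prefix_def using same by auto
  define u where "u = point (Suc m) x"
  have uy: "point (Suc m) y = u" unfolding u_def using same by (intro point_cong) auto
  have hx: "point 0 x = act (comb \<gamma> s) u"
    using point_0[of x m] point_step[of m x] m(2) by (simp add: s_def u_def)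
  have hy: "point 0 y = act (comb \<gamma> s) (act (\<gamma> m) u)"
    using point_0[of y m] point_step[of m y] ym by (simp add: s uy)
  have "\<delta> \<subseteq> {..<m}" using d m(1) by auto
  then have tp: "true_positions (restr (cantor_act \<delta> x) m) = sym_diff s \<delta>"
    unfolding s_def by (rule true_positions_restr)
  have "n < m" using n m(1) by simp
  then have "R m = graph_act act (comb \<gamma> (sym_diff s \<delta>)) (F n)"
    using realized[of m] t unfolding realized_spec_def tp[symmetric] by (metis length_restr)
  moreover have "(u, act (\<gamma> m) u) \<in> R m" unfolding u_def by (rule point_edge)
  moreover have "finite (sym_diff s \<delta>)" using fs fd by simp
  ultimately have "(act (comb \<gamma> (sym_diff s \<delta>)) u, act (comb \<gamma> (sym_diff s \<delta>)) (act (\<gamma> m) u)) \<in> F n"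
    by (simp add: graph_act_iff finite_comb_generators)
  moreover have "act (comb \<gamma> (sym_diff s \<delta>)) v = act (comb \<gamma> \<delta>) (act (comb \<gamma> s) v)" for v
    unfolding act_comb_act_comb[OF fd fs] by (simp add: Un_commute)
  ultimately show ?thesis
    unfolding hx hy graph_act_iff[OF finite_comb_generators[OF fd]] by simp
qed

text \<open>Agreement below \<open>k\<close> is needed because the translate of \<open>F n\<close>
  is controlled only against differences from \<open>k\<close> on. Conversely, an edge gives
  finitely many differences, the invariant leaves a single one, and the graph realized there
  determines the string and \<open>n\<close> by \<open>image_graph_inj\<close>.\<close>

lemma point_edge_iff:
  assumes d: "\<delta> \<subseteq> {..<k}" and n: "n < k" and same: "\<And>i. i < k \<Longrightarrow> x i = y i"
  shows "(point 0 x, point 0 y) \<in> graph_act act (comb \<gamma> \<delta>) (F n) \<longleftrightarrow>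
    (x, y) \<in> graph_act cantor_act \<delta> (cantor_graph (b n))"
proof
  assume "(x, y) \<in> graph_act cantor_act \<delta> (cantor_graph (b n))"
  then obtain m where m: "{i. x i \<noteq> y i} = {m}" "restr (cantor_act \<delta> x) m \<in> b n"
    unfolding cantor_graph_edge_iff by blast
  have km: "k \<le> m" using same m(1) by (metis (mono_tags) linorder_not_le mem_Collect_eq singletonI)
  have fd: "finite \<delta>" using d finite_subset by blast
  show "(point 0 x, point 0 y) \<in> graph_act act (comb \<gamma> \<delta>) (F n)"
  proof (cases "x m")
    case False
    then show ?thesis using point_edge_forward[OF d n m(1) km] m(2) by blast
  next
    case True
    then have "\<not> y m" using m(1) by auto
    have yx: "{i. y i \<noteq> x i} = {m}" using m(1) by blast
    have "restr (cantor_act \<delta> y) m = restr (cantor_act \<delta> x) m"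
      unfolding restr_def
    proof (rule map_cong[OF refl])
      fix i assume "i \<in> set [0..<m]"
      then have "i \<noteq> m" by simp
      then have "x i = y i" using m(1) by blast
      then show "cantor_act \<delta> y i = cantor_act \<delta> x i" by (simp add: cantor_act_apply)
    qed
    then have "(point 0 y, point 0 x) \<in> graph_act act (comb \<gamma> \<delta>) (F n)"
      using point_edge_forward[OF d n yx km \<open>\<not> y m\<close>] m(2) by simp
    then show ?thesis by (rule graph_sym[OF image_graph_in[OF fd]])
  qed
next
  let ?G = "graph_act act (comb \<gamma> \<delta>) (F n)"
  assume edge: "(point 0 x, point 0 y) \<in> ?G"
  have fd: "finite \<delta>" using d finite_subset by blast
  have G: "?G \<in> \<G>" by (rule image_graph_in[OF fd])
  obtain \<epsilon> where \<epsilon>: "finite \<epsilon>" "point 0 y = act \<epsilon> (point 0 x)" using graph_orbit[OF G edge] by blast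
  have fin: "finite {i. x i \<noteq> y i}" using orbit_reflection[OF \<epsilon>] by (rule conjunct1)
  then have "finite (insert k {i. x i \<noteq> y i})" by simp
  \<comment> \<open>Beyond all differences both points come from the same point of level
    \<open>m\<close>, as the invariant requires.\<close>
  then obtain m where m: "\<forall>i\<in>insert k {i. x i \<noteq> y i}. i < m" using finite_nat_set_iff_bounded by blast
  define s t u where "s = prefix x m" and "t = prefix y m" and "u = point m x"
  have st: "s \<subseteq> {..<m}" "t \<subseteq> {..<m}" unfolding s_def t_def by (rule prefix_subset)+
  have D: "sym_diff s t = {i. x i \<noteq> y i}" unfolding s_def t_def sym_diff_prefix using m by auto
  have uy: "point m y = u" unfolding u_def
  proof (rule point_cong)
    fix i assume "m \<le> i"
    then have "\<not> i < m" by simp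
    then show "y i = x i" using m by auto
  qed
  have e: "(act (comb \<gamma> s) u, act (comb \<gamma> t) u) \<in> ?G"
    using edge point_0[of x m] point_0[of y m] unfolding uy s_def t_def u_def by simp
  have "s \<noteq> t"
  proof
    assume "s = t"
    then show False using e graph_irrefl[OF G] by simp
  qed
  have sub: "sym_diff s t \<subseteq> {k..}"
  proof
    fix i assume "i \<in> sym_diff s t"
    then have "x i \<noteq> y i" unfolding D by simp
    then show "i \<in> {k..}" using same[of i] by force
  qed
  have Gk: "?G \<in> orbit_family \<gamma> F k" unfolding orbit_family_def using d n by blast
  have ore: "only_realized_edges m \<gamma> R F (g m ` K m)" using good[of m] by (simp add: good_def)
  have "k \<le> m" using m by simp
  from only_realized_edgesD[OF ore this Gk st \<open>s \<noteq> t\<close> sub _ e]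
  obtain j where j: "sym_diff s t = {j}" "graph_act act (comb \<gamma> (s \<inter> {..<j})) ?G = R j"
    using point_mem[of m x] unfolding u_def by blast
  have kj: "k \<le> j" using sub unfolding j(1) by simp
  have jm: "j < m" using j(1) st by blast
  have sj: "s \<inter> {..<j} = prefix x j" unfolding s_def prefix_def using jm by auto
  have dj: "\<delta> \<subseteq> {..<j}" using d kj by auto
  have eqR: "graph_act act (comb \<gamma> (sym_diff (prefix x j) \<delta>)) (F n) = R j"
    using j(2) unfolding sj graph_act_graph_act[OF finite_comb_generators[OF finite_prefix] finite_comb_generators[OF fd]]
      comb_sym_diff[OF finite_prefix fd] .
  \<comment> \<open>Otherwise stage \<open>j\<close> would realize the new graph \<open>F j\<close>,
    which lies in none of the orbits considered before, whereas \<open>R j\<close> is a translate of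
    \<open>F n\<close> with \<open>n < j\<close>.\<close>
  have "\<exists>n' t'. n' < j \<and> t' \<in> b n' \<and> length t' = j"
  proof (rule ccontr)
    assume "\<not> ?thesis"
    then have "R j = F j" using realized[of j] next_graph_eq[of j] unfolding realized_spec_def by metis
    moreover have "F j \<notin> orbit_family \<gamma> F j"
      using next_graph(2)[OF G] next_graph_eq[of j] by metis
    moreover have "sym_diff (prefix x j) \<delta> \<subseteq> {..<j}" using dj prefix_subset by blast
    then have "R j \<in> orbit_family \<gamma> F j"
      unfolding eqR[symmetric] orbit_family_def using n kj by fastforce
    ultimately show False by simp
  qed
  then obtain n' t' where t': "n' < j" "t' \<in> b n'" "length t' = j" by blast
  then have "R j = graph_act act (comb \<gamma> (true_positions t')) (F n')"
    using realized[of j] unfolding realized_spec_def by blast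
  then have "sym_diff (prefix x j) \<delta> = true_positions t' \<and> n = n'"
    using eqR finite_prefix fd finite_true_positions by (intro image_graph_inj) auto
  then have "true_positions (restr (cantor_act \<delta> x) j) = true_positions t'" "n' = n"
    using true_positions_restr[OF dj] by simp_all
  then have "restr (cantor_act \<delta> x) j = t'" using t'(3) by (intro true_positions_inj) (simp_all add: length_restr)
  then have "restr (cantor_act \<delta> x) j \<in> b n" using t'(2) \<open>n' = n\<close> by simp
  then show "(x, y) \<in> graph_act cantor_act \<delta> (cantor_graph (b n))"
    unfolding cantor_graph_edge_iff using j(1) D by blast
qed

text \<open>The pieces are the clopen sets of points with the same first \<open>k\<close> digits,
  where \<open>k\<close> exceeds \<open>n\<close> and all elements of \<delta>. They are numbered by
  \<open>set_encode\<close>; pieces with other numbers are empty.\<close>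

lemma near_reduction_point:
  assumes "finite \<delta>"
  shows "near_reduction (point 0) (graph_act cantor_act \<delta> (cantor_graph (b n)))
    (graph_act act (comb \<gamma> \<delta>) (F n))"
proof -
  have "finite (insert n \<delta>)" using assms by simp
  then obtain k where k: "\<forall>i\<in>insert n \<delta>. i < k" using finite_nat_set_iff_bounded by blast
  define B where "B i = {z. set_encode (prefix z k) = i}" for i
  have "B i \<in> sets borel" for i
  proof -
    have "cylinder z k \<subseteq> B i" if "z \<in> B i" for z
    proof
      fix z' assume "z' \<in> cylinder z k"
      then have "prefix z' k = prefix z k" by (auto simp: prefix_def cylinder_def)
      then show "z' \<in> B i" using that by (simp add: B_def)
    qed
    then have "B i = (\<Union>z\<in>B i. cylinder z k)" using mem_cylinder_self by blast
    then have "open (B i)" by (metis open_UN open_cylinder)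
    then show ?thesis by (rule borel_open)
  qed
  moreover have "disjoint_family B" unfolding disjoint_family_on_def B_def by blast
  moreover have "(\<Union>i. B i) = UNIV" unfolding B_def by blast
  moreover have "reduction_on (B i) (point 0) (graph_act cantor_act \<delta> (cantor_graph (b n)))
    (graph_act act (comb \<gamma> \<delta>) (F n))" for i
    unfolding reduction_on_def
  proof (intro ballI)
    fix x y assume "x \<in> B i" "y \<in> B i"
    then have "set_encode (prefix x k) = set_encode (prefix y k)" by (simp add: B_def)
    then have "prefix x k = prefix y k" using set_encode_eq finite_prefix by blast
    then have "x i = y i" if "i < k" for i
      using that unfolding prefix_def set_eq_iff mem_Collect_eq by blast
    moreover have "\<delta> \<subseteq> {..<k}" "n < k" using k by auto
    ultimately show "((x, y) \<in> graph_act cantor_act \<delta> (cantor_graph (b n))) =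
        ((point 0 x, point 0 y) \<in> graph_act act (comb \<gamma> \<delta>) (F n))"
      using point_edge_iff by blast
  qed
  ultimately show ?thesis unfolding near_reduction_def by blast
qed

section \<open>The correspondence of the two families\<close>

text \<open>One edge suffices: its place of difference \<open>m\<close> lies beyond \<delta> and
  \<open>\<delta>'\<close>, so \<open>m\<close> reveals \<open>n\<close> by disjointness of the sets
  \<open>a n\<close>, and the unique string of length \<open>m\<close> in \<open>b n\<close> reveals
  the translation.\<close>

lemma cantor_graph_inj:
  assumes d: "finite \<delta>" "finite \<delta>'"
    and eq: "graph_act cantor_act \<delta> (cantor_graph (b n)) = graph_act cantor_act \<delta>' (cantor_graph (b n'))"
  shows "\<delta> = \<delta>' \<and> n = n'"
proof -
  have disj: "disjoint_family a"
    and dense: "\<And>n s. \<exists>u. s @ u \<in> b n" and level: "\<And>n t. t \<in> b n \<Longrightarrow> length t \<in> a n"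
    and unique: "\<And>n s t. s \<in> b n \<Longrightarrow> t \<in> b n \<Longrightarrow> length s = length t \<Longrightarrow> s = t"
    using parameters unfolding graph_parameters_def by (simp_all, blast)
  have "finite (\<delta> \<union> \<delta>')" using d by simp
  then obtain N where N: "\<forall>i\<in>\<delta> \<union> \<delta>'. i < N" using finite_nat_set_iff_bounded by blast
  obtain u where u: "replicate N False @ u \<in> b n" using dense[of "replicate N False" n] by blast
  define t where "t = replicate N False @ u"
  define m where "m = length t"
  have "N \<le> m" by (simp add: m_def t_def)
  then have "i < m" if "i \<in> \<delta> \<union> \<delta>'" for i using N that by (meson less_le_trans)
  then have sub: "\<delta> \<subseteq> {..<m}" "\<delta>' \<subseteq> {..<m}" by auto
  define x where "x = cantor_act \<delta> (\<lambda>i. i < m \<and> t ! i)"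
  define y where "y = cantor_act {m} x"
  have xy: "{i. x i \<noteq> y i} = {m}" by (auto simp: y_def cantor_act_apply)
  have tx: "restr (cantor_act \<delta> x) m = t"
    unfolding x_def cantor_act_twice by (rule nth_equalityI) (simp_all add: restr_def m_def)
  have "restr (cantor_act \<delta> x) m \<in> b n" unfolding tx using u by (simp only: t_def)
  with xy have "(x, y) \<in> graph_act cantor_act \<delta> (cantor_graph (b n))"
    unfolding cantor_graph_edge_iff by (intro exI[of _ m] conjI)
  then have "(x, y) \<in> graph_act cantor_act \<delta>' (cantor_graph (b n'))" unfolding eq .
  then obtain m' where m': "{i. x i \<noteq> y i} = {m'}" "restr (cantor_act \<delta>' x) m' \<in> b n'"
    unfolding cantor_graph_edge_iff by blast
  then have tx': "restr (cantor_act \<delta>' x) m \<in> b n'" using xy by simp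
  then have "m \<in> a n'" using level[OF tx'] by (simp add: length_restr)
  moreover have "m \<in> a n" using level[OF u] by (simp add: m_def t_def)
  ultimately have n: "n = n'" using disj unfolding disjoint_family_on_def by blast
  have tb: "t \<in> b n'" using u unfolding n t_def .
  have "restr (cantor_act \<delta>' x) m = t"
    by (rule unique[OF tx' tb]) (simp only: length_restr m_def)
  then have "sym_diff (prefix x m) \<delta>' = sym_diff (prefix x m) \<delta>"
    using tx true_positions_restr[OF sub(1)] true_positions_restr[OF sub(2)] by metis
  then have "\<delta> = \<delta>'" by blast
  then show ?thesis using n by blast
qed

text \<open>Both families are indexed bijectively by the pairs of a group element and a number, and
  \<open>\<pi>\<close> matches equal indices.\<close>

lemma exists_family_near_reduction:
  "\<exists>\<pi>. family_near_reduction (point 0) \<pi> (cantor_family b) \<G>"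
proof -
  define P :: "(nat set \<times> nat) set" where "P = Collect finite \<times> UNIV"
  define H where "H = (\<lambda>p. graph_act cantor_act (fst p) (cantor_graph (b (snd p))))"
  define I where "I = (\<lambda>p. graph_act act (comb \<gamma> (fst p)) (F (snd p)))"
  have "inj_on H P"
  proof (rule inj_onI)
    fix p q assume pq: "p \<in> P" "q \<in> P" "H p = H q"
    then have "fst p = fst q \<and> snd p = snd q" unfolding H_def P_def by (intro cantor_graph_inj) auto
    then show "p = q" by (simp add: prod_eq_iff)
  qed
  moreover have "H ` P = cantor_family b"
  proof (intro equalityI subsetI)
    fix E assume "E \<in> cantor_family b"
    then obtain \<delta> n where "finite \<delta>" "E = H (\<delta>, n)" by (auto simp: cantor_family_def Delta_def H_def)
    then show "E \<in> H ` P" by (auto simp: P_def)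
  qed (auto simp: cantor_family_def Delta_def H_def P_def)
  ultimately have bH: "bij_betw H P (cantor_family b)" by (simp add: bij_betw_def)
  have "inj_on I P"
  proof (rule inj_onI)
    fix p q assume pq: "p \<in> P" "q \<in> P" "I p = I q"
    then have "fst p = fst q \<and> snd p = snd q" unfolding I_def P_def by (intro image_graph_inj) auto
    then show "p = q" by (simp add: prod_eq_iff)
  qed
  moreover have "I ` P = \<G>"
  proof (intro equalityI subsetI)
    fix G assume "G \<in> \<G>"
    then obtain \<delta> n where "finite \<delta>" "G = graph_act act (comb \<gamma> \<delta>) (F n)" by (rule image_graph_surj)
    then have "G = I (\<delta>, n)" "(\<delta>, n) \<in> P" by (simp_all add: I_def P_def)
    then show "G \<in> I ` P" by blast
  qed (auto simp: I_def P_def intro: image_graph_in)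
  ultimately have bI: "bij_betw I P \<G>" by (simp add: bij_betw_def)
  define \<pi> where "\<pi> = I \<circ> inv_into P H"
  have "bij_betw \<pi> (cantor_family b) \<G>"
    unfolding \<pi>_def using bij_betw_inv_into[OF bH] bI by (rule bij_betw_trans)
  moreover have "near_reduction (point 0) E (\<pi> E)" if "E \<in> cantor_family b" for E
  proof -
    have "E \<in> H ` P" using that bij_betw_imp_surj_on[OF bH] by simp
    then obtain p where p: "p \<in> P" "E = H p" by blast
    then have "\<pi> E = I p" unfolding \<pi>_def using bij_betw_inv_into_left[OF bH p(1)] by simp
    moreover have "finite (fst p)" using p(1) by (auto simp: P_def)
    ultimately show ?thesis unfolding p(2) H_def I_def using near_reduction_point by simp
  qed
  ultimately show ?thesis
    unfolding family_near_reduction_def using continuous_point inj_point by blast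
qed

lemma range_point: "range (point 0) \<subseteq> g 0 ` K 0"
  using point_mem by blast

end

section \<open>The dichotomy\<close>

text \<open>Preimages of Borel anticliques, cut by the pieces of the near reduction, are Borel
  anticliques of the corresponding Cantor graphs. Surjectivity of \<open>\<pi>\<close> provides
  these graphs, and countably many such sets would cover the Cantor space.\<close>

lemma graph_ideal_no_near_reduction:
  assumes par: "graph_parameters a b" and A: "A \<in> graph_ideal \<G>"
    and red: "family_near_reduction h \<pi> (cantor_family b) \<G>" and range: "range h \<subseteq> A"
  shows False
proof -
  obtain C where C: "countable C" "C \<subseteq> borel_anticliques \<G>" "A \<subseteq> \<Union>C"
    using A unfolding graph_ideal_iff countably_covered_def by blast
  have h: "continuous_on UNIV h" and \<pi>: "bij_betw \<pi> (cantor_family b) \<G>"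
    and near: "\<And>H. H \<in> cantor_family b \<Longrightarrow> near_reduction h H (\<pi> H)"
    using red unfolding family_near_reduction_def by blast+
  have "\<forall>S\<in>C. \<exists>p :: nat \<Rightarrow> (nat \<Rightarrow> bool) set. (\<Union>n. p n) = UNIV \<and>
      (\<forall>n. p n \<in> sets borel \<and> (\<exists>H\<in>cantor_family b. anticlique H (h -` S \<inter> p n)))"
  proof
    fix S assume "S \<in> C"
    then obtain G where G: "G \<in> \<G>" "anticlique G S" using C(2) unfolding borel_anticliques_def by blast
    then obtain H where H: "H \<in> cantor_family b" "\<pi> H = G" using \<pi> unfolding bij_betw_def by blast
    obtain p :: "nat \<Rightarrow> (nat \<Rightarrow> bool) set" where p: "\<forall>n. p n \<in> sets borel" "(\<Union>n. p n) = UNIV"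
      "\<forall>n. reduction_on (p n) h H (\<pi> H)"
      using near[OF H(1)] unfolding near_reduction_def by blast
    have "anticlique H (h -` S \<inter> p n)" for n
      unfolding anticlique_def
    proof (intro ballI notI)
      fix x y assume xy: "x \<in> h -` S \<inter> p n" "y \<in> h -` S \<inter> p n" "(x, y) \<in> H"
      then have "(h x, h y) \<in> G" using p(3) unfolding reduction_on_def H(2) by blast
      then show False using xy G(2) unfolding anticlique_def by blast
    qed
    then show "\<exists>p :: nat \<Rightarrow> (nat \<Rightarrow> bool) set. (\<Union>n. p n) = UNIV \<and>
      (\<forall>n. p n \<in> sets borel \<and> (\<exists>H\<in>cantor_family b. anticlique H (h -` S \<inter> p n)))"
      using p(1,2) H(1) by (intro exI[of _ p]) blast
  qed
  from bchoice[OF this] obtain p where p: "\<forall>S\<in>C. (\<Union>n. p S n) = (UNIV :: (nat \<Rightarrow> bool) set) \<and>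
      (\<forall>n :: nat. p S n \<in> sets borel \<and> (\<exists>H\<in>cantor_family b. anticlique H (h -` S \<inter> p S n)))"
    by (elim exE)
  define \<K> where "\<K> = (\<lambda>k. h -` fst k \<inter> p (fst k) (snd k)) ` (C \<times> UNIV)"
  show False
  proof (rule no_cantor_anticlique_cover[OF par, of \<K>])
    show "countable \<K>" unfolding \<K>_def using C(1) by (intro countable_image countable_SIGMA) auto
    show "\<Union>\<K> = UNIV"
    proof (intro equalityI subsetI)
      fix z :: "nat \<Rightarrow> bool"
      obtain S where S: "S \<in> C" "h z \<in> S" using range C(3) by blast
      then have "(\<Union>n. p S n) = UNIV" using p by blast
      then obtain n where "z \<in> p S n" by blast
      then have "z \<in> h -` fst (S, n) \<inter> p (fst (S, n)) (snd (S, n))" using S(2) by simp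
      then show "z \<in> \<Union>\<K>" unfolding \<K>_def using S(1) by blast
    qed simp
    fix L assume "L \<in> \<K>"
    then obtain S n where L: "S \<in> C" "L = h -` S \<inter> p S n" unfolding \<K>_def by auto
    have "S \<in> sets borel" using L(1) C(2) unfolding borel_anticliques_def by blast
    moreover have "h \<in> borel_measurable borel" using h by (rule borel_measurable_continuous_onI)
    ultimately have "h -` S \<in> sets borel" by (metis measurable_sets_borel)
    then show "L \<in> sets borel \<and> (\<exists>H\<in>cantor_family b. anticlique H L)"
      using p L by (simp add: sets.Int)
  qed
qed

theorem theorem4p18:
  fixes act :: "nat set \<Rightarrow> 'a \<Rightarrow> 'a::polish_space"
    and \<G> :: "('a \<times> 'a) set set"
    and A :: "'a set"
    and a :: "nat \<Rightarrow> nat set"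
    and b :: "nat \<Rightarrow> bool list set"
  assumes parameters: "graph_parameters a b"
    and free_act: "free_action Delta UNIV act"
    and continuous_act: "continuous_action Delta act"
    and countable_family: "countable \<G>"
    and nonempty_family: "\<G> \<noteq> {}"
    and closed_graphs: "\<And>G. G \<in> \<G> \<Longrightarrow> closed_graph G"
    and edges: "\<And>G. G \<in> \<G> \<Longrightarrow> edges_in_orbits Delta act G"
    and free_family: "free_over_action Delta act \<G>"
    and analytic: "analytic A"
  shows "(A \<in> graph_ideal \<G>) \<longleftrightarrow>
         \<not> (\<exists>h \<pi>. family_near_reduction h \<pi> (cantor_family b) \<G> \<and> range h \<subseteq> A)"
proof -
  have carrier: "\<gamma> \<in> carrier Delta \<longleftrightarrow> finite \<gamma>" for \<gamma> by (simp add: Delta_def)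
  have ga: "group_action Delta UNIV act" and stab: "\<And>x. stabilizer Delta act x = {\<one>\<^bsub>Delta\<^esub>}"
    using free_act unfolding free_action_def by auto
  have one: "\<one>\<^bsub>Delta\<^esub> = {}" and mult: "\<gamma> \<otimes>\<^bsub>Delta\<^esub> \<delta> = sym_diff \<gamma> \<delta>" for \<gamma> \<delta>
    by (simp_all add: Delta_def)
  have invariant: "\<And>\<gamma> G. \<gamma> \<in> carrier Delta \<Longrightarrow> G \<in> \<G> \<Longrightarrow> graph_act act \<gamma> G \<in> \<G>"
    and free: "\<And>\<gamma> G. \<gamma> \<in> carrier Delta \<Longrightarrow> G \<in> \<G> \<Longrightarrow> \<gamma> \<noteq> \<one>\<^bsub>Delta\<^esub> \<Longrightarrow> graph_act act \<gamma> G \<noteq> G"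
    and chromatic: "\<And>G G'. G \<in> \<G> \<Longrightarrow> G' \<in> \<G> \<Longrightarrow> G \<noteq> G' \<Longrightarrow> borel_chromatic_number (G \<inter> G') \<le>o natLeq"
    using free_family unfolding free_over_action_def by simp_all
  interpret free_graph_family act \<G>
  proof (unfold_locales)
    fix \<gamma> \<delta> :: "nat set" and x assume "finite \<gamma>" "finite \<delta>"
    then show "act \<gamma> (act \<delta> x) = act (sym_diff \<gamma> \<delta>) x"
      using group_action.composition_rule[OF ga, of x \<gamma> \<delta>] carrier mult by simp
  next
    fix x show "act {} x = x"
      using group_action.id_eq_one[OF ga] unfolding one by (metis restrict_UNIV)
  next
    fix \<gamma> :: "nat set" and x assume "finite \<gamma>" "act \<gamma> x = x"
    then have "\<gamma> \<in> stabilizer Delta act x" unfolding stabilizer_def carrier[symmetric] by simp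
    then show "\<gamma> = {}" unfolding stab one by simp
  next
    fix \<gamma> :: "nat set" assume "finite \<gamma>"
    then show "continuous_on UNIV (act \<gamma>)"
      using continuous_act carrier unfolding continuous_action_def by simp
  next
    show "countable \<G>" by (rule countable_family)
  next
    fix G x y assume G: "G \<in> \<G>" "(x, y) \<in> G"
    then show "(y, x) \<in> G" using closed_graphs unfolding closed_graph_def is_graph_def by (meson symD)
    show "\<exists>\<gamma>. finite \<gamma> \<and> y = act \<gamma> x"
      using edges[OF G(1)] G(2) carrier unfolding edges_in_orbits_def orbit_def by auto
  next
    fix G x assume "G \<in> \<G>"
    then show "(x, x) \<notin> G" using closed_graphs unfolding closed_graph_def is_graph_def by (meson irreflD)
  next
    fix G assume "G \<in> \<G>"
    then show "closedin (top_of_set (- Id)) G" using closed_graphs unfolding closed_graph_def by blast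
  next
    fix \<gamma> :: "nat set" and G assume "finite \<gamma>" "G \<in> \<G>"
    then show "graph_act act \<gamma> G \<in> \<G>" using invariant carrier by simp
  next
    fix \<gamma> :: "nat set" and G assume "finite \<gamma>" "G \<in> \<G>" "graph_act act \<gamma> G = G"
    then show "\<gamma> = {}" using free[of \<gamma> G] unfolding carrier one by blast
  next
    fix G G' assume G: "G \<in> \<G>" "G' \<in> \<G>" "G \<noteq> G'"
    then have "borel_chromatic_number (G \<inter> G') \<le>o natLeq" by (rule chromatic)
    moreover have "irrefl (G \<inter> G')"
      using closed_graphs[OF G(1)] unfolding closed_graph_def is_graph_def irrefl_def by blast
    ultimately show "\<exists>C. countable C \<and> borel_anticlique_cover (G \<inter> G') C"
      by (simp add: countable_borel_chromatic_number_iff)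
  qed
  obtain G0 where G0: "G0 \<in> \<G>" using nonempty_family by blast
  show ?thesis
  proof
    assume "A \<in> graph_ideal \<G>"
    then show "\<not> (\<exists>h \<pi>. family_near_reduction h \<pi> (cantor_family b) \<G> \<and> range h \<subseteq> A)"
      using graph_ideal_no_near_reduction[OF parameters] by blast
  next
    assume no: "\<not> (\<exists>h \<pi>. family_near_reduction h \<pi> (cantor_family b) \<G> \<and> range h \<subseteq> A)"
    show "A \<in> graph_ideal \<G>"
    proof (rule ccontr)
      assume "A \<notin> graph_ideal \<G>"
      then have "pos \<G> A" using analytic analytic_imp_souslin by (simp add: pos_def)
      then obtain \<gamma> R F K g where seq: "fusion_sequence act \<G> a b \<gamma> R F K g" and A: "g 0 ` K 0 = A"
        using exists_fusion_sequence[OF parameters G0] by blast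
      interpret fusion_sequence act \<G> a b \<gamma> R F K g by (rule seq)
      show False using exists_family_near_reduction range_point no unfolding A by blast
    qed
  qed
qed

end
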